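(* Let $\mathbf S$ be any category whose objects are symmetric monoidal categories and whose morphisms are functors that are at least lax symmetric monoidal (with the usual composition). Then $\mathbf S$ supports an underlying multicategory functor: there is a functor $U$ from $\mathbf S$ to the category of multicategories and multifunctors sending each object $\mathcal C$ to an underlying multicategory $U\mathcal C=U_\kappa\mathcal C$ of $\mathcal C$ and each morphism $F:\mathcal C\to\mathcal D$ to the multifunctor $UF:U\mathcal C\to U\mathcal D$ induced by $F$.
   Context: "Multicategory" means symmetric multicategory (with right actions $\sigma^*:M(\mathbf x;y)\to M(\sigma^{-1}\mathbf x;y)$, $\sigma\in\Sigma_n$, where $\sigma^{-1}\mathbf x=(x_{\sigma(1)},\dots,x_{\sigma(n)})$, units, and an associative, unital, equivariant multiproduct $\Gamma$); a multifunctor is a map on objects and morphism sets preserving identities, composition and symmetric group actions. $\odot$ denotes concatenation of tuples. A symmetric monoidal category $(\mathcal C,\oplus,e_{\mathcal C})$ has unit isomorphism $c_a:a\oplus e_{\mathcal C}\to a$, associator $\alpha$ and symmetry $\tau$. A lax symmetric monoidal functor $F:\mathcal C\to\mathcal D$ is a functor with a map $\eta:e_{\mathcal D}\to Fe_{\mathcal C}$ and natural maps $\xi:Fa\oplus Fb\to F(a\oplus b)$ satisfying $F(c_a)\circ\xi\circ(1\oplus\eta)=c_{Fa}$, $F(\alpha)\circ\xi\circ(\xi\oplus1)=\xi\circ(1\oplus\xi)\circ\alpha$ and $F(\tau)\circ\xi=\xi\circ\tau$; "at least lax" allows for instance only strong or only strict ones as morphisms. The categorical operad $Y$. The objects of $Y$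 form the free symmetric operad of sets on a generator $0$ of arity $0$ and a generator $m$ of arity $2$. Concretely an object $w$ of $Y(n)$ is a complete binary parenthesization of a list of $k\ge\max(n,1)$ slots, with the variables $x_1,\dots,x_n$ placed each exactly once, in any order, in $n$ of the slots, and the remaining slots filled by the symbol $e$. The operad unit $1\in Y(1)$ is the word $x_1$; $0\in Y(0)$ is the word $e$; $m\in Y(2)$ is the word $x_1\oplus x_2$. Between any two objects of $Y(n)$ there is exactly one morphism, which is therefore an isomorphism. $Y$ acts on every symmetric monoidal category $\mathcal C$: an object $w\in Y(n)$ gives the functor $w:\mathcal C^n\to\mathcal C$ evaluating the word, and the unique morphism $w\to w'$ gives the canonical natural isomorphism built from $\alpha$, $c$, $\tau$ and inverses (unique by coherence). The operad composition $\gamma$ of $Y$ is substitution, so $\gamma(w;w_1,\dots,w_n)(\odot_s\mathbf x_s)=w(w_1(\mathbf x_1),\dots,w_n(\mathbf x_n))$, and the right $\Sigma_n$-action on $Y(n)$ satisfies $(w\cdot\sigma)(\sigma^{-1}\mathbf x)=w(\mathbf x)$. Underlying multicategories. Let $\kappa_n:\mathrm{Ob}\,\mathcal C^n\to\mathrm{Ob}\,Y(n)$, $n\ge0$, be any sequence of functions; put $\bar\kappa\mathbf x=\kappa_n(\mathbf x)(\mathbf x)$. The multicategory $U_\kappa\mathcal C$ has the objects of $\mathcal C$, and $U_\kappa\mathcal C(\mathbf x;y)=\mathcal C(\bar\kappa\mathbf x,y)$ (elements tagged by the source tuple). - Identities: the map $\bar\kappa(a)\to a$ induced by the unique isomorphism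 $\kappa_1(a)\to1$ in $Y(1)$. - Symmetric group action: $\sigma^*f=f\circ\theta(\mathbf x,\sigma)$, with $\theta(\mathbf x,\sigma):\bar\kappa(\sigma^{-1}\mathbf x)\to(\kappa_n(\mathbf x)\cdot\sigma)(\sigma^{-1}\mathbf x)=\bar\kappa\mathbf x$ induced by the unique isomorphism $\kappa_n(\sigma^{-1}\mathbf x)\to\kappa_n(\mathbf x)\cdot\sigma$. - Composition: $\Gamma(g;f_1,\dots,f_n)=g\circ\kappa_n(\mathbf y)(f_1,\dots,f_n)\circ\phi$ for $g\in\mathcal C(\bar\kappa\mathbf y,z)$, $f_s\in\mathcal C(\bar\kappa\mathbf x_s,y_s)$, $\mathbf x_s$ a $j_s$-tuple, $j=\sum_sj_s$, with $\phi:\bar\kappa(\odot_s\mathbf x_s)\to\kappa_n(\mathbf y)(\bar\kappa\mathbf x_1,\dots,\bar\kappa\mathbf x_n)$ induced by the unique isomorphism $\kappa_j(\odot_s\mathbf x_s)\to\gamma(\kappa_n(\mathbf y);\kappa_{j_1}(\mathbf x_1),\dots,\kappa_{j_n}(\mathbf x_n))$. For two sequences $\kappa,\lambda$ the canonical isomorphism $U_\kappa\mathcal C\to U_\lambda\mathcal C$ is the identity on objects and sends $f\in\mathcal C(\bar\kappa\mathbf x,y)$ to its composite with the isomorphism $\bar\lambda\mathbf x\to\bar\kappa\mathbf x$ induced by the unique isomorphism $\lambda_n(\mathbf x)\to\kappa_n(\mathbf x)$. The induced multifunctor $UF$. Let $k_0=0$, $k_1=1$, $k_n=\gamma(m;k_{n-1},1)$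 for $n\ge2$, regarded as constant functions, with $\bar k\mathbf x=k_n(\mathbf x)$. For lax symmetric monoidal $F:\mathcal C\to\mathcal D$ and $\mathbf x\in\mathrm{Ob}\,\mathcal C^n$, with $F\mathbf x=(Fx_1,\dots,Fx_n)$, define $\xi_n:\bar kF\mathbf x\to F\bar k\mathbf x$ by $\xi_0=\eta$, $\xi_1=\mathrm{id}$, and $\xi_n=\xi\circ(\xi_{n-1}\oplus1)$ for $n\ge2$. Then $U_kF:U_k\mathcal C\to U_k\mathcal D$ is $F$ on objects and sends $f\in\mathcal C(\bar k\mathbf x,y)$ to $F(f)\circ\xi_n$. For arbitrary choices $U\mathcal C$, $U\mathcal D$ of underlying multicategories, $UF$ is the composite $U\mathcal C\cong U_k\mathcal C\xrightarrow{U_kF}U_k\mathcal D\cong U\mathcal D$ with the canonical isomorphisms. *)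

theory Defs
  imports "HOL-Library.FuncSet" "HOL-Combinatorics.Permutations"
begin

section \<open>Categories and functors\<close>

record ('o, 'm) cat =
  Obj :: "'o set"
  Arr :: "'m set"
  Dom :: "'m \<Rightarrow> 'o"
  Cod :: "'m \<Rightarrow> 'o"
  Ident :: "'o \<Rightarrow> 'm"  (\<open>\<i>\<index>\<close>)
  Comp :: "'m \<Rightarrow> 'm \<Rightarrow> 'm"  (infixl \<open>\<cdot>\<index>\<close> 70)

definition hom :: "('o, 'm, 'z) cat_scheme \<Rightarrow> 'o \<Rightarrow> 'o \<Rightarrow> 'm set" where
  "hom C a b = {f \<in> Arr C. Dom C f = a \<and> Cod C f = b}"

locale category =
  fixes C :: "('o, 'm, 'z) cat_scheme" (structure)
  assumes Dom_Obj: "f \<in> Arr C \<Longrightarrow> Dom C f \<in> Obj C"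
    and Cod_Obj: "f \<in> Arr C \<Longrightarrow> Cod C f \<in> Obj C"
    and Ident_hom: "a \<in> Obj C \<Longrightarrow> \<i> a \<in> hom C a a"
    and Comp_hom: "\<lbrakk>g \<in> hom C b c; f \<in> hom C a b\<rbrakk> \<Longrightarrow> g \<cdot> f \<in> hom C a c"
    and Comp_Ident_left: "f \<in> hom C a b \<Longrightarrow> \<i> b \<cdot> f = f"
    and Comp_Ident_right: "f \<in> hom C a b \<Longrightarrow> f \<cdot> \<i> a = f"
    and Comp_assoc: "\<lbrakk>h \<in> hom C c d; g \<in> hom C b c; f \<in> hom C a b\<rbrakk>
      \<Longrightarrow> (h \<cdot> g) \<cdot> f = h \<cdot> (g \<cdot> f)"

definition inverse_arrows :: "('o, 'm, 'z) cat_scheme \<Rightarrow> 'm \<Rightarrow> 'm \<Rightarrow> bool" where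
  "inverse_arrows C f g \<longleftrightarrow>
    f \<in> hom C (Dom C f) (Cod C f) \<and> g \<in> hom C (Cod C f) (Dom C f) \<and>
    Comp C g f = Ident C (Dom C f) \<and> Comp C f g = Ident C (Cod C f)"

definition iso_hom :: "('o, 'm, 'z) cat_scheme \<Rightarrow> 'o \<Rightarrow> 'o \<Rightarrow> 'm set" where
  "iso_hom C a b = {f \<in> hom C a b. \<exists>g. inverse_arrows C f g}"

locale cat_functor = A: category A + B: category B
  for A :: "('o, 'm, 'z) cat_scheme" and B :: "('p, 'n, 'y) cat_scheme" +
  fixes Fo :: "'o \<Rightarrow> 'p" and Fa :: "'m \<Rightarrow> 'n"
  assumes functor_Obj: "a \<in> Obj A \<Longrightarrow> Fo a \<in> Obj B"
    and functor_hom: "f \<in> hom A a b \<Longrightarrow> Fa f \<in> hom B (Fo a) (Fo b)"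
    and functor_Ident: "a \<in> Obj A \<Longrightarrow> Fa (Ident A a) = Ident B (Fo a)"
    and functor_Comp: "\<lbrakk>g \<in> hom A b c; f \<in> hom A a b\<rbrakk>
      \<Longrightarrow> Fa (Comp A g f) = Comp B (Fa g) (Fa f)"

definition subcategory :: "('o, 'm) cat \<Rightarrow> ('o, 'm) cat \<Rightarrow> bool" where
  "subcategory S T \<longleftrightarrow> category S \<and> Obj S \<subseteq> Obj T \<and> Arr S \<subseteq> Arr T \<and>
    (\<forall>f\<in>Arr S. Dom S f = Dom T f \<and> Cod S f = Cod T f) \<and>
    (\<forall>a\<in>Obj S. Ident S a = Ident T a) \<and>
    (\<forall>f\<in>Arr S. \<forall>g\<in>Arr S. Cod S f = Dom S g \<longrightarrow> Comp S g f = Comp T g f)"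


section \<open>Symmetric monoidal categories and lax symmetric monoidal functors\<close>

record ('o, 'm) smc = "('o, 'm) cat" +
  Tensor :: "'o \<Rightarrow> 'o \<Rightarrow> 'o"  (infixl \<open>\<oplus>\<index>\<close> 75)
  TensorM :: "'m \<Rightarrow> 'm \<Rightarrow> 'm"  (infixl \<open>\<uplus>\<index>\<close> 75)
  UnitOb :: "'o"  (\<open>\<e>\<index>\<close>)
  Assoc :: "'o \<Rightarrow> 'o \<Rightarrow> 'o \<Rightarrow> 'm"  (\<open>\<alpha>\<index>\<close>)
  RUnit :: "'o \<Rightarrow> 'm"  (\<open>\<c>\<index>\<close>)
  Symm :: "'o \<Rightarrow> 'o \<Rightarrow> 'm"  (\<open>\<tau>\<index>\<close>)

text \<open>
  The left unit isomorphism is not a separate datum: it is \<open>\<c> a \<cdot> \<tau> \<e> a : \<e> \<oplus> a \<rightarrow> a\<close>,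
  and this is how it enters the triangle axiom.
\<close>

locale symmetric_monoidal_category = category C
  for C :: "('o, 'm) smc" (structure) +
  assumes Unit_Obj: "\<e> \<in> Obj C"
    and Tensor_Obj: "\<lbrakk>a \<in> Obj C; b \<in> Obj C\<rbrakk> \<Longrightarrow> a \<oplus> b \<in> Obj C"
    and TensorM_hom: "\<lbrakk>f \<in> hom C a a'; g \<in> hom C b b'\<rbrakk> \<Longrightarrow> f \<uplus> g \<in> hom C (a \<oplus> b) (a' \<oplus> b')"
    and TensorM_Ident: "\<lbrakk>a \<in> Obj C; b \<in> Obj C\<rbrakk> \<Longrightarrow> \<i> a \<uplus> \<i> b = \<i> (a \<oplus> b)"
    and TensorM_Comp: "\<lbrakk>f \<in> hom C a a'; f' \<in> hom C a' a''; g \<in> hom C b b'; g' \<in> hom C b' b''\<rbrakk>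
      \<Longrightarrow> (f' \<cdot> f) \<uplus> (g' \<cdot> g) = (f' \<uplus> g') \<cdot> (f \<uplus> g)"
    and Assoc_iso: "\<lbrakk>a \<in> Obj C; b \<in> Obj C; c \<in> Obj C\<rbrakk>
      \<Longrightarrow> \<alpha> a b c \<in> iso_hom C ((a \<oplus> b) \<oplus> c) (a \<oplus> (b \<oplus> c))"
    and RUnit_iso: "a \<in> Obj C \<Longrightarrow> \<c> a \<in> iso_hom C (a \<oplus> \<e>) a"
    and Symm_hom: "\<lbrakk>a \<in> Obj C; b \<in> Obj C\<rbrakk> \<Longrightarrow> \<tau> a b \<in> hom C (a \<oplus> b) (b \<oplus> a)"
    and Assoc_natural: "\<lbrakk>f \<in> hom C a a'; g \<in> hom C b b'; h \<in> hom C c c'\<rbrakk>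
      \<Longrightarrow> \<alpha> a' b' c' \<cdot> ((f \<uplus> g) \<uplus> h) = (f \<uplus> (g \<uplus> h)) \<cdot> \<alpha> a b c"
    and RUnit_natural: "f \<in> hom C a a' \<Longrightarrow> \<c> a' \<cdot> (f \<uplus> \<i> \<e>) = f \<cdot> \<c> a"
    and Symm_natural: "\<lbrakk>f \<in> hom C a a'; g \<in> hom C b b'\<rbrakk>
      \<Longrightarrow> \<tau> a' b' \<cdot> (f \<uplus> g) = (g \<uplus> f) \<cdot> \<tau> a b"
    and pentagon: "\<lbrakk>a \<in> Obj C; b \<in> Obj C; c \<in> Obj C; d \<in> Obj C\<rbrakk>
      \<Longrightarrow> \<alpha> a b (c \<oplus> d) \<cdot> \<alpha> (a \<oplus> b) c d
        = (\<i> a \<uplus> \<alpha> b c d) \<cdot> \<alpha> a (b \<oplus> c) d \<cdot> (\<alpha> a b c \<uplus> \<i> d)"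
    and triangle: "\<lbrakk>a \<in> Obj C; b \<in> Obj C\<rbrakk>
      \<Longrightarrow> (\<i> a \<uplus> (\<c> b \<cdot> \<tau> \<e> b)) \<cdot> \<alpha> a \<e> b = \<c> a \<uplus> \<i> b"
    and hexagon: "\<lbrakk>a \<in> Obj C; b \<in> Obj C; c \<in> Obj C\<rbrakk>
      \<Longrightarrow> \<alpha> b c a \<cdot> \<tau> a (b \<oplus> c) \<cdot> \<alpha> a b c
        = (\<i> b \<uplus> \<tau> a c) \<cdot> \<alpha> b a c \<cdot> (\<tau> a b \<uplus> \<i> c)"
    and Symm_Symm: "\<lbrakk>a \<in> Obj C; b \<in> Obj C\<rbrakk> \<Longrightarrow> \<tau> b a \<cdot> \<tau> a b = \<i> (a \<oplus> b)"

text \<open>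
  A lax functor carries its source and target, and its components are extensional
  (\<open>undefined\<close> off their domains), so that equality of records is equality of lax functors.
\<close>

record ('o, 'm) lax =
  lax_dom :: "('o, 'm) smc"
  lax_cod :: "('o, 'm) smc"
  lax_ob :: "'o \<Rightarrow> 'o"
  lax_arr :: "'m \<Rightarrow> 'm"
  lax_eta :: "'m"
  lax_xi :: "'o \<times> 'o \<Rightarrow> 'm"

locale lax_symmetric_monoidal_functor =
  C: symmetric_monoidal_category C + D: symmetric_monoidal_category D +
  cat_functor C D "lax_ob F" "lax_arr F"
  for C D :: "('o, 'm) smc" and F :: "('o, 'm) lax" +
  assumes lax_dom: "lax_dom F = C"
    and lax_cod: "lax_cod F = D"
    and lax_ob_ext: "lax_ob F \<in> extensional (Obj C)"
    and lax_arr_ext: "lax_arr F \<in> extensional (Arr C)"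
    and lax_xi_ext: "lax_xi F \<in> extensional (Obj C \<times> Obj C)"
    and eta_hom: "lax_eta F \<in> hom D \<e>\<^bsub>D\<^esub> (lax_ob F \<e>\<^bsub>C\<^esub>)"
    and xi_hom: "\<lbrakk>a \<in> Obj C; b \<in> Obj C\<rbrakk>
      \<Longrightarrow> lax_xi F (a, b) \<in> hom D (lax_ob F a \<oplus>\<^bsub>D\<^esub> lax_ob F b) (lax_ob F (a \<oplus>\<^bsub>C\<^esub> b))"
    and xi_natural: "\<lbrakk>f \<in> hom C a a'; g \<in> hom C b b'\<rbrakk>
      \<Longrightarrow> lax_xi F (a', b') \<cdot>\<^bsub>D\<^esub> (lax_arr F f \<uplus>\<^bsub>D\<^esub> lax_arr F g)
        = lax_arr F (f \<uplus>\<^bsub>C\<^esub> g) \<cdot>\<^bsub>D\<^esub> lax_xi F (a, b)"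
    and xi_unit: "a \<in> Obj C
      \<Longrightarrow> lax_arr F (\<c>\<^bsub>C\<^esub> a) \<cdot>\<^bsub>D\<^esub> lax_xi F (a, \<e>\<^bsub>C\<^esub>) \<cdot>\<^bsub>D\<^esub> (\<i>\<^bsub>D\<^esub> (lax_ob F a) \<uplus>\<^bsub>D\<^esub> lax_eta F)
        = \<c>\<^bsub>D\<^esub> (lax_ob F a)"
    and xi_assoc: "\<lbrakk>a \<in> Obj C; b \<in> Obj C; c \<in> Obj C\<rbrakk>
      \<Longrightarrow> lax_arr F (\<alpha>\<^bsub>C\<^esub> a b c) \<cdot>\<^bsub>D\<^esub> lax_xi F (a \<oplus>\<^bsub>C\<^esub> b, c) \<cdot>\<^bsub>D\<^esub> (lax_xi F (a, b) \<uplus>\<^bsub>D\<^esub> \<i>\<^bsub>D\<^esub> (lax_ob F c))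
        = lax_xi F (a, b \<oplus>\<^bsub>C\<^esub> c) \<cdot>\<^bsub>D\<^esub> (\<i>\<^bsub>D\<^esub> (lax_ob F a) \<uplus>\<^bsub>D\<^esub> lax_xi F (b, c))
            \<cdot>\<^bsub>D\<^esub> \<alpha>\<^bsub>D\<^esub> (lax_ob F a) (lax_ob F b) (lax_ob F c)"
    and xi_symm: "\<lbrakk>a \<in> Obj C; b \<in> Obj C\<rbrakk>
      \<Longrightarrow> lax_arr F (\<tau>\<^bsub>C\<^esub> a b) \<cdot>\<^bsub>D\<^esub> lax_xi F (a, b)
        = lax_xi F (b, a) \<cdot>\<^bsub>D\<^esub> \<tau>\<^bsub>D\<^esub> (lax_ob F a) (lax_ob F b)"

definition lax_id :: "('o, 'm) smc \<Rightarrow> ('o, 'm) lax" where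
  "lax_id C = \<lparr>lax_dom = C, lax_cod = C,
     lax_ob = (\<lambda>a\<in>Obj C. a), lax_arr = (\<lambda>f\<in>Arr C. f),
     lax_eta = \<i>\<^bsub>C\<^esub> \<e>\<^bsub>C\<^esub>, lax_xi = (\<lambda>(a, b)\<in>Obj C \<times> Obj C. \<i>\<^bsub>C\<^esub> (a \<oplus>\<^bsub>C\<^esub> b))\<rparr>"

definition lax_comp :: "('o, 'm) lax \<Rightarrow> ('o, 'm) lax \<Rightarrow> ('o, 'm) lax" where
  "lax_comp G F = \<lparr>lax_dom = lax_dom F, lax_cod = lax_cod G,
     lax_ob = compose (Obj (lax_dom F)) (lax_ob G) (lax_ob F),
     lax_arr = compose (Arr (lax_dom F)) (lax_arr G) (lax_arr F),
     lax_eta = lax_arr G (lax_eta F) \<cdot>\<^bsub>lax_cod G\<^esub> lax_eta G,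
     lax_xi = (\<lambda>(a, b)\<in>Obj (lax_dom F) \<times> Obj (lax_dom F).
       lax_arr G (lax_xi F (a, b)) \<cdot>\<^bsub>lax_cod G\<^esub> lax_xi G (lax_ob F a, lax_ob F b))\<rparr>"

definition SMCat_lax :: "(('o, 'm) smc, ('o, 'm) lax) cat" where
  "SMCat_lax = \<lparr>Obj = {C. symmetric_monoidal_category C},
     Arr = {F. lax_symmetric_monoidal_functor (lax_dom F) (lax_cod F) F},
     Dom = lax_dom, Cod = lax_cod, Ident = lax_id, Comp = lax_comp\<rparr>"


section \<open>Symmetric multicategories\<close>

text \<open>
  \<open>MAct M \<sigma> f\<close> is \<open>\<sigma>\<^sup>* f\<close>. A permutation \<open>\<sigma> \<in> \<Sigma>\<^sub>n\<close> is a function permuting \<open>{..<n}\<close>, and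
  \<open>permute_list \<sigma> xs\<close> is the tuple with entries \<open>xs ! \<sigma> i\<close>, i.e. \<open>\<sigma>\<^sup>-\<^sup>1 xs\<close>.
\<close>

record ('o, 'f) mcat =
  MObj :: "'o set"
  MArr :: "'f set"
  MSrc :: "'f \<Rightarrow> 'o list"
  MTgt :: "'f \<Rightarrow> 'o"
  MId :: "'o \<Rightarrow> 'f"
  MComp :: "'f \<Rightarrow> 'f list \<Rightarrow> 'f"
  MAct :: "(nat \<Rightarrow> nat) \<Rightarrow> 'f \<Rightarrow> 'f"

definition mhom :: "('o, 'f) mcat \<Rightarrow> 'o list \<Rightarrow> 'o \<Rightarrow> 'f set" where
  "mhom M xs y = {f \<in> MArr M. MSrc M f = xs \<and> MTgt M f = y}"

definition mcomposable :: "('o, 'f) mcat \<Rightarrow> 'f \<Rightarrow> 'f list \<Rightarrow> bool" where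
  "mcomposable M g fs \<longleftrightarrow> g \<in> MArr M \<and> set fs \<subseteq> MArr M \<and> map (MTgt M) fs = MSrc M g"

text \<open>
  \<open>blocks [j\<^sub>1,\<dots>,j\<^sub>n]\<close> cuts \<open>0,\<dots>,j\<^sub>1+\<dots>+j\<^sub>n-1\<close> into consecutive blocks of lengths
  \<open>j\<^sub>1,\<dots>,j\<^sub>n\<close>. \<open>block_perm \<sigma> js\<close> moves the blocks as \<open>\<sigma>\<close> prescribes,
  keeping the order inside each block: it satisfies
  \<open>permute_list (block_perm \<sigma> js) (concat xss) = concat (permute_list \<sigma> xss)\<close> for lists \<open>xss\<close>
  with lengths \<open>js\<close>. \<open>sum_perm \<rho>s js\<close> is the block sum \<open>\<rho>\<^sub>1 \<oplus> \<dots> \<oplus> \<rho>\<^sub>n\<close>.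
\<close>

definition blocks :: "nat list \<Rightarrow> nat list list" where
  "blocks js = map (\<lambda>s. [sum_list (take s js) ..< sum_list (take (Suc s) js)]) [0..<length js]"

definition block_perm :: "(nat \<Rightarrow> nat) \<Rightarrow> nat list \<Rightarrow> nat \<Rightarrow> nat" where
  "block_perm \<sigma> js p =
    (if p < sum_list js then concat (permute_list \<sigma> (blocks js)) ! p else p)"

definition sum_perm :: "(nat \<Rightarrow> nat) list \<Rightarrow> nat list \<Rightarrow> nat \<Rightarrow> nat" where
  "sum_perm \<rho>s js p =
    (if p < sum_list js then concat (map2 permute_list \<rho>s (blocks js)) ! p else p)"

locale multicategory =
  fixes M :: "('o, 'f) mcat"
  assumes MSrc_MObj: "f \<in> MArr M \<Longrightarrow> set (MSrc M f) \<subseteq> MObj M"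
    and MTgt_MObj: "f \<in> MArr M \<Longrightarrow> MTgt M f \<in> MObj M"
    and MId_mhom: "a \<in> MObj M \<Longrightarrow> MId M a \<in> mhom M [a] a"
    and MComp_mhom: "mcomposable M g fs
      \<Longrightarrow> MComp M g fs \<in> mhom M (concat (map (MSrc M) fs)) (MTgt M g)"
    and MAct_mhom: "\<lbrakk>f \<in> mhom M xs y; \<sigma> permutes {..<length xs}\<rbrakk>
      \<Longrightarrow> MAct M \<sigma> f \<in> mhom M (permute_list \<sigma> xs) y"
    and MComp_MId_left: "f \<in> MArr M \<Longrightarrow> MComp M (MId M (MTgt M f)) [f] = f"
    and MComp_MId_right: "f \<in> MArr M \<Longrightarrow> MComp M f (map (MId M) (MSrc M f)) = f"
    and MComp_assoc: "\<lbrakk>mcomposable M h gs; list_all2 (mcomposable M) gs fss\<rbrakk>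
      \<Longrightarrow> MComp M (MComp M h gs) (concat fss) = MComp M h (map2 (MComp M) gs fss)"
    and MAct_id: "f \<in> MArr M \<Longrightarrow> MAct M id f = f"
    and MAct_MAct: "\<lbrakk>f \<in> mhom M xs y; \<sigma> permutes {..<length xs}; \<rho> permutes {..<length xs}\<rbrakk>
      \<Longrightarrow> MAct M \<rho> (MAct M \<sigma> f) = MAct M (\<sigma> \<circ> \<rho>) f"
    and MComp_MAct_outer: "\<lbrakk>mcomposable M g fs; \<sigma> permutes {..<length fs}\<rbrakk>
      \<Longrightarrow> MComp M (MAct M \<sigma> g) (permute_list \<sigma> fs)
        = MAct M (block_perm \<sigma> (map (\<lambda>f. length (MSrc M f)) fs)) (MComp M g fs)"
    and MComp_MAct_inner: "\<lbrakk>mcomposable M g fs;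
        list_all2 (\<lambda>\<rho> f. \<rho> permutes {..<length (MSrc M f)}) \<rho>s fs\<rbrakk>
      \<Longrightarrow> MComp M g (map2 (MAct M) \<rho>s fs)
        = MAct M (sum_perm \<rho>s (map (\<lambda>f. length (MSrc M f)) fs)) (MComp M g fs)"

record ('o, 'f) mfun =
  mf_dom :: "('o, 'f) mcat"
  mf_cod :: "('o, 'f) mcat"
  mf_ob :: "'o \<Rightarrow> 'o"
  mf_arr :: "'f \<Rightarrow> 'f"

locale multifunctor = M: multicategory M + N: multicategory N
  for M N :: "('o, 'f) mcat" and F :: "('o, 'f) mfun" +
  assumes mf_dom: "mf_dom F = M"
    and mf_cod: "mf_cod F = N"
    and mf_ob_ext: "mf_ob F \<in> extensional (MObj M)"
    and mf_arr_ext: "mf_arr F \<in> extensional (MArr M)"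
    and mf_ob_MObj: "a \<in> MObj M \<Longrightarrow> mf_ob F a \<in> MObj N"
    and mf_arr_mhom: "f \<in> mhom M xs y \<Longrightarrow> mf_arr F f \<in> mhom N (map (mf_ob F) xs) (mf_ob F y)"
    and mf_arr_MId: "a \<in> MObj M \<Longrightarrow> mf_arr F (MId M a) = MId N (mf_ob F a)"
    and mf_arr_MComp: "mcomposable M g fs
      \<Longrightarrow> mf_arr F (MComp M g fs) = MComp N (mf_arr F g) (map (mf_arr F) fs)"
    and mf_arr_MAct: "\<lbrakk>f \<in> mhom M xs y; \<sigma> permutes {..<length xs}\<rbrakk>
      \<Longrightarrow> mf_arr F (MAct M \<sigma> f) = MAct N \<sigma> (mf_arr F f)"

definition mf_id :: "('o, 'f) mcat \<Rightarrow> ('o, 'f) mfun" where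
  "mf_id M = \<lparr>mf_dom = M, mf_cod = M, mf_ob = (\<lambda>a\<in>MObj M. a), mf_arr = (\<lambda>f\<in>MArr M. f)\<rparr>"

definition mf_comp :: "('o, 'f) mfun \<Rightarrow> ('o, 'f) mfun \<Rightarrow> ('o, 'f) mfun" where
  "mf_comp G F = \<lparr>mf_dom = mf_dom F, mf_cod = mf_cod G,
     mf_ob = compose (MObj (mf_dom F)) (mf_ob G) (mf_ob F),
     mf_arr = compose (MArr (mf_dom F)) (mf_arr G) (mf_arr F)\<rparr>"

definition Multicat :: "(('o, 'f) mcat, ('o, 'f) mfun) cat" where
  "Multicat = \<lparr>Obj = {M. multicategory M}, Arr = {F. multifunctor (mf_dom F) (mf_cod F) F},
     Dom = mf_dom, Cod = mf_cod, Ident = mf_id, Comp = mf_comp\<rparr>"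


section \<open>The categorical operad Y and its action\<close>

text \<open>
  The variables \<open>x\<^sub>1,\<dots>,x\<^sub>n\<close> of a word are \<open>YVar 0,\<dots>,YVar (n-1)\<close>. The morphisms of \<open>Y(n)\<close> need
  no encoding, as there is exactly one between any two objects.
\<close>

datatype yword = YE | YVar nat | YSum yword yword

primrec yvars :: "yword \<Rightarrow> nat list" where
  "yvars YE = []"
| "yvars (YVar i) = [i]"
| "yvars (YSum u v) = yvars u @ yvars v"

definition Y_obj :: "nat \<Rightarrow> yword set" where
  "Y_obj n = {w. distinct (yvars w) \<and> set (yvars w) = {..<n}}"

abbreviation y_arity :: "yword \<Rightarrow> nat" where
  "y_arity w \<equiv> length (yvars w)"

abbreviation y_zero :: yword where "y_zero \<equiv> YE"
abbreviation y_one :: yword where "y_one \<equiv> YVar 0"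
abbreviation y_m :: yword where "y_m \<equiv> YSum (YVar 0) (YVar 1)"

primrec ysubst :: "(nat \<Rightarrow> yword) \<Rightarrow> yword \<Rightarrow> yword" where
  "ysubst s YE = YE"
| "ysubst s (YVar i) = s i"
| "ysubst s (YSum u v) = YSum (ysubst s u) (ysubst s v)"

text \<open>Operad composition: the variables of the \<open>i\<close>-th inner word are shifted past those of the
  preceding ones.\<close>

definition y_gamma :: "yword \<Rightarrow> yword list \<Rightarrow> yword" where
  "y_gamma w ws =
    ysubst (\<lambda>i. ysubst (\<lambda>j. YVar (sum_list (map y_arity (take i ws)) + j)) (ws ! i)) w"

text \<open>Right action, fixed by \<open>(w \<cdot> \<sigma>)(\<sigma>\<^sup>-\<^sup>1 xs) = w(xs)\<close>.\<close>

definition y_act :: "yword \<Rightarrow> (nat \<Rightarrow> nat) \<Rightarrow> yword" where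
  "y_act w \<sigma> = ysubst (\<lambda>i. YVar (inv \<sigma> i)) w"

primrec y_eval :: "('o, 'm) smc \<Rightarrow> yword \<Rightarrow> 'o list \<Rightarrow> 'o" where
  "y_eval C YE xs = \<e>\<^bsub>C\<^esub>"
| "y_eval C (YVar i) xs = xs ! i"
| "y_eval C (YSum u v) xs = y_eval C u xs \<oplus>\<^bsub>C\<^esub> y_eval C v xs"

primrec y_eval_arr :: "('o, 'm) smc \<Rightarrow> yword \<Rightarrow> 'm list \<Rightarrow> 'm" where
  "y_eval_arr C YE fs = \<i>\<^bsub>C\<^esub> \<e>\<^bsub>C\<^esub>"
| "y_eval_arr C (YVar i) fs = fs ! i"
| "y_eval_arr C (YSum u v) fs = y_eval_arr C u fs \<uplus>\<^bsub>C\<^esub> y_eval_arr C v fs"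

text \<open>
  \<open>canonical C xs w w' f\<close>: \<open>f\<close> is the component at \<open>xs\<close> of a natural isomorphism \<open>w \<rightarrow> w'\<close>
  built from \<open>\<alpha>\<close>, \<open>c\<close>, \<open>\<tau>\<close> and inverses. The relation is indexed by formal words, not by their
  values, so that coincidences among the entries of \<open>xs\<close> create no additional canonical maps.
\<close>

inductive canonical :: "('o, 'm) smc \<Rightarrow> 'o list \<Rightarrow> yword \<Rightarrow> yword \<Rightarrow> 'm \<Rightarrow> bool"
  for C :: "('o, 'm) smc" and xs :: "'o list" where
  canonical_id: "canonical C xs w w (\<i>\<^bsub>C\<^esub> (y_eval C w xs))"
| canonical_Assoc: "canonical C xs (YSum (YSum u v) w) (YSum u (YSum v w))
    (\<alpha>\<^bsub>C\<^esub> (y_eval C u xs) (y_eval C v xs) (y_eval C w xs))"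
| canonical_RUnit: "canonical C xs (YSum w YE) w (\<c>\<^bsub>C\<^esub> (y_eval C w xs))"
| canonical_Symm: "canonical C xs (YSum u v) (YSum v u) (\<tau>\<^bsub>C\<^esub> (y_eval C u xs) (y_eval C v xs))"
| canonical_inverse: "\<lbrakk>canonical C xs u v f; inverse_arrows C f g\<rbrakk> \<Longrightarrow> canonical C xs v u g"
| canonical_Comp: "\<lbrakk>canonical C xs v w g; canonical C xs u v f\<rbrakk>
    \<Longrightarrow> canonical C xs u w (g \<cdot>\<^bsub>C\<^esub> f)"
| canonical_Tensor: "\<lbrakk>canonical C xs u u' f; canonical C xs v v' g\<rbrakk>
    \<Longrightarrow> canonical C xs (YSum u v) (YSum u' v') (f \<uplus>\<^bsub>C\<^esub> g)"

text \<open>The map induced at \<open>xs\<close> by the unique morphism \<open>w \<rightarrow> w'\<close> of \<open>Y(n)\<close>; it is well defined for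
  \<open>w, w' \<in> Y_obj n\<close> by coherence.\<close>

definition y_can :: "('o, 'm) smc \<Rightarrow> yword \<Rightarrow> yword \<Rightarrow> 'o list \<Rightarrow> 'm" where
  "y_can C w w' xs = (THE f. canonical C xs w w' f)"


section \<open>Underlying multicategories and induced multifunctors\<close>

text \<open>
  The sequence \<open>\<kappa>\<^sub>n : Ob C\<^sup>n \<rightarrow> Ob Y(n)\<close> is a single function on lists, \<open>n\<close> being the length.
\<close>

definition word_choice :: "('o, 'm) smc \<Rightarrow> ('o list \<Rightarrow> yword) \<Rightarrow> bool" where
  "word_choice C \<kappa> \<longleftrightarrow> (\<forall>xs. set xs \<subseteq> Obj C \<longrightarrow> \<kappa> xs \<in> Y_obj (length xs))"

definition kbar :: "('o, 'm) smc \<Rightarrow> ('o list \<Rightarrow> yword) \<Rightarrow> 'o list \<Rightarrow> 'o" where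
  "kbar C \<kappa> xs = y_eval C (\<kappa> xs) xs"

definition underlying ::
  "('o, 'm) smc \<Rightarrow> ('o list \<Rightarrow> yword) \<Rightarrow> ('o, 'o list \<times> 'm) mcat" where
  "underlying C \<kappa> = \<lparr>
     MObj = Obj C,
     MArr = {(xs, f). set xs \<subseteq> Obj C \<and> f \<in> Arr C \<and> Dom C f = kbar C \<kappa> xs},
     MSrc = fst,
     MTgt = (\<lambda>(xs, f). Cod C f),
     MId = (\<lambda>a. ([a], y_can C (\<kappa> [a]) y_one [a])),
     MComp = (\<lambda>(ys, g) fs. let xss = map fst fs in
       (concat xss,
        g \<cdot>\<^bsub>C\<^esub> y_eval_arr C (\<kappa> ys) (map snd fs)
          \<cdot>\<^bsub>C\<^esub> y_can C (\<kappa> (concat xss)) (y_gamma (\<kappa> ys) (map \<kappa> xss)) (concat xss))),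
     MAct = (\<lambda>\<sigma> (xs, f). let xs' = permute_list \<sigma> xs in
       (xs', f \<cdot>\<^bsub>C\<^esub> y_can C (\<kappa> xs') (y_act (\<kappa> xs) \<sigma>) xs'))\<rparr>"

definition change_choice ::
  "('o, 'm) smc \<Rightarrow> ('o list \<Rightarrow> yword) \<Rightarrow> ('o list \<Rightarrow> yword) \<Rightarrow> ('o, 'o list \<times> 'm) mfun" where
  "change_choice C \<kappa> \<mu> = \<lparr>
     mf_dom = underlying C \<kappa>, mf_cod = underlying C \<mu>,
     mf_ob = (\<lambda>a\<in>Obj C. a),
     mf_arr = (\<lambda>(xs, f)\<in>MArr (underlying C \<kappa>). (xs, f \<cdot>\<^bsub>C\<^esub> y_can C (\<mu> xs) (\<kappa> xs) xs))\<rparr>"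

fun k_word :: "nat \<Rightarrow> yword" where
  "k_word 0 = y_zero"
| "k_word (Suc 0) = y_one"
| "k_word (Suc (Suc n)) = y_gamma y_m [k_word (Suc n), y_one]"

definition k_choice :: "'o list \<Rightarrow> yword" where
  "k_choice xs = k_word (length xs)"

text \<open>\<open>xi_n n F xs\<close> is \<open>\<xi>\<^sub>n\<close> at the \<open>n\<close>-tuple \<open>xs\<close>.\<close>

fun xi_n :: "nat \<Rightarrow> ('o, 'm) lax \<Rightarrow> 'o list \<Rightarrow> 'm" where
  "xi_n 0 F xs = lax_eta F"
| "xi_n (Suc 0) F xs = \<i>\<^bsub>lax_cod F\<^esub> (lax_ob F (hd xs))"
| "xi_n (Suc (Suc n)) F xs =
    lax_xi F (kbar (lax_dom F) k_choice (butlast xs), last xs)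
      \<cdot>\<^bsub>lax_cod F\<^esub> (xi_n (Suc n) F (butlast xs) \<uplus>\<^bsub>lax_cod F\<^esub> \<i>\<^bsub>lax_cod F\<^esub> (lax_ob F (last xs)))"

definition induced_k :: "('o, 'm) lax \<Rightarrow> ('o, 'o list \<times> 'm) mfun" where
  "induced_k F = \<lparr>
     mf_dom = underlying (lax_dom F) k_choice, mf_cod = underlying (lax_cod F) k_choice,
     mf_ob = (\<lambda>a\<in>Obj (lax_dom F). lax_ob F a),
     mf_arr = (\<lambda>(xs, f)\<in>MArr (underlying (lax_dom F) k_choice).
       (map (lax_ob F) xs, lax_arr F f \<cdot>\<^bsub>lax_cod F\<^esub> xi_n (length xs) F xs))\<rparr>"

definition induced ::
  "('o list \<Rightarrow> yword) \<Rightarrow> ('o list \<Rightarrow> yword) \<Rightarrow> ('o, 'm) lax \<Rightarrow> ('o, 'o list \<times> 'm) mfun" where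
  "induced \<kappa> \<mu> F =
    mf_comp (change_choice (lax_cod F) k_choice \<mu>)
      (mf_comp (induced_k F) (change_choice (lax_dom F) \<kappa> k_choice))"

end

theory Submission
  imports Defs
begin

text \<open>
  A map in the underlying multicategory is an arrow out of the value of one chosen word, and every
  structure map of that multicategory is a canonical isomorphism between values of words. Each
  multicategory axiom, and each statement about multifunctors, is therefore an equation between
  composites of given arrows and canonical maps. Canonical maps are natural
  (\<open>y_can_natural\<close>) and stable under substitution (\<open>canonical_gamma\<close>,
  \<open>canonical_gamma_inner\<close>, \<open>canonical_act\<close>), so they can all be collected at the source; both sides
  then differ only by two canonical maps between the same formal words, each variable occurring
  exactly once. By \<open>coherence\<close> there is exactly one such map, and the equation holds.

  Coherence is proved with normal forms. For finite sets \<open>P\<close> of variables let \<open>N P\<close> be the left-nested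
  sum of the variables in \<open>P\<close>. The maps \<open>merge : N P \<oplus> N Q \<rightarrow> N (P \<union> Q)\<close>, for disjoint \<open>P\<close> and \<open>Q\<close>, turn
  \<open>N\<close> into a symmetric monoidal functor on finite sets under disjoint union. Its associativity
  (\<open>merge_Assoc\<close>), unit (\<open>merge_RUnit\<close>) and symmetry (\<open>merge_Symm\<close>) laws imply that the map
  \<open>nf w : w \<rightarrow> N (vars w)\<close>, built by merging along the word \<open>w\<close>, absorbs the generators of the canonical
  maps: \<open>nf v \<cdot> f = nf u\<close> for every canonical \<open>f : u \<rightarrow> v\<close>. As \<open>nf v\<close> is invertible, \<open>f\<close> is determined.

  A lax functor \<open>F\<close> has a structure map \<open>\<xi>\<^sub>w : w(F xs) \<rightarrow> F(w xs)\<close> for every word \<open>w\<close>, not only for the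
  left-nested ones, and these maps commute with canonical maps (\<open>y_can_lax\<close>). Consequently the detour
  through the left-nested words in the definition of the induced multifunctor cancels: it sends
  \<open>(xs, f)\<close> to \<open>F f\<close> composed with \<open>\<xi>\<^sub>w\<close>, for \<open>w = \<kappa> xs\<close>, and one canonical map (\<open>induced_eq\<close>). In this
  form, compatibility with the multicategory structure (\<open>induced_multifunctor\<close>) and with identities
  and composites of lax functors (\<open>induced_lax_id\<close>, \<open>induced_lax_comp\<close>) again reduces to coherence.
\<close>

section \<open>Composition, isomorphisms and tensor products\<close>

context category
begin

lemma homD: "f \<in> hom C a b \<Longrightarrow> f \<in> Arr C \<and> Dom C f = a \<and> Cod C f = b"
  by (simp add: hom_def)

declare Dom_Obj [simp] Cod_Obj [simp]

text \<open>
  The axioms describe composites through \<open>hom\<close> and an intermediate object, which rewriting would have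
  to guess. Stated with \<open>Arr\<close>, \<open>Dom\<close> and \<open>Cod\<close>, the typing rules let the simplifier verify
  composability on its own.
\<close>

lemma Comp_typed [simp]:
  assumes "f \<in> Arr C" "g \<in> Arr C" "Dom C g = Cod C f"
  shows "g \<cdot> f \<in> Arr C" "Dom C (g \<cdot> f) = Dom C f" "Cod C (g \<cdot> f) = Cod C g"
  using Comp_hom[of g "Cod C f" "Cod C g" f "Dom C f"] assms by (auto simp: hom_def)

lemma Ident_typed [simp]:
  assumes "a \<in> Obj C"
  shows "\<i> a \<in> Arr C" "Dom C (\<i> a) = a" "Cod C (\<i> a) = a"
  using Ident_hom[OF assms] by (auto simp: hom_def)

lemma Ident_left [simp]: "\<lbrakk>f \<in> Arr C; Cod C f = b\<rbrakk> \<Longrightarrow> \<i> b \<cdot> f = f"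
  by (rule Comp_Ident_left[of f "Dom C f"]) (simp add: hom_def)

lemma Ident_right [simp]: "\<lbrakk>f \<in> Arr C; Dom C f = a\<rbrakk> \<Longrightarrow> f \<cdot> \<i> a = f"
  by (rule Comp_Ident_right[of f _ "Cod C f"]) (simp add: hom_def)

lemma assoc:
  assumes "f \<in> Arr C" "g \<in> Arr C" "h \<in> Arr C" "Dom C g = Cod C f" "Dom C h = Cod C g"
  shows "(h \<cdot> g) \<cdot> f = h \<cdot> (g \<cdot> f)"
  by (rule Comp_assoc[of h "Cod C g" "Cod C h" g "Cod C f" f "Dom C f"])
    (use assms in \<open>auto simp: hom_def\<close>)

text \<open>
  Composites are kept associated to the right, so an equation \<open>g \<cdot> f = k\<close> has to be applied in this
  form whenever it occurs in front of further arrows.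
\<close>

lemma rewrite_head:
  assumes "g \<cdot> f = k" "f \<in> Arr C" "g \<in> Arr C" "x \<in> Arr C" "Dom C g = Cod C f" "Dom C f = Cod C x"
  shows "g \<cdot> (f \<cdot> x) = k \<cdot> x"
  using assms assoc[of x f g] by simp

lemma inverse_arrowsD:
  assumes "inverse_arrows C f g"
  shows "f \<in> Arr C" "g \<in> Arr C" "Dom C g = Cod C f" "Cod C g = Dom C f"
    "g \<cdot> f = \<i> (Dom C f)" "f \<cdot> g = \<i> (Cod C f)"
  using assms by (auto simp: inverse_arrows_def hom_def)

lemma inverse_arrows_sym: "inverse_arrows C f g \<Longrightarrow> inverse_arrows C g f"
  by (auto simp: inverse_arrows_def hom_def)

lemma inverse_arrows_Comp:
  assumes "inverse_arrows C f f'" "inverse_arrows C g g'" "Dom C g = Cod C f"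
  shows "inverse_arrows C (g \<cdot> f) (f' \<cdot> g')"
proof -
  note F = inverse_arrowsD[OF assms(1)] and G = inverse_arrowsD[OF assms(2)]
  have "(f' \<cdot> g') \<cdot> (g \<cdot> f) = f' \<cdot> ((g' \<cdot> g) \<cdot> f)"
    using F(1-4) G(1-4) assms(3) by (simp add: assoc)
  moreover have "(g \<cdot> f) \<cdot> (f' \<cdot> g') = g \<cdot> ((f \<cdot> f') \<cdot> g')"
    using F(1-4) G(1-4) assms(3) by (simp add: assoc)
  ultimately show ?thesis
    using F G assms(3) by (simp add: inverse_arrows_def hom_def)
qed

definition iso :: "'m \<Rightarrow> bool" where "iso f \<longleftrightarrow> (\<exists>g. inverse_arrows C f g)"

definition inverse_arr :: "'m \<Rightarrow> 'm" where "inverse_arr f = (SOME g. inverse_arrows C f g)"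

lemma inverse_arrows_inverse_arr: "iso f \<Longrightarrow> inverse_arrows C f (inverse_arr f)"
  unfolding iso_def inverse_arr_def by (rule someI_ex)

lemma inverse_arr_typed [simp]:
  assumes "iso f"
  shows "inverse_arr f \<in> Arr C" "Dom C (inverse_arr f) = Cod C f"
    "Cod C (inverse_arr f) = Dom C f" "inverse_arr f \<cdot> f = \<i> (Dom C f)"
    "f \<cdot> inverse_arr f = \<i> (Cod C f)"
  using inverse_arrowsD[OF inverse_arrows_inverse_arr[OF assms]] by auto

lemma iso_Arr: "iso f \<Longrightarrow> f \<in> Arr C"
  by (auto simp: iso_def dest: inverse_arrowsD)

lemma iso_left_cancel:
  assumes "iso f" "f \<cdot> x = f \<cdot> y" "x \<in> Arr C" "y \<in> Arr C" "Cod C x = Dom C f" "Cod C y = Dom C f"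
  shows "x = y"
proof -
  have "(inverse_arr f \<cdot> f) \<cdot> x = (inverse_arr f \<cdot> f) \<cdot> y"
    using assms iso_Arr[OF assms(1)] by (simp add: assoc del: inverse_arr_typed(4,5))
  then show ?thesis using assms by simp
qed

lemma iso_right_cancel:
  assumes "iso f" "x \<cdot> f = y \<cdot> f" "x \<in> Arr C" "y \<in> Arr C" "Dom C x = Cod C f" "Dom C y = Cod C f"
  shows "x = y"
proof -
  have *: "(z \<cdot> f) \<cdot> inverse_arr f = z" if "z \<in> Arr C" "Dom C z = Cod C f" for z
    using that assms(1) iso_Arr[OF assms(1)] by (simp add: assoc)
  have "(x \<cdot> f) \<cdot> inverse_arr f = (y \<cdot> f) \<cdot> inverse_arr f" by (simp only: assms(2))
  then have "x = y" unfolding *[OF assms(3,5)] *[OF assms(4,6)] .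
  then show ?thesis using assms by simp
qed

lemma iso_Comp: "\<lbrakk>iso f; iso g; Dom C g = Cod C f\<rbrakk> \<Longrightarrow> iso (g \<cdot> f)"
  unfolding iso_def using inverse_arrows_Comp by blast

end

context symmetric_monoidal_category
begin

declare Unit_Obj [simp] Tensor_Obj [simp]

lemma TensorM_typed [simp]:
  assumes "f \<in> Arr C" "g \<in> Arr C"
  shows "f \<uplus> g \<in> Arr C" "Dom C (f \<uplus> g) = Dom C f \<oplus> Dom C g"
    "Cod C (f \<uplus> g) = Cod C f \<oplus> Cod C g"
  using TensorM_hom[of f "Dom C f" "Cod C f" g "Dom C g" "Cod C g"] assms
  by (auto simp: hom_def)

declare TensorM_Ident [simp]

lemma interchange:
  assumes "f \<in> Arr C" "f' \<in> Arr C" "g \<in> Arr C" "g' \<in> Arr C" "Dom C f' = Cod C f" "Dom C g' = Cod C g"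
  shows "(f' \<uplus> g') \<cdot> (f \<uplus> g) = (f' \<cdot> f) \<uplus> (g' \<cdot> g)"
  by (rule TensorM_Comp[symmetric, where a="Dom C f" and b="Dom C g"])
    (use assms in \<open>auto simp: hom_def\<close>)

lemma interchange_head:
  assumes "f \<in> Arr C" "f' \<in> Arr C" "g \<in> Arr C" "g' \<in> Arr C" "Dom C f' = Cod C f" "Dom C g' = Cod C g"
    "x \<in> Arr C" "Cod C x = Dom C f \<oplus> Dom C g"
  shows "(f' \<uplus> g') \<cdot> ((f \<uplus> g) \<cdot> x) = ((f' \<cdot> f) \<uplus> (g' \<cdot> g)) \<cdot> x"
  using assms by (intro rewrite_head interchange) auto

lemma Assoc_typed [simp]:
  assumes "a \<in> Obj C" "b \<in> Obj C" "c \<in> Obj C"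
  shows "\<alpha> a b c \<in> Arr C" "Dom C (\<alpha> a b c) = (a \<oplus> b) \<oplus> c" "Cod C (\<alpha> a b c) = a \<oplus> (b \<oplus> c)"
    "iso (\<alpha> a b c)"
  using Assoc_iso[OF assms] by (auto simp: iso_hom_def hom_def iso_def)

lemma RUnit_typed [simp]:
  assumes "a \<in> Obj C"
  shows "\<c> a \<in> Arr C" "Dom C (\<c> a) = a \<oplus> \<e>" "Cod C (\<c> a) = a" "iso (\<c> a)"
  using RUnit_iso[OF assms] by (auto simp: iso_hom_def hom_def iso_def)

lemma Symm_typed [simp]:
  assumes "a \<in> Obj C" "b \<in> Obj C"
  shows "\<tau> a b \<in> Arr C" "Dom C (\<tau> a b) = a \<oplus> b" "Cod C (\<tau> a b) = b \<oplus> a"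
  using Symm_hom[OF assms] by (auto simp: hom_def)

declare Symm_Symm [simp]

lemma Symm_iso [simp]: "\<lbrakk>a \<in> Obj C; b \<in> Obj C\<rbrakk> \<Longrightarrow> iso (\<tau> a b)"
  unfolding iso_def by (rule exI[of _ "\<tau> b a"]) (simp add: inverse_arrows_def hom_def)

lemma Assoc_nat:
  assumes "f \<in> Arr C" "g \<in> Arr C" "h \<in> Arr C"
  shows "\<alpha> (Cod C f) (Cod C g) (Cod C h) \<cdot> ((f \<uplus> g) \<uplus> h)
    = (f \<uplus> (g \<uplus> h)) \<cdot> \<alpha> (Dom C f) (Dom C g) (Dom C h)"
  by (rule Assoc_natural) (use assms in \<open>auto simp: hom_def\<close>)

lemma Symm_nat:
  assumes "f \<in> Arr C" "g \<in> Arr C"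
  shows "\<tau> (Cod C f) (Cod C g) \<cdot> (f \<uplus> g) = (g \<uplus> f) \<cdot> \<tau> (Dom C f) (Dom C g)"
  by (rule Symm_natural) (use assms in \<open>auto simp: hom_def\<close>)

lemma RUnit_nat: "f \<in> Arr C \<Longrightarrow> \<c> (Cod C f) \<cdot> (f \<uplus> \<i> \<e>) = f \<cdot> \<c> (Dom C f)"
  by (rule RUnit_natural) (auto simp: hom_def)

lemma inverse_arrows_TensorM:
  assumes "inverse_arrows C f f'" "inverse_arrows C g g'"
  shows "inverse_arrows C (f \<uplus> g) (f' \<uplus> g')"
  using inverse_arrowsD[OF assms(1)] inverse_arrowsD[OF assms(2)]
  by (auto simp: inverse_arrows_def hom_def interchange)

lemma iso_TensorM: "\<lbrakk>iso f; iso g\<rbrakk> \<Longrightarrow> iso (f \<uplus> g)"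
  unfolding iso_def using inverse_arrows_TensorM by blast

lemma iso_Ident: "a \<in> Obj C \<Longrightarrow> iso (\<i> a)"
  unfolding iso_def by (rule exI[of _ "\<i> a"]) (simp add: inverse_arrows_def hom_def)

lemma inverse_Assoc_nat:
  assumes "f \<in> Arr C" "g \<in> Arr C" "h \<in> Arr C"
  shows "inverse_arr (\<alpha> (Cod C f) (Cod C g) (Cod C h)) \<cdot> (f \<uplus> (g \<uplus> h))
    = ((f \<uplus> g) \<uplus> h) \<cdot> inverse_arr (\<alpha> (Dom C f) (Dom C g) (Dom C h))"
proof (rule iso_left_cancel[of "\<alpha> (Cod C f) (Cod C g) (Cod C h)"])
  let ?a = "\<alpha> (Cod C f) (Cod C g) (Cod C h)" and ?b = "\<alpha> (Dom C f) (Dom C g) (Dom C h)"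
  have "?a \<cdot> (inverse_arr ?a \<cdot> (f \<uplus> (g \<uplus> h))) = f \<uplus> (g \<uplus> h)"
    using assms by (subst rewrite_head[of _ _ "\<i> (Cod C ?a)"]) auto
  moreover have "?a \<cdot> (((f \<uplus> g) \<uplus> h) \<cdot> inverse_arr ?b) = (f \<uplus> (g \<uplus> h)) \<cdot> (?b \<cdot> inverse_arr ?b)"
    using assms by (subst rewrite_head[OF Assoc_nat]) (auto simp: assoc)
  ultimately show "?a \<cdot> (inverse_arr ?a \<cdot> (f \<uplus> (g \<uplus> h))) = ?a \<cdot> (((f \<uplus> g) \<uplus> h) \<cdot> inverse_arr ?b)"
    using assms by simp
qed (use assms in auto)

lemma inverse_pentagon:
  assumes "a \<in> Obj C" "b \<in> Obj C" "c \<in> Obj C" "d \<in> Obj C"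
  shows "inverse_arr (\<alpha> a (b \<oplus> c) d) \<cdot> ((\<i> a \<uplus> inverse_arr (\<alpha> b c d)) \<cdot> \<alpha> a b (c \<oplus> d))
    = (\<alpha> a b c \<uplus> \<i> d) \<cdot> inverse_arr (\<alpha> (a \<oplus> b) c d)" (is "?l = ?r")
proof (rule iso_left_cancel[of "(\<i> a \<uplus> \<alpha> b c d) \<cdot> \<alpha> a (b \<oplus> c) d"])
  have "(\<i> a \<uplus> \<alpha> b c d) \<cdot> \<alpha> a (b \<oplus> c) d \<cdot> ?l
    = ((\<i> a \<uplus> \<alpha> b c d) \<cdot> (\<i> a \<uplus> inverse_arr (\<alpha> b c d))) \<cdot> \<alpha> a b (c \<oplus> d)"
    using assms by (simp add: assoc rewrite_head[of "\<alpha> a (b \<oplus> c) d" "inverse_arr (\<alpha> a (b \<oplus> c) d)", OF inverse_arr_typed(5)])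
  also have "\<dots> = \<alpha> a b (c \<oplus> d)" using assms by (simp add: interchange)
  also have "\<dots> = (\<alpha> a b (c \<oplus> d) \<cdot> \<alpha> (a \<oplus> b) c d) \<cdot> inverse_arr (\<alpha> (a \<oplus> b) c d)"
    using assms by (simp add: assoc)
  also have "\<dots> = (\<i> a \<uplus> \<alpha> b c d) \<cdot> \<alpha> a (b \<oplus> c) d \<cdot> ?r"
    using assms by (simp add: assoc pentagon)
  finally show "(\<i> a \<uplus> \<alpha> b c d) \<cdot> \<alpha> a (b \<oplus> c) d \<cdot> ?l = (\<i> a \<uplus> \<alpha> b c d) \<cdot> \<alpha> a (b \<oplus> c) d \<cdot> ?r" .
  show "iso ((\<i> a \<uplus> \<alpha> b c d) \<cdot> \<alpha> a (b \<oplus> c) d)"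
    using assms by (intro iso_Comp iso_TensorM iso_Ident) auto
qed (use assms in auto)

text \<open>
  Tensoring with \<open>\<e>\<close> is naturally isomorphic to the identity. Equations between arrows may thus be
  checked after tensoring with \<open>\<e>\<close>, where the pentagon and the triangle apply.
\<close>

lemma tensor_unit_faithful:
  assumes "f \<uplus> \<i> \<e> = g \<uplus> \<i> \<e>" "f \<in> Arr C" "g \<in> Arr C" "Dom C f = Dom C g" "Cod C f = Cod C g"
  shows "f = g"
proof (rule iso_right_cancel[of "\<c> (Dom C f)"])
  show "f \<cdot> \<c> (Dom C f) = g \<cdot> \<c> (Dom C f)"
  proof -
    have "f \<cdot> \<c> (Dom C f) = \<c> (Cod C f) \<cdot> (f \<uplus> \<i> \<e>)" by (simp add: RUnit_nat assms(2))
    also have "\<dots> = \<c> (Cod C g) \<cdot> (g \<uplus> \<i> \<e>)" by (simp only: assms)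
    also have "\<dots> = g \<cdot> \<c> (Dom C f)" by (simp add: RUnit_nat assms(3,4))
    finally show ?thesis .
  qed
qed (use assms in auto)

lemma unit_tensor_faithful:
  assumes "\<i> \<e> \<uplus> f = \<i> \<e> \<uplus> g" "f \<in> Arr C" "g \<in> Arr C" "Dom C f = Dom C g" "Cod C f = Cod C g"
  shows "f = g"
proof (rule tensor_unit_faithful)
  show "f \<uplus> \<i> \<e> = g \<uplus> \<i> \<e>"
  proof (rule iso_right_cancel[of "\<tau> \<e> (Dom C f)"])
    show "(f \<uplus> \<i> \<e>) \<cdot> \<tau> \<e> (Dom C f) = (g \<uplus> \<i> \<e>) \<cdot> \<tau> \<e> (Dom C f)"
    proof -
      have "(f \<uplus> \<i> \<e>) \<cdot> \<tau> \<e> (Dom C f) = \<tau> \<e> (Cod C f) \<cdot> (\<i> \<e> \<uplus> f)"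
        using Symm_nat[of "\<i> \<e>" f] assms(2) by simp
      also have "\<dots> = \<tau> \<e> (Cod C g) \<cdot> (\<i> \<e> \<uplus> g)" by (simp only: assms)
      also have "\<dots> = (g \<uplus> \<i> \<e>) \<cdot> \<tau> \<e> (Dom C f)"
        using Symm_nat[of "\<i> \<e>" g] assms(3,4) by simp
      finally show ?thesis .
    qed
  qed (use assms in auto)
qed (use assms in auto)

text \<open>
  Kelly's argument: after tensoring with \<open>\<e>\<close> on the right, the two sides are connected by the pentagon
  for \<open>a, b, \<e>, \<e>\<close>, two triangles and the naturality of \<open>\<alpha>\<close>.
\<close>

lemma RUnit_Tensor:
  assumes "a \<in> Obj C" "b \<in> Obj C"
  shows "(\<i> a \<uplus> \<c> b) \<cdot> \<alpha> a b \<e> = \<c> (a \<oplus> b)"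
proof (rule tensor_unit_faithful)
  let ?l = "\<c> \<e> \<cdot> \<tau> \<e> \<e>"
  have "\<alpha> a b \<e> \<cdot> (\<c> (a \<oplus> b) \<uplus> \<i> \<e>) = \<alpha> a b \<e> \<cdot> ((\<i> (a \<oplus> b) \<uplus> ?l) \<cdot> \<alpha> (a \<oplus> b) \<e> \<e>)"
    using assms triangle[of "a \<oplus> b" \<e>] by simp
  also have "\<dots> = (\<i> a \<uplus> (\<i> b \<uplus> ?l)) \<cdot> (\<alpha> a b (\<e> \<oplus> \<e>) \<cdot> \<alpha> (a \<oplus> b) \<e> \<e>)"
    using assms rewrite_head[OF Assoc_nat[of "\<i> a" "\<i> b" ?l]] by (simp add: assoc)
  also have "\<dots> = ((\<i> a \<uplus> (\<i> b \<uplus> ?l)) \<cdot> (\<i> a \<uplus> \<alpha> b \<e> \<e>)) \<cdot> \<alpha> a (b \<oplus> \<e>) \<e> \<cdot> (\<alpha> a b \<e> \<uplus> \<i> \<e>)"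
    using assms pentagon[of a b \<e> \<e>] by (simp add: assoc)
  also have "\<dots> = (\<i> a \<uplus> (\<c> b \<uplus> \<i> \<e>)) \<cdot> \<alpha> a (b \<oplus> \<e>) \<e> \<cdot> (\<alpha> a b \<e> \<uplus> \<i> \<e>)"
    using assms triangle[of b \<e>] by (simp add: interchange)
  also have "\<dots> = \<alpha> a b \<e> \<cdot> (((\<i> a \<uplus> \<c> b) \<uplus> \<i> \<e>) \<cdot> (\<alpha> a b \<e> \<uplus> \<i> \<e>))"
    using assms rewrite_head[OF Assoc_nat[of "\<i> a" "\<c> b" "\<i> \<e>"]] by (simp add: assoc)
  also have "\<dots> = \<alpha> a b \<e> \<cdot> (((\<i> a \<uplus> \<c> b) \<cdot> \<alpha> a b \<e>) \<uplus> \<i> \<e>)"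
    using assms by (simp add: interchange)
  finally have *: "\<alpha> a b \<e> \<cdot> (\<c> (a \<oplus> b) \<uplus> \<i> \<e>) = \<dots>" .
  show "((\<i> a \<uplus> \<c> b) \<cdot> \<alpha> a b \<e>) \<uplus> \<i> \<e> = \<c> (a \<oplus> b) \<uplus> \<i> \<e>"
    by (rule iso_left_cancel[OF _ *[symmetric]]) (use assms in simp_all)
qed (use assms in auto)

text \<open>
  The left and right unit isomorphisms agree at \<open>\<e>\<close>. Naturality of \<open>\<c>\<close> at \<open>\<c> \<e>\<close> gives
  \<open>\<c> (\<e> \<oplus> \<e>) = \<c> \<e> \<uplus> \<i> \<e>\<close>; the triangle turns this into the claim tensored with \<open>\<e>\<close>.
\<close>

lemma RUnit_Unit_Symm: "\<c> \<e> \<cdot> \<tau> \<e> \<e> = \<c> \<e>"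
proof (rule unit_tensor_faithful)
  have "\<c> (\<e> \<oplus> \<e>) = \<c> \<e> \<uplus> \<i> \<e>"
    by (rule iso_left_cancel[of "\<c> \<e>"]) (use RUnit_nat[of "\<c> \<e>"] in auto)
  then have "(\<i> \<e> \<uplus> (\<c> \<e> \<cdot> \<tau> \<e> \<e>)) \<cdot> \<alpha> \<e> \<e> \<e> = (\<i> \<e> \<uplus> \<c> \<e>) \<cdot> \<alpha> \<e> \<e> \<e>"
    using triangle[of \<e> \<e>] RUnit_Tensor[of \<e> \<e>] by simp
  then show "\<i> \<e> \<uplus> (\<c> \<e> \<cdot> \<tau> \<e> \<e>) = \<i> \<e> \<uplus> \<c> \<e>"
    by (rule iso_right_cancel[rotated]) auto
qed auto

text \<open>
  This equation reverses a threefold tensor product in two ways. It arises by pasting the hexagon for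
  \<open>a, c, b\<close> and the inverse of the hexagon for \<open>c, a, b\<close> along the map \<open>\<i> a \<uplus> \<tau> b c\<close>.
\<close>

lemma reversed_hexagon:
  assumes "a \<in> Obj C" "b \<in> Obj C" "c \<in> Obj C"
  shows "\<alpha> c b a \<cdot> ((\<tau> b c \<uplus> \<i> a) \<cdot> (\<tau> a (b \<oplus> c) \<cdot> \<alpha> a b c)) = (\<i> c \<uplus> \<tau> a b) \<cdot> \<tau> (a \<oplus> b) c"
proof -
  have 1: "(\<tau> b c \<uplus> \<i> a) \<cdot> \<tau> a (b \<oplus> c) = \<tau> a (c \<oplus> b) \<cdot> (\<i> a \<uplus> \<tau> b c)"
    using assms Symm_nat[of "\<i> a" "\<tau> b c"] by simp
  have 2: "\<alpha> c b a \<cdot> (\<tau> a (c \<oplus> b) \<cdot> (\<alpha> a c b \<cdot> x)) = (\<i> c \<uplus> \<tau> a b) \<cdot> (\<alpha> c a b \<cdot> ((\<tau> a c \<uplus> \<i> b) \<cdot> x))"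
    if "x \<in> Arr C" "Cod C x = (a \<oplus> c) \<oplus> b" for x
    using arg_cong[OF hexagon[of a c b], of "\<lambda>y. y \<cdot> x"] assms that by (simp add: assoc)
  \<comment> \<open>the hexagon for \<open>c, a, b\<close>, solved for its side \<open>\<i> a \<uplus> \<tau> b c\<close>\<close>
  have 3: "\<i> a \<uplus> \<tau> b c = \<alpha> a c b \<cdot> ((\<tau> c a \<uplus> \<i> b) \<cdot> (inverse_arr (\<alpha> c a b) \<cdot> (\<tau> (a \<oplus> b) c \<cdot> inverse_arr (\<alpha> a b c))))"
    (is "_ = ?r")
  proof (rule iso_left_cancel[of "\<i> a \<uplus> \<tau> c b"])
    have "(\<i> a \<uplus> \<tau> c b) \<cdot> ?r = (\<alpha> a b c \<cdot> (\<tau> c (a \<oplus> b) \<cdot> \<alpha> c a b)) \<cdot> (inverse_arr (\<alpha> c a b) \<cdot> (\<tau> (a \<oplus> b) c \<cdot> inverse_arr (\<alpha> a b c)))"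
      using arg_cong[OF hexagon[of c a b], of "\<lambda>y. y \<cdot> (inverse_arr (\<alpha> c a b) \<cdot> (\<tau> (a \<oplus> b) c \<cdot> inverse_arr (\<alpha> a b c)))"] assms
      by (simp add: assoc)
    also have "\<dots> = \<i> (a \<oplus> (b \<oplus> c))"
      using assms by (simp add: assoc rewrite_head[OF inverse_arr_typed(5)] rewrite_head[OF Symm_Symm])
    finally show "(\<i> a \<uplus> \<tau> c b) \<cdot> (\<i> a \<uplus> \<tau> b c) = (\<i> a \<uplus> \<tau> c b) \<cdot> ?r"
      using assms by (simp add: interchange)
  qed (use assms in \<open>auto intro!: iso_TensorM iso_Ident\<close>)
  have 4: "(\<tau> a c \<uplus> \<i> b) \<cdot> ((\<tau> c a \<uplus> \<i> b) \<cdot> x) = x"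
    if "x \<in> Arr C" "Cod C x = (c \<oplus> a) \<oplus> b" for x
    using assms that by (simp add: interchange_head)
  have "\<alpha> c b a \<cdot> ((\<tau> b c \<uplus> \<i> a) \<cdot> (\<tau> a (b \<oplus> c) \<cdot> \<alpha> a b c))
    = \<alpha> c b a \<cdot> (\<tau> a (c \<oplus> b) \<cdot> ((\<i> a \<uplus> \<tau> b c) \<cdot> \<alpha> a b c))"
    using assms by (simp add: rewrite_head[OF 1] assoc)
  also have "\<dots> = (\<i> c \<uplus> \<tau> a b) \<cdot> \<tau> (a \<oplus> b) c"
    unfolding 3 using assms
    by (simp add: assoc 2 4 rewrite_head[OF inverse_arr_typed(5)])
  finally show ?thesis .
qed

text \<open>
  A multiplication that is symmetric and associative on the factors \<open>c, b, a\<close> is associative on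
  \<open>a, b, c\<close>: naturality of \<open>\<tau>\<close> reduces the claim to the previous lemma. The arrows \<open>p, q, p', q'\<close> are
  the partial multiplications; no uniformity between them is assumed, so that the lemma also applies
  to unit isomorphisms.
\<close>

lemma associative_reverse:
  assumes ob: "a \<in> Obj C" "b \<in> Obj C" "c \<in> Obj C"
    and p: "p \<in> hom C (b \<oplus> a) x" and q: "q \<in> hom C (c \<oplus> b) y"
    and p': "p' \<in> hom C (c \<oplus> x) z" and q': "q' \<in> hom C (y \<oplus> a) z"
    and eq: "p' \<cdot> ((\<i> c \<uplus> p) \<cdot> \<alpha> c b a) = q' \<cdot> (q \<uplus> \<i> a)"
  shows "(q' \<cdot> \<tau> a y) \<cdot> ((\<i> a \<uplus> (q \<cdot> \<tau> b c)) \<cdot> \<alpha> a b c)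
    = (p' \<cdot> \<tau> x c) \<cdot> ((p \<cdot> \<tau> a b) \<uplus> \<i> c)"
proof -
  note hs = p[THEN homD] q[THEN homD] p'[THEN homD] q'[THEN homD]
  have xy: "x \<in> Obj C" "y \<in> Obj C" using hs Cod_Obj by metis+
  have n: "\<tau> a y \<cdot> (\<i> a \<uplus> (q \<cdot> \<tau> b c)) = ((q \<cdot> \<tau> b c) \<uplus> \<i> a) \<cdot> \<tau> a (b \<oplus> c)"
    using Symm_nat[of "\<i> a" "q \<cdot> \<tau> b c"] ob hs by simp
  have "(q' \<cdot> \<tau> a y) \<cdot> ((\<i> a \<uplus> (q \<cdot> \<tau> b c)) \<cdot> \<alpha> a b c)
    = q' \<cdot> (((q \<cdot> \<tau> b c) \<uplus> \<i> a) \<cdot> (\<tau> a (b \<oplus> c) \<cdot> \<alpha> a b c))"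
    using ob hs xy by (simp add: assoc rewrite_head[OF n])
  also have "((q \<cdot> \<tau> b c) \<uplus> \<i> a) = (q \<uplus> \<i> a) \<cdot> (\<tau> b c \<uplus> \<i> a)"
    using ob hs by (simp add: interchange)
  also have "q' \<cdot> ((q \<uplus> \<i> a) \<cdot> (\<tau> b c \<uplus> \<i> a) \<cdot> (\<tau> a (b \<oplus> c) \<cdot> \<alpha> a b c))
     = p' \<cdot> ((\<i> c \<uplus> p) \<cdot> (\<alpha> c b a \<cdot> ((\<tau> b c \<uplus> \<i> a) \<cdot> (\<tau> a (b \<oplus> c) \<cdot> \<alpha> a b c))))"
    using ob hs xy arg_cong[OF eq, of "\<lambda>u. u \<cdot> ((\<tau> b c \<uplus> \<i> a) \<cdot> (\<tau> a (b \<oplus> c) \<cdot> \<alpha> a b c))"] by (simp add: assoc)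
  also have "\<dots> = p' \<cdot> ((\<i> c \<uplus> (p \<cdot> \<tau> a b)) \<cdot> \<tau> (a \<oplus> b) c)"
    unfolding reversed_hexagon[OF ob] using ob hs by (simp add: interchange_head)
  also have "\<dots> = p' \<cdot> (\<tau> x c \<cdot> ((p \<cdot> \<tau> a b) \<uplus> \<i> c))"
    using Symm_nat[of "p \<cdot> \<tau> a b" "\<i> c"] ob hs by simp
  finally show ?thesis using ob hs xy by (simp add: assoc)
qed

text \<open>
  If a symmetric multiplication is associative on \<open>b, a, c\<close> and on \<open>b, c, a\<close>, the hexagon makes it
  associative on \<open>a, b, c\<close>. Together with reversal this reduces all orders of three factors to the
  order in which a distinguished factor comes last.
\<close>

lemma associative_rotate:
  assumes ob: "a \<in> Obj C" "b \<in> Obj C" "c \<in> Obj C"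
    and ba: "ba \<in> hom C (b \<oplus> a) x" and bc: "bc \<in> hom C (b \<oplus> c) y" and ca: "ca \<in> hom C (c \<oplus> a) w"
    and b_w: "b_w \<in> hom C (b \<oplus> w) z" and x_c: "x_c \<in> hom C (x \<oplus> c) z" and y_a: "y_a \<in> hom C (y \<oplus> a) z"
    and bac: "b_w \<cdot> ((\<i> b \<uplus> (ca \<cdot> \<tau> a c)) \<cdot> \<alpha> b a c) = x_c \<cdot> (ba \<uplus> \<i> c)"
    and bca: "b_w \<cdot> ((\<i> b \<uplus> ca) \<cdot> \<alpha> b c a) = y_a \<cdot> (bc \<uplus> \<i> a)"
  shows "(y_a \<cdot> \<tau> a y) \<cdot> ((\<i> a \<uplus> bc) \<cdot> \<alpha> a b c) = x_c \<cdot> ((ba \<cdot> \<tau> a b) \<uplus> \<i> c)"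
proof -
  note hs = ba[THEN homD] bc[THEN homD] ca[THEN homD] b_w[THEN homD] x_c[THEN homD] y_a[THEN homD]
  have xy: "x \<in> Obj C" "y \<in> Obj C" "w \<in> Obj C" using hs Cod_Obj by metis+
  have n: "\<tau> a y \<cdot> (\<i> a \<uplus> bc) = (bc \<uplus> \<i> a) \<cdot> \<tau> a (b \<oplus> c)"
    using Symm_nat[of "\<i> a" bc] ob hs by simp
  have "(y_a \<cdot> \<tau> a y) \<cdot> ((\<i> a \<uplus> bc) \<cdot> \<alpha> a b c) = y_a \<cdot> ((bc \<uplus> \<i> a) \<cdot> (\<tau> a (b \<oplus> c) \<cdot> \<alpha> a b c))"
    using ob hs xy by (simp add: assoc rewrite_head[OF n])
  also have "\<dots> = b_w \<cdot> ((\<i> b \<uplus> ca) \<cdot> (\<alpha> b c a \<cdot> (\<tau> a (b \<oplus> c) \<cdot> \<alpha> a b c)))"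
    using ob hs xy arg_cong[OF bca, of "\<lambda>u. u \<cdot> (\<tau> a (b \<oplus> c) \<cdot> \<alpha> a b c)"] by (simp add: assoc)
  also have "\<dots> = b_w \<cdot> ((\<i> b \<uplus> ca) \<cdot> ((\<i> b \<uplus> \<tau> a c) \<cdot> (\<alpha> b a c \<cdot> (\<tau> a b \<uplus> \<i> c))))"
    using ob hexagon[of a b c] by (simp add: assoc)
  also have "\<dots> = (b_w \<cdot> ((\<i> b \<uplus> (ca \<cdot> \<tau> a c)) \<cdot> \<alpha> b a c)) \<cdot> (\<tau> a b \<uplus> \<i> c)"
    using ob hs xy by (simp add: assoc interchange_head)
  also have "\<dots> = x_c \<cdot> ((ba \<cdot> \<tau> a b) \<uplus> \<i> c)"
    unfolding bac using ob hs xy by (simp add: assoc interchange)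
  finally show ?thesis .
qed

lemma LUnit_nat:
  assumes "f \<in> Arr C"
  shows "(\<c> (Cod C f) \<cdot> \<tau> \<e> (Cod C f)) \<cdot> (\<i> \<e> \<uplus> f) = f \<cdot> (\<c> (Dom C f) \<cdot> \<tau> \<e> (Dom C f))"
proof -
  have "(\<c> (Cod C f) \<cdot> \<tau> \<e> (Cod C f)) \<cdot> (\<i> \<e> \<uplus> f) = \<c> (Cod C f) \<cdot> ((f \<uplus> \<i> \<e>) \<cdot> \<tau> \<e> (Dom C f))"
    using Symm_nat[of "\<i> \<e>" f] assms by (simp add: assoc)
  also have "\<dots> = f \<cdot> (\<c> (Dom C f) \<cdot> \<tau> \<e> (Dom C f))"
    using assms by (simp add: rewrite_head[OF RUnit_nat[OF assms]] assoc)
  finally show ?thesis .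
qed

text \<open>
  The mirror image of \<open>RUnit_Tensor\<close>, which is an associativity law for three factors the last of
  which is \<open>\<e>\<close>: the multiplications with \<open>\<e>\<close> are unit isomorphisms and the other one is an identity.
\<close>

lemma LUnit_Tensor:
  assumes "a \<in> Obj C" "b \<in> Obj C"
  shows "(\<c> (a \<oplus> b) \<cdot> \<tau> \<e> (a \<oplus> b)) \<cdot> \<alpha> \<e> a b = (\<c> a \<cdot> \<tau> \<e> a) \<uplus> \<i> b"
proof (rule iso_left_cancel[of "\<tau> a b"])
  have "(\<c> (b \<oplus> a) \<cdot> \<tau> \<e> (b \<oplus> a)) \<cdot> ((\<i> \<e> \<uplus> (\<i> (b \<oplus> a) \<cdot> \<tau> a b)) \<cdot> \<alpha> \<e> a b)
    = (\<i> (b \<oplus> a) \<cdot> \<tau> a b) \<cdot> ((\<c> a \<cdot> \<tau> \<e> a) \<uplus> \<i> b)"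
    by (rule associative_reverse) (use assms RUnit_Tensor in \<open>auto simp: hom_def\<close>)
  then show "\<tau> a b \<cdot> ((\<c> (a \<oplus> b) \<cdot> \<tau> \<e> (a \<oplus> b)) \<cdot> \<alpha> \<e> a b) = \<tau> a b \<cdot> ((\<c> a \<cdot> \<tau> \<e> a) \<uplus> \<i> b)"
    using assms rewrite_head[OF LUnit_nat[of "\<tau> a b"]] by (simp add: assoc)
qed (use assms in auto)

end

section \<open>Normal forms of words and coherence\<close>

abbreviation vars_below :: "yword \<Rightarrow> nat \<Rightarrow> bool" where
  "vars_below w n \<equiv> set (yvars w) \<subseteq> {..<n}"

lemma canonical_mset_yvars: "canonical C xs u v f \<Longrightarrow> mset (yvars u) = mset (yvars v)"
  by (induction rule: canonical.induct) auto

lemma canonical_set_yvars: "canonical C xs u v f \<Longrightarrow> set (yvars u) = set (yvars v)"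
  by (rule mset_eq_setD[OF canonical_mset_yvars])

lemma canonical_distinct_yvars: "canonical C xs u v f \<Longrightarrow> distinct (yvars u) = distinct (yvars v)"
  by (rule mset_eq_imp_distinct_iff[OF canonical_mset_yvars])

context symmetric_monoidal_category
begin

lemma y_eval_Obj [simp]:
  "(\<And>i. i \<in> set (yvars w) \<Longrightarrow> xs ! i \<in> Obj C) \<Longrightarrow> y_eval C w xs \<in> Obj C"
  by (induction w) simp_all

lemma canonical_typed_iso:
  assumes "canonical C xs u v f" "\<forall>i\<in>set (yvars u). xs ! i \<in> Obj C"
  shows "f \<in> hom C (y_eval C u xs) (y_eval C v xs) \<and> iso f"
  using assms
proof (induction rule: canonical.induct)
  case (canonical_inverse u v f g)
  then show ?case
    using canonical_set_yvars[OF canonical_inverse.hyps(1)] inverse_arrowsD[OF canonical_inverse.hyps(2)]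
      inverse_arrows_sym[OF canonical_inverse.hyps(2)]
    by (auto simp: hom_def iso_def)
next
  case (canonical_Comp v w g u f)
  then show ?case
    using canonical_set_yvars[OF canonical_Comp.hyps(2)] by (auto simp: hom_def intro: iso_Comp)
qed (auto simp: hom_def iso_TensorM iso_Ident)

lemmas canonical_hom = canonical_typed_iso[THEN conjunct1]
lemmas canonical_iso = canonical_typed_iso[THEN conjunct2]

lemma canonical_typed:
  assumes "canonical C xs u v f" "\<forall>i\<in>set (yvars u). xs ! i \<in> Obj C"
  shows "f \<in> Arr C" "Dom C f = y_eval C u xs" "Cod C f = y_eval C v xs"
  using canonical_hom[OF assms] by (auto simp: hom_def)

lemma canonical_inverse_arr:
  assumes "canonical C xs u v f" "\<forall>i\<in>set (yvars u). xs ! i \<in> Obj C"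
  shows "canonical C xs v u (inverse_arr f)"
  using canonical.canonical_inverse[OF assms(1)] inverse_arrows_inverse_arr canonical_iso[OF assms] by blast

end

text \<open>
  The left-nested sum of the variables in \<open>P\<close> that are below \<open>n\<close>, starting from the unit. The recursion
  runs over the bound \<open>n\<close> and not over a list of variables, so that two words on disjoint sets are
  merged by following the same recursion and at most one of them changes in each step.
\<close>

primrec nword :: "nat \<Rightarrow> nat set \<Rightarrow> yword" where
  "nword 0 P = YE"
| "nword (Suc n) P = (if n \<in> P then YSum (nword n P) (YVar n) else nword n P)"

lemma set_yvars_nword: "set (yvars (nword n P)) = P \<inter> {..<n}"
  by (induction n) (simp_all add: lessThan_Suc Un_commute)

lemma nword_empty [simp]: "nword n {} = YE"
  by (induction n) auto

lemma nword_singleton: "i < n \<Longrightarrow> nword n {i} = YSum YE (YVar i)"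
proof (induction n)
  case (Suc n)
  moreover have "nword n {n} = YE" for n
  proof -
    have "i \<ge> m \<Longrightarrow> nword m {i} = YE" for i m by (induction m) auto
    then show ?thesis by simp
  qed
  ultimately show ?case by (cases "i = n") auto
qed simp

context symmetric_monoidal_category
begin

abbreviation nob :: "'o list \<Rightarrow> nat \<Rightarrow> nat set \<Rightarrow> 'o" where
  "nob xs n P \<equiv> y_eval C (nword n P) xs"

text \<open>
  The largest variable of \<open>P \<union> Q\<close> has to become the outermost summand. If it lies in \<open>Q\<close>, it stands
  on the far right and one inverse associator suffices. If it lies in \<open>P\<close>, the value is forced by the
  symmetry law, which therefore needs an argument only at \<open>0\<close> (where the choice \<open>\<c> \<e>\<close> is symmetric
  by \<open>RUnit_Unit_Symm\<close>).
\<close>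

primrec merge :: "'o list \<Rightarrow> nat \<Rightarrow> nat set \<Rightarrow> nat set \<Rightarrow> 'm" where
  "merge xs 0 P Q = \<c> \<e>"
| "merge xs (Suc n) P Q =
    (if n \<in> Q then (merge xs n P Q \<uplus> \<i> (xs ! n)) \<cdot> inverse_arr (\<alpha> (nob xs n P) (nob xs n Q) (xs ! n))
     else if n \<in> P then ((merge xs n Q P \<uplus> \<i> (xs ! n))
        \<cdot> inverse_arr (\<alpha> (nob xs n Q) (nob xs n P) (xs ! n))) \<cdot> \<tau> (nob xs n P \<oplus> xs ! n) (nob xs n Q)
     else merge xs n P Q)"

lemma nob_Obj [simp]: "\<forall>i<n. xs ! i \<in> Obj C \<Longrightarrow> nob xs n P \<in> Obj C"
  by (rule y_eval_Obj) (auto simp: set_yvars_nword)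

lemma merge_canonical:
  assumes "\<forall>i<n. xs ! i \<in> Obj C" "P \<inter> Q = {}"
  shows "canonical C xs (YSum (nword n P) (nword n Q)) (nword n (P \<union> Q)) (merge xs n P Q)"
  using assms
proof (induction n arbitrary: P Q)
  case 0
  then show ?case using canonical_RUnit[of C xs YE] by simp
next
  case (Suc n)
  have ob: "\<forall>i<n. xs ! i \<in> Obj C" "xs ! n \<in> Obj C" using Suc.prems by auto
  have step: "canonical C xs (YSum (nword n P) (YSum (nword n Q) (YVar n)))
      (YSum (nword n (P \<union> Q)) (YVar n))
      ((merge xs n P Q \<uplus> \<i> (xs ! n)) \<cdot> inverse_arr (\<alpha> (nob xs n P) (nob xs n Q) (xs ! n)))"
    if "P \<inter> Q = {}" for P Q
  proof (rule canonical_Comp)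
    have "canonical C xs (YVar n) (YVar n) (\<i> (xs ! n))"
      using canonical_id[of C xs "YVar n"] by simp
    with Suc.IH[OF ob(1) that]
    show "canonical C xs (YSum (YSum (nword n P) (nword n Q)) (YVar n)) (YSum (nword n (P \<union> Q)) (YVar n))
      (merge xs n P Q \<uplus> \<i> (xs ! n))" by (rule canonical_Tensor)
    have "canonical C xs (YSum (YSum (nword n P) (nword n Q)) (YVar n)) (YSum (nword n P) (YSum (nword n Q) (YVar n)))
      (\<alpha> (nob xs n P) (nob xs n Q) (xs ! n))"
      using canonical_Assoc[of C xs "nword n P" "nword n Q" "YVar n"] by simp
    then show "canonical C xs (YSum (nword n P) (YSum (nword n Q) (YVar n)))
      (YSum (YSum (nword n P) (nword n Q)) (YVar n)) (inverse_arr (\<alpha> (nob xs n P) (nob xs n Q) (xs ! n)))"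
      by (rule canonical_inverse_arr) (use ob in \<open>auto simp: set_yvars_nword\<close>)
  qed
  consider "n \<in> Q" "n \<notin> P" | "n \<in> P" "n \<notin> Q" | "n \<notin> P" "n \<notin> Q" using Suc.prems(2) by auto
  then show ?case
  proof cases
    case 1
    then show ?thesis using step[OF Suc.prems(2)] by simp
  next
    case 2
    have "canonical C xs (YSum (YSum (nword n P) (YVar n)) (nword n Q)) (YSum (nword n Q) (YSum (nword n P) (YVar n)))
      (\<tau> (nob xs n P \<oplus> xs ! n) (nob xs n Q))"
      using canonical_Symm[of C xs "YSum (nword n P) (YVar n)" "nword n Q"] by simp
    from canonical_Comp[OF step this] 2 Suc.prems(2) show ?thesis by (simp add: Un_commute Int_commute)
  next
    case 3
    then show ?thesis using Suc.IH[OF ob(1) Suc.prems(2)] by simp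
  qed
qed

lemma merge_typed [simp]:
  assumes "\<forall>i<n. xs ! i \<in> Obj C" "P \<inter> Q = {}"
  shows "merge xs n P Q \<in> Arr C" "Dom C (merge xs n P Q) = nob xs n P \<oplus> nob xs n Q"
    "Cod C (merge xs n P Q) = nob xs n (P \<union> Q)"
  using canonical_typed[OF merge_canonical[OF assms]] assms by (auto simp: set_yvars_nword)

lemma merge_Symm:
  assumes "\<forall>i<n. xs ! i \<in> Obj C" "P \<inter> Q = {}"
  shows "merge xs n Q P \<cdot> \<tau> (nob xs n P) (nob xs n Q) = merge xs n P Q"
  using assms
proof (induction n)
  case 0
  then show ?case by (simp add: RUnit_Unit_Symm)
next
  case (Suc n)
  have ob: "\<forall>i<n. xs ! i \<in> Obj C" "xs ! n \<in> Obj C" "Q \<inter> P = {}" using Suc.prems by auto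
  consider "n \<in> Q" "n \<notin> P" | "n \<in> P" "n \<notin> Q" | "n \<notin> P" "n \<notin> Q" using Suc.prems(2) by auto
  then show ?case
    using ob Suc by cases (simp_all add: assoc)
qed

lemma merge_RUnit:
  assumes "\<forall>i<n. xs ! i \<in> Obj C"
  shows "merge xs n P {} = \<c> (nob xs n P)"
  using assms
proof (induction n)
  case (Suc n)
  have ob: "\<forall>i<n. xs ! i \<in> Obj C" "xs ! n \<in> Obj C" using Suc.prems by auto
  show ?case
  proof (cases "n \<in> P")
    case True
    let ?N = "nob xs n P" and ?x = "xs ! n"
    have "merge xs n {} P = \<c> ?N \<cdot> \<tau> \<e> ?N"
      using merge_Symm[of n xs "{}" P] Suc.IH ob by simp
    then have "merge xs n {} P \<uplus> \<i> ?x = (\<c> (?N \<oplus> ?x) \<cdot> \<tau> \<e> (?N \<oplus> ?x)) \<cdot> \<alpha> \<e> ?N ?x"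
      using LUnit_Tensor[of ?N ?x] ob by simp
    then show ?thesis
      using True ob by (simp add: assoc rewrite_head[OF inverse_arr_typed(5)])
  qed (use Suc.IH ob in simp)
qed simp

definition merge_associative :: "'o list \<Rightarrow> nat \<Rightarrow> nat set \<Rightarrow> nat set \<Rightarrow> nat set \<Rightarrow> bool" where
  "merge_associative xs n P Q R \<longleftrightarrow>
    merge xs n P (Q \<union> R) \<cdot> ((\<i> (nob xs n P) \<uplus> merge xs n Q R) \<cdot> \<alpha> (nob xs n P) (nob xs n Q) (nob xs n R))
      = merge xs n (P \<union> Q) R \<cdot> (merge xs n P Q \<uplus> \<i> (nob xs n R))"

text \<open>
  Of the possible positions of the largest variable, the last factor is the one that needs a diagram
  of its own: the pentagon moves the variable out of all brackets, and what remains is the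
  associativity of \<open>merge\<close> below it.
\<close>

lemma merge_associative_last:
  assumes IH: "merge_associative xs n P Q R"
    and ob: "\<forall>i<n. xs ! i \<in> Obj C" "xs ! n \<in> Obj C"
    and disj: "P \<inter> Q = {}" "P \<inter> R = {}" "Q \<inter> R = {}" and n: "n \<in> R"
  shows "merge_associative xs (Suc n) P Q R"
proof -
  have nn: "n \<notin> P" "n \<notin> Q" using n disj by auto
  let ?P = "nob xs n P" and ?Q = "nob xs n Q" and ?R = "nob xs n R" and ?x = "xs ! n"
  let ?m = "merge xs n"
  have d: "P \<inter> (Q \<union> R) = {}" "(P \<union> Q) \<inter> R = {}" using disj by auto
  have nat: "inverse_arr (\<alpha> ?P (nob xs n (Q \<union> R)) ?x) \<cdot> (\<i> ?P \<uplus> (?m Q R \<uplus> \<i> ?x))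
    = ((\<i> ?P \<uplus> ?m Q R) \<uplus> \<i> ?x) \<cdot> inverse_arr (\<alpha> ?P (?Q \<oplus> ?R) ?x)"
    using inverse_Assoc_nat[of "\<i> ?P" "?m Q R" "\<i> ?x"] ob disj by simp
  have nat': "inverse_arr (\<alpha> (nob xs n (P \<union> Q)) ?R ?x) \<cdot> (?m P Q \<uplus> \<i> (?R \<oplus> ?x))
    = ((?m P Q \<uplus> \<i> ?R) \<uplus> \<i> ?x) \<cdot> inverse_arr (\<alpha> (?P \<oplus> ?Q) ?R ?x)"
    using inverse_Assoc_nat[of "?m P Q" "\<i> ?R" "\<i> ?x"] ob disj by simp
  have "(?m P (Q \<union> R) \<uplus> \<i> ?x) \<cdot> inverse_arr (\<alpha> ?P (nob xs n (Q \<union> R)) ?x)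
      \<cdot> ((\<i> ?P \<uplus> ((?m Q R \<uplus> \<i> ?x) \<cdot> inverse_arr (\<alpha> ?Q ?R ?x))) \<cdot> \<alpha> ?P ?Q (?R \<oplus> ?x))
    = (?m P (Q \<union> R) \<uplus> \<i> ?x) \<cdot> ((inverse_arr (\<alpha> ?P (nob xs n (Q \<union> R)) ?x)
      \<cdot> (\<i> ?P \<uplus> (?m Q R \<uplus> \<i> ?x))) \<cdot> ((\<i> ?P \<uplus> inverse_arr (\<alpha> ?Q ?R ?x)) \<cdot> \<alpha> ?P ?Q (?R \<oplus> ?x)))"
    using ob disj d by (simp add: assoc interchange_head)
  also have "\<dots> = (?m P (Q \<union> R) \<uplus> \<i> ?x) \<cdot> (((\<i> ?P \<uplus> ?m Q R) \<uplus> \<i> ?x)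
     \<cdot> (inverse_arr (\<alpha> ?P (?Q \<oplus> ?R) ?x) \<cdot> ((\<i> ?P \<uplus> inverse_arr (\<alpha> ?Q ?R ?x)) \<cdot> \<alpha> ?P ?Q (?R \<oplus> ?x))))"
    unfolding nat using ob disj d by (simp add: assoc)
  also have "\<dots> = (?m P (Q \<union> R) \<uplus> \<i> ?x) \<cdot> (((\<i> ?P \<uplus> ?m Q R) \<uplus> \<i> ?x)
     \<cdot> ((\<alpha> ?P ?Q ?R \<uplus> \<i> ?x) \<cdot> inverse_arr (\<alpha> (?P \<oplus> ?Q) ?R ?x)))"
    using ob by (simp add: inverse_pentagon)
  also have "\<dots> = ((?m P (Q \<union> R) \<cdot> ((\<i> ?P \<uplus> ?m Q R) \<cdot> \<alpha> ?P ?Q ?R)) \<uplus> \<i> ?x)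
     \<cdot> inverse_arr (\<alpha> (?P \<oplus> ?Q) ?R ?x)"
    using ob disj d by (simp add: interchange_head)
  also have "\<dots> = ((?m (P \<union> Q) R \<cdot> (?m P Q \<uplus> \<i> ?R)) \<uplus> \<i> ?x) \<cdot> inverse_arr (\<alpha> (?P \<oplus> ?Q) ?R ?x)"
    using IH by (simp add: merge_associative_def)
  also have "\<dots> = (?m (P \<union> Q) R \<uplus> \<i> ?x) \<cdot> (inverse_arr (\<alpha> (nob xs n (P \<union> Q)) ?R ?x) \<cdot> (?m P Q \<uplus> \<i> (?R \<oplus> ?x)))"
    unfolding nat' using ob disj d by (simp add: interchange_head)
  finally show ?thesis
    using n nn ob disj d by (simp add: merge_associative_def assoc)
qed

lemma merge_associative_reverse:
  assumes ob: "\<forall>i<n. xs ! i \<in> Obj C"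
    and disj: "P \<inter> Q = {}" "P \<inter> R = {}" "Q \<inter> R = {}"
    and rqp: "merge_associative xs n R Q P"
  shows "merge_associative xs n P Q R"
proof -
  have d: "Q \<inter> P = {}" "R \<inter> Q = {}" "R \<inter> (Q \<union> P) = {}" "(R \<union> Q) \<inter> P = {}" using disj by auto
  let ?N = "nob xs n"
  have "(merge xs n (R \<union> Q) P \<cdot> \<tau> (?N P) (?N (R \<union> Q)))
      \<cdot> ((\<i> (?N P) \<uplus> (merge xs n R Q \<cdot> \<tau> (?N Q) (?N R))) \<cdot> \<alpha> (?N P) (?N Q) (?N R))
    = (merge xs n R (Q \<union> P) \<cdot> \<tau> (?N (Q \<union> P)) (?N R)) \<cdot> ((merge xs n Q P \<cdot> \<tau> (?N P) (?N Q)) \<uplus> \<i> (?N R))"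
    by (rule associative_reverse)
      (use ob d rqp in \<open>auto simp: merge_associative_def hom_def Un_assoc\<close>)
  then show ?thesis
    using ob disj merge_Symm[of n xs P "R \<union> Q"] merge_Symm[of n xs Q R] merge_Symm[of n xs "Q \<union> P" R]
      merge_Symm[of n xs P Q] d
    by (simp add: merge_associative_def Un_commute Int_commute)
qed

lemma merge_associative_rotate:
  assumes ob: "\<forall>i<n. xs ! i \<in> Obj C"
    and disj: "P \<inter> Q = {}" "P \<inter> R = {}" "Q \<inter> R = {}"
    and qpr: "merge_associative xs n Q P R" and qrp: "merge_associative xs n Q R P"
  shows "merge_associative xs n P Q R"
proof -
  have d: "Q \<inter> P = {}" "R \<inter> P = {}" "R \<inter> Q = {}" "Q \<inter> (R \<union> P) = {}" "(Q \<union> P) \<inter> R = {}"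
    "(Q \<union> R) \<inter> P = {}" using disj by auto
  have u: "Q \<union> (R \<union> P) = P \<union> (Q \<union> R)" "Q \<union> P \<union> R = P \<union> (Q \<union> R)" "Q \<union> R \<union> P = P \<union> (Q \<union> R)" by auto
  let ?N = "nob xs n"
  have "(merge xs n (Q \<union> R) P \<cdot> \<tau> (?N P) (?N (Q \<union> R)))
      \<cdot> ((\<i> (?N P) \<uplus> merge xs n Q R) \<cdot> \<alpha> (?N P) (?N Q) (?N R))
    = merge xs n (Q \<union> P) R \<cdot> ((merge xs n Q P \<cdot> \<tau> (?N P) (?N Q)) \<uplus> \<i> (?N R))"
  proof (rule associative_rotate[where ca="merge xs n R P" and b_w="merge xs n Q (R \<union> P)"])
    show "merge xs n Q (R \<union> P) \<cdot> ((\<i> (?N Q) \<uplus> (merge xs n R P \<cdot> \<tau> (?N P) (?N R))) \<cdot> \<alpha> (?N Q) (?N P) (?N R))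
      = merge xs n (Q \<union> P) R \<cdot> (merge xs n Q P \<uplus> \<i> (?N R))"
      using qpr merge_Symm[OF ob disj(2)] by (simp add: merge_associative_def Un_commute)
    show "merge xs n Q (R \<union> P) \<cdot> ((\<i> (?N Q) \<uplus> merge xs n R P) \<cdot> \<alpha> (?N Q) (?N R) (?N P))
      = merge xs n (Q \<union> R) P \<cdot> (merge xs n Q R \<uplus> \<i> (?N P))"
      using qrp by (simp add: merge_associative_def)
  qed (use ob d disj u in \<open>auto simp: hom_def\<close>)
  then show ?thesis
    using ob disj merge_Symm[of n xs P "Q \<union> R"] merge_Symm[of n xs P Q] d
    by (simp add: merge_associative_def Un_commute Int_commute)
qed

text \<open>
  If the largest variable lies in the first factor, reversal moves it to the last one. If it lies in
  the middle factor, rotation asks for two laws in which it lies in an outer factor.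
\<close>

lemma merge_Assoc:
  assumes "\<forall>i<n. xs ! i \<in> Obj C" "P \<inter> Q = {}" "P \<inter> R = {}" "Q \<inter> R = {}"
  shows "merge_associative xs n P Q R"
  using assms
proof (induction n arbitrary: P Q R)
  case 0
  then show ?case
    using RUnit_nat[of "\<c> \<e>"] RUnit_Tensor[of \<e> \<e>] by (simp add: merge_associative_def)
next
  case (Suc n)
  have ob: "\<forall>i<n. xs ! i \<in> Obj C" "xs ! n \<in> Obj C" using Suc.prems by auto
  have last: "merge_associative xs (Suc n) P Q R"
    if "P \<inter> Q = {}" "P \<inter> R = {}" "Q \<inter> R = {}" "n \<in> R" for P Q R
    using merge_associative_last[OF Suc.IH[OF ob(1) that(1-3)] ob that] .
  have first: "merge_associative xs (Suc n) P Q R"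
    if "P \<inter> Q = {}" "P \<inter> R = {}" "Q \<inter> R = {}" "n \<in> P" for P Q R
    by (rule merge_associative_reverse[OF Suc.prems(1) that(1-3)], rule last) (use that in auto)
  consider "n \<in> R" | "n \<in> P" | "n \<in> Q" | "n \<notin> P \<union> Q \<union> R" by auto
  then show ?case
  proof cases
    case 3
    show ?thesis
      by (rule merge_associative_rotate[OF Suc.prems]; rule first) (use 3 Suc.prems in auto)
  next
    case 4
    then show ?thesis using Suc.IH[OF ob(1) Suc.prems(2-4)] by (simp add: merge_associative_def)
  qed (use last first Suc.prems in auto)
qed

text \<open>
  A single variable is not literally its normal word, which starts from \<open>\<e>\<close>; hence the inverse unit
  isomorphism in the second equation.
\<close>

primrec nf :: "'o list \<Rightarrow> nat \<Rightarrow> yword \<Rightarrow> 'm" where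
  "nf xs n YE = \<i> \<e>"
| "nf xs n (YVar i) = \<tau> (xs ! i) \<e> \<cdot> inverse_arr (\<c> (xs ! i))"
| "nf xs n (YSum u v) = merge xs n (set (yvars u)) (set (yvars v)) \<cdot> (nf xs n u \<uplus> nf xs n v)"

lemma nf_canonical:
  assumes ob: "\<forall>i<n. xs ! i \<in> Obj C" and "distinct (yvars w)" "vars_below w n"
  shows "canonical C xs w (nword n (set (yvars w))) (nf xs n w)"
  using assms(2,3)
proof (induction w)
  case YE
  show ?case using canonical_id[of C xs YE] by simp
next
  case (YVar i)
  then have "canonical C xs (YVar i) (YSum (YVar i) YE) (inverse_arr (\<c> (xs ! i)))"
    using canonical_inverse_arr[OF canonical_RUnit[of C xs "YVar i"]] ob by simp
  from canonical_Comp[OF canonical_Symm this] YVar show ?case by (simp add: nword_singleton)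
next
  case (YSum u v)
  show ?case
    using canonical_Comp[OF merge_canonical[OF ob] canonical_Tensor[OF YSum.IH]] YSum.prems by simp
qed

lemma nf_typed:
  assumes "\<forall>i<n. xs ! i \<in> Obj C" "distinct (yvars w)" "vars_below w n"
  shows "nf xs n w \<in> Arr C" "Dom C (nf xs n w) = y_eval C w xs"
    "Cod C (nf xs n w) = nob xs n (set (yvars w))" "iso (nf xs n w)"
  using canonical_typed[OF nf_canonical[OF assms]] canonical_iso[OF nf_canonical[OF assms]] assms by auto

text \<open>
  The associator, the unit and the symmetry are absorbed by the corresponding laws of \<open>merge\<close> after
  naturality has moved them past the normal forms of the subwords. Tensor products are absorbed
  because \<open>merge\<close> depends only on the sets of variables, which canonical maps do not change.
\<close>

lemma nf_absorbs_canonical: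
  assumes "canonical C xs u v f" and ob: "\<forall>i<n. xs ! i \<in> Obj C"
    and "distinct (yvars u)" "vars_below u n"
  shows "nf xs n v \<cdot> f = nf xs n u"
  using assms(1,3,4)
proof (induction rule: canonical.induct)
  case (canonical_id w)
  then show ?case using nf_typed[OF ob, of w] by simp
next
  case (canonical_Assoc u v w)
  let ?N = "\<lambda>w. nob xs n (set (yvars w))"
  have t: "nf xs n z \<in> Arr C" "Dom C (nf xs n z) = y_eval C z xs" "Cod C (nf xs n z) = ?N z" if "z \<in> {u, v, w}" for z
    using nf_typed[OF ob, of z] canonical_Assoc that by auto
  have ev: "y_eval C z xs \<in> Obj C" if "z \<in> {u, v, w}" for z
    using t(1,2)[OF that] Dom_Obj by metis
  have d: "set (yvars u) \<inter> set (yvars v) = {}" "set (yvars u) \<inter> set (yvars w) = {}"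
     "set (yvars v) \<inter> set (yvars w) = {}" "set (yvars u) \<inter> (set (yvars v) \<union> set (yvars w)) = {}"
     "(set (yvars u) \<union> set (yvars v)) \<inter> set (yvars w) = {}"
    using canonical_Assoc by auto
  let ?m = "\<lambda>u v. merge xs n (set (yvars u)) (set (yvars v))"
  have "nf xs n (YSum u (YSum v w)) \<cdot> \<alpha> (y_eval C u xs) (y_eval C v xs) (y_eval C w xs)
    = ?m u (YSum v w) \<cdot> ((\<i> (?N u) \<uplus> ?m v w) \<cdot> ((nf xs n u \<uplus> (nf xs n v \<uplus> nf xs n w))
       \<cdot> \<alpha> (y_eval C u xs) (y_eval C v xs) (y_eval C w xs)))"
    using t ev ob d by (simp add: assoc interchange_head)
  also have "\<dots> = ?m u (YSum v w) \<cdot> ((\<i> (?N u) \<uplus> ?m v w) \<cdot> (\<alpha> (?N u) (?N v) (?N w) \<cdot> ((nf xs n u \<uplus> nf xs n v) \<uplus> nf xs n w)))"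
    using Assoc_nat[of "nf xs n u" "nf xs n v" "nf xs n w"] t by simp
  also have "\<dots> = (?m u (YSum v w) \<cdot> ((\<i> (?N u) \<uplus> ?m v w) \<cdot> \<alpha> (?N u) (?N v) (?N w))) \<cdot> ((nf xs n u \<uplus> nf xs n v) \<uplus> nf xs n w)"
    using t ob d by (simp add: assoc)
  also have "\<dots> = nf xs n (YSum (YSum u v) w)"
    using merge_Assoc[OF ob d(1-3)] t ob d ev by (simp add: merge_associative_def assoc interchange)
  finally show ?case .
next
  case (canonical_RUnit w)
  then show ?case
    using nf_typed[OF ob, of w] RUnit_nat[of "nf xs n w"] by (simp add: merge_RUnit[OF ob])
next
  case (canonical_Symm u v)
  have d: "set (yvars u) \<inter> set (yvars v) = {}" "set (yvars v) \<inter> set (yvars u) = {}" using canonical_Symm by auto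
  have t: "nf xs n z \<in> Arr C" "Dom C (nf xs n z) = y_eval C z xs" "Cod C (nf xs n z) = nob xs n (set (yvars z))"
     if "z \<in> {u, v}" for z
    using nf_typed[OF ob, of z] canonical_Symm that by auto
  have ev: "y_eval C z xs \<in> Obj C" if "z \<in> {u, v}" for z
    using t(1,2)[OF that] Dom_Obj by metis
  show ?case
    using t ev ob d Symm_nat[of "nf xs n u" "nf xs n v", symmetric] merge_Symm[OF ob d(1)]
    by (simp add: assoc rewrite_head[OF merge_Symm[OF ob d(1)]])
next
  case (canonical_inverse u v f g)
  have u: "distinct (yvars u)" "vars_below u n"
    using canonical_inverse.prems canonical_set_yvars[OF canonical_inverse.hyps(1)]
      canonical_distinct_yvars[OF canonical_inverse.hyps(1)] by auto
  note g = inverse_arrowsD[OF canonical_inverse.hyps(2)]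
  have f: "Dom C f = y_eval C u xs" "Cod C f = y_eval C v xs"
    using canonical_typed[OF canonical_inverse.hyps(1)] u ob by auto
  have "nf xs n u \<cdot> g = nf xs n v \<cdot> (f \<cdot> g)"
    using canonical_inverse.IH[OF u, symmetric] nf_typed[OF ob, of v] canonical_inverse.prems g(1-4) f
    by (simp add: assoc)
  then show ?case using g f nf_typed[OF ob, of v] canonical_inverse.prems by simp
next
  case (canonical_Comp v w g u f)
  have v: "distinct (yvars v)" "vars_below v n"
    using canonical_Comp.prems canonical_set_yvars[OF canonical_Comp.hyps(2)]
      canonical_distinct_yvars[OF canonical_Comp.hyps(2)] by auto
  then have w: "distinct (yvars w)" "vars_below w n"
    using canonical_set_yvars[OF canonical_Comp.hyps(1)]
      canonical_distinct_yvars[OF canonical_Comp.hyps(1)] by auto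
  have "\<forall>i\<in>set (yvars u). xs ! i \<in> Obj C" "\<forall>i\<in>set (yvars v). xs ! i \<in> Obj C"
    using ob v canonical_Comp.prems by auto
  with canonical_typed[OF canonical_Comp.hyps(2)] canonical_typed[OF canonical_Comp.hyps(1)]
  have "nf xs n w \<cdot> (g \<cdot> f) = (nf xs n w \<cdot> g) \<cdot> f"
    using nf_typed[OF ob w] by (simp add: assoc)
  then show ?case using canonical_Comp.IH v canonical_Comp.prems by simp
next
  case (canonical_Tensor u u' f v v' g)
  have u': "distinct (yvars u')" "set (yvars u') = set (yvars u)" "distinct (yvars v')" "set (yvars v') = set (yvars v)"
    using canonical_Tensor.prems canonical_set_yvars[OF canonical_Tensor.hyps(1)] canonical_set_yvars[OF canonical_Tensor.hyps(2)]
      canonical_distinct_yvars[OF canonical_Tensor.hyps(1)] canonical_distinct_yvars[OF canonical_Tensor.hyps(2)] by auto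
  have "\<forall>i\<in>set (yvars u). xs ! i \<in> Obj C" "\<forall>i\<in>set (yvars v). xs ! i \<in> Obj C"
    using ob canonical_Tensor.prems by auto
  with canonical_typed[OF canonical_Tensor.hyps(2)] canonical_typed[OF canonical_Tensor.hyps(1)]
  show ?case
    using canonical_Tensor.IH canonical_Tensor.prems u' nf_typed[OF ob, of u'] nf_typed[OF ob, of v'] ob
    by (simp add: assoc interchange)
qed

text \<open>
  A canonical map from \<open>u\<close> to \<open>v\<close> exists because both words have the same normal word. It is unique
  because any such map \<open>f\<close> satisfies \<open>nf v \<cdot> f = nf u\<close>.
\<close>

theorem coherence:
  assumes "u \<in> Y_obj n" "v \<in> Y_obj n" and ob: "\<forall>i<n. xs ! i \<in> Obj C"
  shows "\<exists>!f. canonical C xs u v f"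
proof -
  have u: "distinct (yvars u)" "vars_below u n" "set (yvars u) = {..<n}"
    and v: "distinct (yvars v)" "vars_below v n" "set (yvars v) = {..<n}"
    using assms by (auto simp: Y_obj_def)
  have obu: "\<forall>i\<in>set (yvars u). xs ! i \<in> Obj C" "\<forall>i\<in>set (yvars v). xs ! i \<in> Obj C" using u v ob by auto
  have "canonical C xs u v (inverse_arr (nf xs n v) \<cdot> nf xs n u)"
    using canonical_Comp[OF canonical_inverse_arr[OF nf_canonical[OF ob v(1,2)]]] nf_canonical[OF ob u(1,2)] u(3) v(3) obu by simp
  moreover have "f = g" if "canonical C xs u v f" "canonical C xs u v g" for f g
  proof (rule iso_left_cancel[OF nf_typed(4)[OF ob v(1,2)]])
    show "nf xs n v \<cdot> f = nf xs n v \<cdot> g"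
      using nf_absorbs_canonical[OF that(1) ob u(1,2)] nf_absorbs_canonical[OF that(2) ob u(1,2)] by simp
  qed (use canonical_typed[OF that(1) obu(1)] canonical_typed[OF that(2) obu(1)] nf_typed[OF ob v(1,2)] in auto)
  ultimately show ?thesis by blast
qed

end

section \<open>Words as an operad\<close>

text \<open>
  Substitution and the evaluations on objects and on arrows are folds over words with different
  operations. Their behaviour under operad composition and under the symmetric group action is
  thereby proved for all three at once.
\<close>

primrec y_fold :: "'a \<Rightarrow> ('a \<Rightarrow> 'a \<Rightarrow> 'a) \<Rightarrow> (nat \<Rightarrow> 'a) \<Rightarrow> yword \<Rightarrow> 'a" where
  "y_fold e t s YE = e"
| "y_fold e t s (YVar i) = s i"
| "y_fold e t s (YSum u v) = t (y_fold e t s u) (y_fold e t s v)"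

lemma ysubst_eq_y_fold: "ysubst s w = y_fold YE YSum s w"
  by (induction w) auto

lemma y_eval_eq_y_fold: "y_eval C w xs = y_fold \<e>\<^bsub>C\<^esub> (Tensor C) (nth xs) w"
  by (induction w) auto

lemma y_eval_arr_eq_y_fold: "y_eval_arr C w fs = y_fold (\<i>\<^bsub>C\<^esub> \<e>\<^bsub>C\<^esub>) (TensorM C) (nth fs) w"
  by (induction w) auto

lemma y_fold_ysubst: "y_fold e t s (ysubst r w) = y_fold e t (\<lambda>i. y_fold e t s (r i)) w"
  by (induction w) auto

lemma y_fold_cong: "(\<And>i. i \<in> set (yvars w) \<Longrightarrow> s i = s' i) \<Longrightarrow> y_fold e t s w = y_fold e t s' w"
  by (induction w) auto

lemma ysubst_cong: "(\<And>i. i \<in> set (yvars w) \<Longrightarrow> s i = s' i) \<Longrightarrow> ysubst s w = ysubst s' w"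
  by (induction w) auto

lemma ysubst_ysubst: "ysubst s (ysubst r w) = ysubst (\<lambda>i. ysubst s (r i)) w"
  by (induction w) auto

lemma ysubst_YVar [simp]: "ysubst YVar w = w"
  by (induction w) auto

lemma yvars_ysubst: "yvars (ysubst s w) = concat (map (\<lambda>i. yvars (s i)) (yvars w))"
  by (induction w) auto

lemma Y_obj_iff_mset: "w \<in> Y_obj n \<longleftrightarrow> mset (yvars w) = mset [0..<n]"
proof
  assume "w \<in> Y_obj n"
  then show "mset (yvars w) = mset [0..<n]"
    using set_eq_iff_mset_eq_distinct[of "yvars w" "[0..<n]"]
    by (simp add: Y_obj_def lessThan_atLeast0)
next
  assume *: "mset (yvars w) = mset [0..<n]"
  show "w \<in> Y_obj n"
    using mset_eq_imp_distinct_iff[OF *] mset_eq_setD[OF *] by (simp add: Y_obj_def lessThan_atLeast0)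
qed

lemma Y_obj_arity: "w \<in> Y_obj n \<Longrightarrow> y_arity w = n"
  unfolding Y_obj_iff_mset by (metis size_mset length_upt diff_zero)

lemma Y_obj_vars: "w \<in> Y_obj n \<Longrightarrow> set (yvars w) = {..<n}"
  by (simp add: Y_obj_def)

lemma nth_concat_offset:
  "\<lbrakk>i < length xss; j < length (xss ! i)\<rbrakk>
    \<Longrightarrow> concat xss ! (sum_list (map length (take i xss)) + j) = xss ! i ! j"
proof (induction xss arbitrary: i)
  case (Cons xs xss)
  then show ?case by (cases i) (auto simp: nth_append add.assoc)
qed simp

lemma split_list_lengths:
  "length zs = sum_list js \<Longrightarrow> \<exists>zss. concat zss = zs \<and> map length zss = js"
proof (induction js arbitrary: zs)
  case (Cons j js)
  then obtain zss where "concat zss = drop j zs" "map length zss = js"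
    by (metis add_diff_cancel_left' length_drop sum_list.Cons)
  with Cons.prems show ?case by (intro exI[of _ "take j zs # zss"]) auto
qed simp

lemma length_blocks [simp]: "length (blocks js) = length js"
  by (simp add: blocks_def)

lemma map_length_blocks: "map length (blocks js) = js"
  by (intro nth_equalityI) (auto simp: blocks_def take_Suc_conv_app_nth)

lemma map_nth_blocks: "map (map (nth (concat xss))) (blocks (map length xss)) = xss"
proof (rule nth_equalityI)
  fix i assume "i < length (map (map (nth (concat xss))) (blocks (map length xss)))"
  then have i: "i < length xss" by simp
  show "map (map (nth (concat xss))) (blocks (map length xss)) ! i = xss ! i"
    using i nth_concat_offset[OF i]
    by (intro nth_equalityI) (auto simp: blocks_def take_map take_Suc_conv_app_nth)
qed simp

lemma concat_blocks: "concat (blocks js) = [0..<sum_list js]"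
proof -
  obtain zss where z: "concat zss = [0..<sum_list js]" "map length zss = js"
    using split_list_lengths[of "[0..<sum_list js]" js] by auto
  have "map (map (nth [0..<sum_list js])) (blocks js) = zss"
    using map_nth_blocks[of zss] z by simp
  moreover have "map (map (nth [0..<sum_list js])) (blocks js) = blocks js"
  proof -
    have le: "sum_list (take (Suc s) js) \<le> sum_list js" for s
      by (metis append_take_drop_id le_add1 sum_list_append)
    have "map (nth [0..<sum_list js]) [a..<sum_list (take (Suc s) js)] = [a..<sum_list (take (Suc s) js)]" for a s
      by (rule map_idI) (use le[of s] in simp)
    then show ?thesis by (simp add: blocks_def)
  qed
  ultimately show ?thesis using z by simp
qed

text \<open>
  Block permutations and block sums are given by the list of their values; such a list describes a
  permutation as soon as it is a rearrangement of \<open>0, \<dots>, n - 1\<close>.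
\<close>

lemma permutes_of_mset:
  assumes "mset l = mset [0..<n]"
  shows "(\<lambda>p. if p < n then l ! p else p) permutes {..<n}"
proof (rule bij_imp_permutes)
  have d: "distinct l" and s: "set l = {..<n}" and len: "length l = n"
    using mset_eq_imp_distinct_iff[OF assms] mset_eq_setD[OF assms] mset_eq_length[OF assms] by (simp_all add: lessThan_atLeast0)
  have "bij_betw (nth l) {..<n} {..<n}"
    by (rule bij_betw_nth[OF d]) (simp_all add: len s)
  then show "bij_betw (\<lambda>p. if p < n then l ! p else p) {..<n} {..<n}"
    by (subst bij_betw_cong[where g="nth l"]) simp_all
qed simp

lemma permute_list_of_list:
  assumes "length l = length zs"
  shows "permute_list (\<lambda>p. if p < length zs then l ! p else p) zs = map (nth zs) l"
  using assms by (intro nth_equalityI) (auto simp: permute_list_def)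

lemma mset_concat_permute_list:
  assumes "\<sigma> permutes {..<length xss}"
  shows "mset (concat (permute_list \<sigma> xss)) = mset (concat xss)"
proof -
  have "mset (map mset (permute_list \<sigma> xss)) = mset (map mset xss)"
    using assms by simp
  then show ?thesis unfolding mset_concat by (metis sum_mset_sum_list)
qed

lemma block_perm_permutes:
  assumes "\<sigma> permutes {..<length js}"
  shows "block_perm \<sigma> js permutes {..<sum_list js}"
  unfolding block_perm_def
  by (rule permutes_of_mset) (use assms in \<open>simp add: mset_concat_permute_list concat_blocks\<close>)

lemma permute_list_block_perm:
  assumes "\<sigma> permutes {..<length xss}"
  shows "permute_list (block_perm \<sigma> (map length xss)) (concat xss) = concat (permute_list \<sigma> xss)"
proof -
  let ?b = "permute_list \<sigma> (blocks (map length xss))"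
  have "length (concat ?b) = length (concat xss)"
    using mset_eq_length[OF mset_concat_permute_list[of \<sigma> "blocks (map length xss)"]] assms
    by (simp add: concat_blocks length_concat)
  from permute_list_of_list[OF this]
  have "permute_list (block_perm \<sigma> (map length xss)) (concat xss) = map (nth (concat xss)) (concat ?b)"
    by (simp add: block_perm_def[abs_def] length_concat)
  also have "\<dots> = concat (permute_list \<sigma> (map (map (nth (concat xss))) (blocks (map length xss))))"
    using assms by (simp add: map_concat permute_list_map)
  finally show ?thesis by (simp only: map_nth_blocks)
qed

lemma mset_concat_map2_permute_list:
  "list_all2 (\<lambda>\<rho> xs. \<rho> permutes {..<length xs}) \<rho>s xss
    \<Longrightarrow> mset (concat (map2 permute_list \<rho>s xss)) = mset (concat xss)"
  by (induction rule: list_all2_induct) auto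

lemma list_all2_permutes_blocks:
  "list_all2 (\<lambda>\<rho> j. \<rho> permutes {..<j}) \<rho>s js
    \<Longrightarrow> list_all2 (\<lambda>\<rho> xs. \<rho> permutes {..<length xs}) \<rho>s (blocks js)"
  by (subst (asm) map_length_blocks[symmetric]) (simp only: list_all2_map2)

lemma sum_perm_permutes:
  assumes "list_all2 (\<lambda>\<rho> j. \<rho> permutes {..<j}) \<rho>s js"
  shows "sum_perm \<rho>s js permutes {..<sum_list js}"
  unfolding sum_perm_def
  by (rule permutes_of_mset)
    (simp add: mset_concat_map2_permute_list[OF list_all2_permutes_blocks[OF assms]] concat_blocks)

lemma permute_list_sum_perm:
  assumes "list_all2 (\<lambda>\<rho> xs. \<rho> permutes {..<length xs}) \<rho>s xss"
  shows "permute_list (sum_perm \<rho>s (map length xss)) (concat xss) = concat (map2 permute_list \<rho>s xss)"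
proof -
  let ?B = "blocks (map length xss)"
  have a: "list_all2 (\<lambda>\<rho> xs. \<rho> permutes {..<length xs}) \<rho>s ?B"
    by (rule list_all2_permutes_blocks) (use assms in \<open>simp add: list_all2_map2\<close>)
  have "length (concat (map2 permute_list \<rho>s ?B)) = length (concat xss)"
    using mset_eq_length[OF mset_concat_map2_permute_list[OF a]] by (simp add: concat_blocks length_concat)
  from permute_list_of_list[OF this]
  have "permute_list (sum_perm \<rho>s (map length xss)) (concat xss)
      = concat (map (map (nth (concat xss))) (map2 permute_list \<rho>s ?B))"
    by (simp add: sum_perm_def[abs_def] length_concat map_concat)
  also have "map (map (nth (concat xss))) (map2 permute_list \<rho>s ?B)
    = map2 permute_list \<rho>s (map (map (nth (concat xss))) ?B)"
    using a by (induction rule: list_all2_induct) (auto simp: permute_list_map)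
  finally show ?thesis by (simp only: map_nth_blocks)
qed

abbreviation fits :: "'a list list \<Rightarrow> yword list \<Rightarrow> bool" where
  "fits xss ws \<equiv> list_all2 (\<lambda>xs w. w \<in> Y_obj (length xs)) xss ws"

lemma y_fold_gamma:
  assumes "fits zss ws" "vars_below w (length ws)"
  shows "y_fold e t (nth (concat zss)) (y_gamma w ws)
    = y_fold e t (nth (map2 (\<lambda>zs v. y_fold e t (nth zs) v) zss ws)) w"
  unfolding y_gamma_def y_fold_ysubst
proof (rule y_fold_cong)
  fix i assume "i \<in> set (yvars w)"
  then have i: "i < length ws" "i < length zss" using assms list_all2_lengthD by fastforce+
  have v: "ws ! i \<in> Y_obj (length (zss ! i))" using assms(1) i by (simp add: list_all2_conv_all_nth)
  have "map y_arity ws = map length zss"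
    using assms(1) by (auto simp: list_all2_conv_all_nth Y_obj_arity intro!: nth_equalityI)
  then have off: "map y_arity (take i ws) = map length (take i zss)" by (metis take_map)
  show "y_fold e t (\<lambda>j. y_fold e t (nth (concat zss)) (YVar (sum_list (map y_arity (take i ws)) + j))) (ws ! i)
     = map2 (\<lambda>zs v. y_fold e t (nth zs) v) zss ws ! i"
    using i v by (auto simp: off Y_obj_vars nth_concat_offset intro!: y_fold_cong)
qed

lemma y_fold_act:
  assumes "\<sigma> permutes {..<length zs}" "vars_below w (length zs)"
  shows "y_fold e t (nth (permute_list \<sigma> zs)) (y_act w \<sigma>) = y_fold e t (nth zs) w"
  unfolding y_act_def y_fold_ysubst
proof (rule y_fold_cong)
  fix i assume "i \<in> set (yvars w)"
  then have i: "i < length zs" using assms(2) by auto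
  have "inv \<sigma> i < length zs"
    using permutes_in_image[OF permutes_inv[OF assms(1)], of i] i by simp
  then show "y_fold e t (nth (permute_list \<sigma> zs)) (YVar (inv \<sigma> i)) = zs ! i"
    by (simp add: permute_list_nth[OF assms(1)] permutes_inverses[OF assms(1)])
qed

lemmas ysubst_gamma = y_fold_gamma[where e=YE and t=YSum, folded ysubst_eq_y_fold]
lemmas ysubst_act = y_fold_act[where e=YE and t=YSum, folded ysubst_eq_y_fold]

lemma y_eval_gamma:
  "\<lbrakk>fits xss ws; vars_below w (length ws)\<rbrakk>
    \<Longrightarrow> y_eval C (y_gamma w ws) (concat xss) = y_eval C w (map2 (\<lambda>xs v. y_eval C v xs) xss ws)"
  unfolding y_eval_eq_y_fold by (rule y_fold_gamma)

lemma y_eval_arr_gamma: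
  "\<lbrakk>fits hss ws; vars_below w (length ws)\<rbrakk>
    \<Longrightarrow> y_eval_arr C (y_gamma w ws) (concat hss) = y_eval_arr C w (map2 (\<lambda>hs v. y_eval_arr C v hs) hss ws)"
  unfolding y_eval_arr_eq_y_fold by (rule y_fold_gamma)

lemma y_eval_act:
  "\<lbrakk>\<sigma> permutes {..<length xs}; vars_below w (length xs)\<rbrakk>
    \<Longrightarrow> y_eval C (y_act w \<sigma>) (permute_list \<sigma> xs) = y_eval C w xs"
  unfolding y_eval_eq_y_fold by (rule y_fold_act)

lemma y_eval_arr_act:
  "\<lbrakk>\<sigma> permutes {..<length hs}; vars_below w (length hs)\<rbrakk>
    \<Longrightarrow> y_eval_arr C (y_act w \<sigma>) (permute_list \<sigma> hs) = y_eval_arr C w hs"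
  unfolding y_eval_arr_eq_y_fold by (rule y_fold_act)

lemma mset_concat_map_cong:
  assumes "mset l = mset l'" shows "mset (concat (map h l)) = mset (concat (map h l'))"
proof -
  have "mset (map (\<lambda>x. mset (h x)) l) = mset (map (\<lambda>x. mset (h x)) l')" using assms by simp
  then show ?thesis unfolding mset_concat by (metis (no_types, lifting) map_map comp_def sum_mset_sum_list map_eq_conv)
qed

text \<open>
  The variables of the composite word are the blocks of shifted variables of the inner words, arranged
  in the order in which the outer word uses them; as a multiset they form \<open>concat (blocks js)\<close>.
\<close>

lemma y_gamma_Y_obj:
  assumes "w \<in> Y_obj (length ws)" "list_all2 (\<lambda>j v. v \<in> Y_obj j) js ws"
  shows "y_gamma w ws \<in> Y_obj (sum_list js)"
proof -
  let ?h = "\<lambda>i. map (\<lambda>j. sum_list (map y_arity (take i ws)) + j) (yvars (ws ! i))"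
  have len: "length js = length ws" using assms(2) list_all2_lengthD by blast
  have js: "map y_arity ws = js"
    using assms(2) by (auto simp: list_all2_conv_all_nth Y_obj_arity intro!: nth_equalityI)
  have "mset (yvars (y_gamma w ws)) = mset (concat (map ?h (yvars w)))"
    by (simp add: y_gamma_def yvars_ysubst comp_def)
  also have "\<dots> = mset (concat (map ?h [0..<length ws]))"
    using assms(1) by (intro mset_concat_map_cong) (simp add: Y_obj_iff_mset)
  also have "\<dots> = sum_list (map (\<lambda>i. mset (?h i)) [0..<length ws])"
    by (simp add: mset_concat comp_def del: mset_map)
  also have "map (\<lambda>i. mset (?h i)) [0..<length ws] = map (\<lambda>s. mset [sum_list (take s js) ..< sum_list (take (Suc s) js)]) [0..<length js]"
  proof (intro nth_equalityI)
    fix i assume "i < length (map (\<lambda>i. mset (?h i)) [0..<length ws])"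
    then have i: "i < length ws" by simp
    have o: "sum_list (map y_arity (take i ws)) = sum_list (take i js)" using js by (simp add: take_map[symmetric])
    have m: "mset (yvars (ws ! i)) = mset [0..<js ! i]"
      using assms(2) i len by (auto simp: list_all2_conv_all_nth Y_obj_iff_mset)
    have "mset (?h i) = mset (map (\<lambda>j. sum_list (take i js) + j) [0..<js ! i])"
      unfolding o mset_map m by simp
    also have "map (\<lambda>j. sum_list (take i js) + j) [0..<js ! i] = [sum_list (take i js) ..< sum_list (take (Suc i) js)]"
      using i len by (simp add: take_Suc_conv_app_nth map_add_upt[symmetric] add.commute)
    finally show "map (\<lambda>i. mset (?h i)) [0..<length ws] ! i = map (\<lambda>s. mset [sum_list (take s js) ..< sum_list (take (Suc s) js)]) [0..<length js] ! i"
      using i len by simp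
  qed (simp add: len)
  also have "sum_list \<dots> = mset (concat (blocks js))"
    by (simp add: mset_concat blocks_def comp_def del: mset_upt)
  finally show ?thesis by (simp add: Y_obj_iff_mset concat_blocks)
qed

lemma y_act_Y_obj:
  assumes "w \<in> Y_obj n" "\<sigma> permutes {..<n}"
  shows "y_act w \<sigma> \<in> Y_obj n"
proof -
  have y: "yvars (y_act w \<sigma>) = map (inv \<sigma>) (yvars w)"
    by (simp add: y_act_def yvars_ysubst)
  have p: "inv \<sigma> permutes {..<n}" using permutes_inv[OF assms(2)] .
  show ?thesis
    using assms(1) permutes_image[OF p] permutes_inj[OF p]
    by (auto simp: Y_obj_def y distinct_map inj_on_def inj_def)
qed

text \<open>
  Words are the free algebra on their variables, so two words are equal once they have equal values at
  the variables. In this way identities between words follow from \<open>ysubst_gamma\<close> and \<open>ysubst_act\<close>,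
  where composition is nested evaluation and no index arithmetic is left.
\<close>

lemma eq_of_ysubst_variables:
  assumes "u \<in> Y_obj n" "v \<in> Y_obj n"
    "ysubst (nth (map YVar [0..<n])) u = ysubst (nth (map YVar [0..<n])) v"
  shows "u = v"
proof -
  have "ysubst (nth (map YVar [0..<n])) w = w" if "w \<in> Y_obj n" for w
    using ysubst_cong[of w "nth (map YVar [0..<n])" YVar] Y_obj_vars[OF that] by simp
  then show ?thesis using assms by simp
qed

lemma y_gamma_one_left: "y_gamma (YVar 0) [w] = w"
  by (simp add: y_gamma_def)

lemma y_gamma_one_right:
  assumes "w \<in> Y_obj n"
  shows "y_gamma w (replicate n (YVar 0)) = w"
proof -
  have "ysubst (\<lambda>i. ysubst (\<lambda>j. YVar (sum_list (map y_arity (take i (replicate n (YVar 0)))) + j)) (replicate n (YVar 0) ! i)) w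
     = ysubst YVar w"
    using Y_obj_vars[OF assms] by (intro ysubst_cong) (simp add: min_def map_replicate_const sum_list_replicate)
  then show ?thesis by (simp add: y_gamma_def)
qed

lemma list_all2_concat: "list_all2 (list_all2 R) xss yss \<Longrightarrow> list_all2 R (concat xss) (concat yss)"
  by (induction rule: list_all2_induct) (simp_all add: list_all2_appendI)

lemma sum_list_concat_nat: "sum_list (concat jss :: nat list) = sum_list (map sum_list jss)"
  by (induction jss) simp_all

lemma y_gamma_assoc:
  assumes w: "w \<in> Y_obj (length vs)" and vs: "list_all2 (\<lambda>v us. v \<in> Y_obj (length us)) vs uss"
    and us: "list_all2 (list_all2 (\<lambda>j u. u \<in> Y_obj j)) jss uss"
  shows "y_gamma (y_gamma w vs) (concat uss) = y_gamma w (map2 y_gamma vs uss)"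
proof (rule eq_of_ysubst_variables[where n="sum_list (concat jss)"])
  let ?Z = "map YVar [0..<sum_list (concat jss)]"
  have len: "length vs = length uss" "length jss = length uss" using vs us list_all2_lengthD by blast+
  obtain zss where zss: "concat zss = ?Z" "map length zss = concat jss"
    using split_list_lengths[of ?Z "concat jss"] by auto
  have "length zss = sum_list (map length jss)"
    using arg_cong[OF zss(2), of length] by (simp add: length_concat)
  then obtain zsss where zsss: "concat zsss = zss" "map length zsss = map length jss"
    using split_list_lengths[of zss "map length jss"] by auto
  have jss: "map (map length) zsss = jss"
  proof (rule concat_injective)
    show "concat (map (map length) zsss) = concat jss" by (simp only: map_concat[symmetric] zsss zss)
    show l: "length (map (map length) zsss) = length jss" using arg_cong[OF zsss(2), of length] by simp
    show "\<forall>(x, y)\<in>set (zip (map (map length) zsss) jss). length x = length y"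
      using zsss(2) l by (auto simp: set_zip list_eq_iff_nth_eq)
  qed
  have fitz: "list_all2 fits zsss uss"
    using us unfolding jss[symmetric] by (simp add: list_all2_map1 list_all2_conv_all_nth)
  then have lz: "length zsss = length uss" using list_all2_lengthD by blast
  have fitc: "fits (concat zsss) (concat uss)"
    using fitz by (induction rule: list_all2_induct) (auto intro: list_all2_appendI)
  have gw: "y_gamma w vs \<in> Y_obj (length (concat uss))"
    using y_gamma_Y_obj[OF w, of "map length uss"] vs
    by (simp add: length_concat list_all2_conv_all_nth list_all2_map1)
  have gvu: "list_all2 (\<lambda>j v. v \<in> Y_obj j) (map sum_list jss) (map2 y_gamma vs uss)"
    using vs us len by (auto simp: list_all2_conv_all_nth intro!: y_gamma_Y_obj)
  have fitcz: "fits (map concat zsss) (map2 y_gamma vs uss)"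
    using gvu len lz unfolding jss[symmetric] by (auto simp: list_all2_conv_all_nth length_concat)
  show "y_gamma (y_gamma w vs) (concat uss) \<in> Y_obj (sum_list (concat jss))"
    using y_gamma_Y_obj[OF gw, of "concat jss"] us
    by (simp add: list_all2_concat)
  show "y_gamma w (map2 y_gamma vs uss) \<in> Y_obj (sum_list (concat jss))"
    using y_gamma_Y_obj[OF _ gvu, of w] w len by (simp add: sum_list_concat_nat)
  have "ysubst (nth ?Z) (y_gamma (y_gamma w vs) (concat uss))
    = ysubst (nth (map2 (\<lambda>zs. ysubst (nth zs)) (concat zsss) (concat uss))) (y_gamma w vs)"
    using ysubst_gamma[OF fitc, of "y_gamma w vs"] Y_obj_vars[OF gw] zss zsss by simp
  also have "map2 (\<lambda>zs. ysubst (nth zs)) (concat zsss) (concat uss)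
    = concat (map2 (map2 (\<lambda>zs. ysubst (nth zs))) zsss uss)"
    using fitz by (induction rule: list_all2_induct) (auto dest: list_all2_lengthD)
  also have "ysubst (nth \<dots>) (y_gamma w vs)
    = ysubst (nth (map2 (\<lambda>zs. ysubst (nth zs)) (map2 (map2 (\<lambda>zs. ysubst (nth zs))) zsss uss) vs)) w"
    using vs len lz fitz Y_obj_vars[OF w]
    by (intro ysubst_gamma) (auto simp: list_all2_conv_all_nth)
  also have "map2 (\<lambda>zs. ysubst (nth zs)) (map2 (map2 (\<lambda>zs. ysubst (nth zs))) zsss uss) vs
    = map2 (\<lambda>zs. ysubst (nth zs)) (map concat zsss) (map2 y_gamma vs uss)"
    using vs len lz fitz
    by (intro nth_equalityI) (auto simp: list_all2_conv_all_nth Y_obj_vars intro!: ysubst_gamma[symmetric])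
  also have "ysubst (nth \<dots>) w = ysubst (nth (concat (map concat zsss))) (y_gamma w (map2 y_gamma vs uss))"
    by (rule ysubst_gamma[symmetric, OF fitcz]) (use len Y_obj_vars[OF w] in simp)
  also have "concat (map concat zsss) = ?Z"
    unfolding zss(1)[symmetric] zsss(1)[symmetric] by (induction zsss) simp_all
  finally show "ysubst (nth ?Z) (y_gamma (y_gamma w vs) (concat uss)) = ysubst (nth ?Z) (y_gamma w (map2 y_gamma vs uss))" .
qed

lemma y_act_id: "y_act w id = w"
  by (simp add: y_act_def)

lemma y_act_y_act:
  assumes "\<sigma> permutes A" "\<rho> permutes A"
  shows "y_act (y_act w \<sigma>) \<rho> = y_act w (\<sigma> \<circ> \<rho>)"
  using o_inv_distrib[OF permutes_bij[OF assms(1)] permutes_bij[OF assms(2)]]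
  by (simp add: y_act_def ysubst_ysubst comp_def)

text \<open>
  The action is characterized by \<open>(v \<cdot> \<sigma>)(\<sigma>\<^sup>-\<^sup>1 zs) = v(zs)\<close>, since every list of length \<open>n\<close> is of the
  form \<open>permute_list \<sigma> zs\<close>.
\<close>

lemma eq_of_ysubst_act:
  assumes "\<sigma> permutes {..<n}" "u \<in> Y_obj n" "v \<in> Y_obj n"
    and eq: "\<And>zs. length zs = n \<Longrightarrow> ysubst (nth (permute_list \<sigma> zs)) u = ysubst (nth zs) v"
  shows "u = y_act v \<sigma>"
proof (rule eq_of_ysubst_variables[OF assms(2) y_act_Y_obj[OF assms(3,1)]])
  let ?Z = "map YVar [0..<n]" and ?z = "permute_list (inv \<sigma>) (map YVar [0..<n])"
  have z: "permute_list \<sigma> ?z = ?Z"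
    using permute_list_compose[of \<sigma> ?Z "inv \<sigma>"] assms(1) by (simp add: permutes_inv_o)
  show "ysubst (nth ?Z) u = ysubst (nth ?Z) (y_act v \<sigma>)"
    using eq[of ?z] ysubst_act[of \<sigma> ?z v] assms(1,3) z by (simp add: Y_obj_vars)
qed

lemma y_gamma_act_outer:
  assumes w: "w \<in> Y_obj (length ws)" and ws: "list_all2 (\<lambda>j v. v \<in> Y_obj j) js ws"
    and \<sigma>: "\<sigma> permutes {..<length ws}"
  shows "y_gamma (y_act w \<sigma>) (permute_list \<sigma> ws) = y_act (y_gamma w ws) (block_perm \<sigma> js)"
proof (rule eq_of_ysubst_act)
  have len: "length js = length ws" using ws list_all2_lengthD by blast
  show "block_perm \<sigma> js permutes {..<sum_list js}"
    using block_perm_permutes \<sigma> len by simp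
  show "y_gamma w ws \<in> Y_obj (sum_list js)" by (rule y_gamma_Y_obj[OF w ws])
  have "list_all2 (\<lambda>j v. v \<in> Y_obj j) (permute_list \<sigma> js) (permute_list \<sigma> ws)"
    using ws len \<sigma> list_all2_permute_list_iff by metis
  from y_gamma_Y_obj[OF _ this, of "y_act w \<sigma>"]
  have "y_gamma (y_act w \<sigma>) (permute_list \<sigma> ws) \<in> Y_obj (sum_list (permute_list \<sigma> js))"
    using y_act_Y_obj[OF w \<sigma>] by simp
  moreover have "sum_list (permute_list \<sigma> js) = sum_list js"
    using \<sigma> len by (metis mset_permute_list sum_mset_sum_list)
  ultimately show "y_gamma (y_act w \<sigma>) (permute_list \<sigma> ws) \<in> Y_obj (sum_list js)" by simp
  fix zs :: "yword list" assume "length zs = sum_list js"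
  then obtain zss where zss: "concat zss = zs" "map length zss = js" using split_list_lengths by blast
  have lz: "length zss = length ws" using arg_cong[OF zss(2), of length] len by simp
  have fit: "fits zss ws" using ws unfolding zss(2)[symmetric] by (simp add: list_all2_map1)
  have "permute_list (block_perm \<sigma> js) zs = concat (permute_list \<sigma> zss)"
    using permute_list_block_perm[of \<sigma> zss] \<sigma> lz zss by simp
  also have "ysubst (nth \<dots>) (y_gamma (y_act w \<sigma>) (permute_list \<sigma> ws))
    = ysubst (nth (map2 (\<lambda>zs. ysubst (nth zs)) (permute_list \<sigma> zss) (permute_list \<sigma> ws))) (y_act w \<sigma>)"
    using fit \<sigma> lz y_act_Y_obj[OF w \<sigma>]
    by (intro ysubst_gamma) (auto simp: list_all2_permute_list_iff Y_obj_vars)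
  also have "map2 (\<lambda>zs. ysubst (nth zs)) (permute_list \<sigma> zss) (permute_list \<sigma> ws)
    = permute_list \<sigma> (map2 (\<lambda>zs. ysubst (nth zs)) zss ws)"
    using \<sigma> lz by (simp add: permute_list_zip permute_list_map)
  also have "ysubst (nth \<dots>) (y_act w \<sigma>) = ysubst (nth (map2 (\<lambda>zs. ysubst (nth zs)) zss ws)) w"
    using \<sigma> lz w by (intro ysubst_act) (auto simp: Y_obj_vars)
  also have "\<dots> = ysubst (nth zs) (y_gamma w ws)"
    using ysubst_gamma[OF fit, of w] w zss by (simp add: Y_obj_vars)
  finally show "ysubst (nth (permute_list (block_perm \<sigma> js) zs)) (y_gamma (y_act w \<sigma>) (permute_list \<sigma> ws))
    = ysubst (nth zs) (y_gamma w ws)" .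
qed

lemma y_gamma_act_inner:
  assumes w: "w \<in> Y_obj (length ws)" and ws: "list_all2 (\<lambda>j v. v \<in> Y_obj j) js ws"
    and \<rho>s: "list_all2 (\<lambda>\<rho> j. \<rho> permutes {..<j}) \<rho>s js"
  shows "y_gamma w (map2 y_act ws \<rho>s) = y_act (y_gamma w ws) (sum_perm \<rho>s js)"
proof (rule eq_of_ysubst_act)
  have len: "length js = length ws" "length \<rho>s = length ws"
    using list_all2_lengthD[OF ws] list_all2_lengthD[OF \<rho>s] by simp_all
  show "sum_perm \<rho>s js permutes {..<sum_list js}"
    using sum_perm_permutes \<rho>s by simp
  show "y_gamma w ws \<in> Y_obj (sum_list js)" by (rule y_gamma_Y_obj[OF w ws])
  show "y_gamma w (map2 y_act ws \<rho>s) \<in> Y_obj (sum_list js)"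
    using w ws \<rho>s len
    by (intro y_gamma_Y_obj) (auto simp: list_all2_conv_all_nth y_act_Y_obj)
  fix zs :: "yword list" assume "length zs = sum_list js"
  then obtain zss where zss: "concat zss = zs" "map length zss = js" using split_list_lengths by blast
  have lz: "length zss = length ws" using arg_cong[OF zss(2), of length] len by simp
  have fit: "fits zss ws" using ws unfolding zss(2)[symmetric] by (simp add: list_all2_map1)
  have r: "list_all2 (\<lambda>\<rho> xs. \<rho> permutes {..<length xs}) \<rho>s zss"
    using \<rho>s unfolding zss(2)[symmetric] by (simp add: list_all2_map2)
  have "permute_list (sum_perm \<rho>s js) zs = concat (map2 permute_list \<rho>s zss)"
    using permute_list_sum_perm[OF r] zss by simp
  also have "ysubst (nth \<dots>) (y_gamma w (map2 y_act ws \<rho>s))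
    = ysubst (nth (map2 (\<lambda>zs. ysubst (nth zs)) (map2 permute_list \<rho>s zss) (map2 y_act ws \<rho>s))) w"
    using fit r lz len w
    by (intro ysubst_gamma) (auto simp: list_all2_conv_all_nth Y_obj_vars y_act_Y_obj)
  also have "map2 (\<lambda>zs. ysubst (nth zs)) (map2 permute_list \<rho>s zss) (map2 y_act ws \<rho>s)
    = map2 (\<lambda>zs. ysubst (nth zs)) zss ws"
    using r fit lz len
    by (intro nth_equalityI) (auto simp: list_all2_conv_all_nth Y_obj_vars ysubst_act)
  also have "ysubst (nth \<dots>) w = ysubst (nth zs) (y_gamma w ws)"
    using ysubst_gamma[OF fit, of w] w zss by (simp add: Y_obj_vars)
  finally show "ysubst (nth (permute_list (sum_perm \<rho>s js) zs)) (y_gamma w (map2 y_act ws \<rho>s))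
    = ysubst (nth zs) (y_gamma w ws)" .
qed

section \<open>Canonical maps under substitution, and naturality\<close>

lemma y_gamma_YVar: "y_gamma (YVar i) ws = ysubst (\<lambda>j. YVar (sum_list (map y_arity (take i ws)) + j)) (ws ! i)"
  by (simp add: y_gamma_def)

lemma y_gamma_eq_ysubst: "y_gamma w ws = ysubst (\<lambda>i. y_gamma (YVar i) ws) w"
  by (simp add: y_gamma_def)

lemma y_eval_ysubst:
  "\<forall>i\<in>set (yvars w). ys ! i = y_eval C (s i) xs \<Longrightarrow> y_eval C (ysubst s w) xs = y_eval C w ys"
  by (induction w) simp_all

text \<open>
  The generating rules of \<open>canonical\<close> are closed under substituting words for variables, provided that
  the values at which the given map is formed are those of the substituted words.
\<close>

lemma canonical_ysubst:
  assumes "canonical C ys u v f" "\<forall>i\<in>set (yvars u). ys ! i = y_eval C (s i) xs"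
  shows "canonical C xs (ysubst s u) (ysubst s v) f"
  using assms
proof (induction rule: canonical.induct)
  case (canonical_id w)
  then show ?case using canonical.canonical_id[of C xs "ysubst s w"] y_eval_ysubst[of w ys C s xs] by simp
next
  case (canonical_Assoc u v w)
  then show ?case
    using canonical.canonical_Assoc[of C xs "ysubst s u" "ysubst s v" "ysubst s w"]
      y_eval_ysubst[of u ys C s xs] y_eval_ysubst[of v ys C s xs] y_eval_ysubst[of w ys C s xs] by simp
next
  case (canonical_RUnit w)
  then show ?case
    using canonical.canonical_RUnit[of C xs "ysubst s w"] y_eval_ysubst[of w ys C s xs] by simp
next
  case (canonical_Symm u v)
  then show ?case
    using canonical.canonical_Symm[of C xs "ysubst s u" "ysubst s v"]
      y_eval_ysubst[of u ys C s xs] y_eval_ysubst[of v ys C s xs] by simp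
next
  case (canonical_inverse u v f g)
  then show ?case
    using canonical_set_yvars[OF canonical_inverse.hyps(1)] canonical.canonical_inverse by metis
next
  case (canonical_Comp v w g u f)
  then show ?case
    using canonical_set_yvars[OF canonical_Comp.hyps(2)] canonical.canonical_Comp by metis
next
  case (canonical_Tensor u u' f v v' g)
  then show ?case by (simp add: canonical.canonical_Tensor)
qed

text \<open>
  Two ways to obtain canonical maps between composite words: this lemma substitutes fixed inner words
  into a canonical map between outer words, and \<open>canonical_gamma_inner\<close> evaluates a fixed outer word
  at canonical maps between inner words.
\<close>

lemma canonical_gamma:
  assumes "canonical C (map2 (\<lambda>xs w. y_eval C w xs) xss ws) u v f"
    and fit: "fits xss ws" and u: "vars_below u (length ws)"
  shows "canonical C (concat xss) (y_gamma u ws) (y_gamma v ws) f"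
  unfolding y_gamma_eq_ysubst[of u] y_gamma_eq_ysubst[of v]
proof (rule canonical_ysubst[OF assms(1)], intro ballI)
  fix i assume "i \<in> set (yvars u)"
  then have "i < length ws" using u by auto
  then show "map2 (\<lambda>xs w. y_eval C w xs) xss ws ! i = y_eval C (y_gamma (YVar i) ws) (concat xss)"
    using y_eval_gamma[OF fit, of "YVar i" C] by simp
qed

lemma canonical_act:
  assumes "canonical C xs u v f" and \<sigma>: "\<sigma> permutes {..<length xs}" and u: "vars_below u (length xs)"
  shows "canonical C (permute_list \<sigma> xs) (y_act u \<sigma>) (y_act v \<sigma>) f"
  unfolding y_act_def
proof (rule canonical_ysubst[OF assms(1)], intro ballI)
  fix i assume "i \<in> set (yvars u)"
  then show "xs ! i = y_eval C (YVar (inv \<sigma> i)) (permute_list \<sigma> xs)"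
    using y_eval_act[OF \<sigma>, of "YVar i" C] u by (simp add: y_act_def subset_iff)
qed

lemma canonical_y_eval_arr:
  "\<forall>i\<in>set (yvars w). canonical C xs (s i) (t i) (fs ! i)
    \<Longrightarrow> canonical C xs (ysubst s w) (ysubst t w) (y_eval_arr C w fs)"
proof (induction w)
  case YE
  then show ?case using canonical_id[of C xs YE] by simp
qed (simp_all add: canonical_Tensor)

lemma canonical_gamma_inner:
  assumes us: "fits xss us" and vs: "fits xss vs" and w: "vars_below w (length xss)"
    and fs: "\<And>i. i < length xss \<Longrightarrow> canonical C (xss ! i) (us ! i) (vs ! i) (fs ! i)"
  shows "canonical C (concat xss) (y_gamma w us) (y_gamma w vs) (y_eval_arr C w fs)"
  unfolding y_gamma_eq_ysubst[of w]
proof (rule canonical_y_eval_arr, intro ballI)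
  fix i assume "i \<in> set (yvars w)"
  then have i: "i < length xss" using w by auto
  have u: "us ! i \<in> Y_obj (length (xss ! i))" using us i by (simp add: list_all2_conv_all_nth)
  have "map y_arity us = map length xss" "map y_arity vs = map length xss"
    using us vs by (auto simp: list_all2_conv_all_nth Y_obj_arity intro!: nth_equalityI)
  then have o: "map y_arity (take i us) = map length (take i xss)" "map y_arity (take i vs) = map length (take i xss)"
    by (metis take_map)+
  show "canonical C (concat xss) (y_gamma (YVar i) us) (y_gamma (YVar i) vs) (fs ! i)"
    unfolding y_gamma_YVar o
    by (rule canonical_ysubst[OF fs[OF i]]) (simp add: Y_obj_vars[OF u] nth_concat_offset i)
qed

lemma canonical_Y_obj: "canonical C xs u v f \<Longrightarrow> u \<in> Y_obj n \<Longrightarrow> v \<in> Y_obj n"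
  using canonical_mset_yvars[of C xs u v f] by (simp add: Y_obj_iff_mset)

context symmetric_monoidal_category
begin

lemma y_eval_arr_typed [simp]:
  assumes "vars_below w (length hs)" "set hs \<subseteq> Arr C"
  shows "y_eval_arr C w hs \<in> Arr C" "Dom C (y_eval_arr C w hs) = y_eval C w (map (Dom C) hs)"
    "Cod C (y_eval_arr C w hs) = y_eval C w (map (Cod C) hs)"
proof -
  have "y_eval_arr C w hs \<in> Arr C \<and> Dom C (y_eval_arr C w hs) = y_eval C w (map (Dom C) hs)
    \<and> Cod C (y_eval_arr C w hs) = y_eval C w (map (Cod C) hs)"
    using assms(1) by (induction w) (use assms(2) in \<open>auto simp: subset_iff\<close>)
  then show "y_eval_arr C w hs \<in> Arr C" "Dom C (y_eval_arr C w hs) = y_eval C w (map (Dom C) hs)"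
    "Cod C (y_eval_arr C w hs) = y_eval C w (map (Cod C) hs)" by simp_all
qed

lemma y_eval_Obj_list [simp]: "\<lbrakk>vars_below w (length xs); set xs \<subseteq> Obj C\<rbrakk> \<Longrightarrow> y_eval C w xs \<in> Obj C"
  by (rule y_eval_Obj) (auto simp: subset_iff)

lemma y_eval_arr_Comp:
  assumes "vars_below w (length hs)" "set hs \<subseteq> Arr C" "set gs \<subseteq> Arr C" "map (Dom C) gs = map (Cod C) hs"
  shows "y_eval_arr C w (map2 (Comp C) gs hs) = y_eval_arr C w gs \<cdot> y_eval_arr C w hs"
  using assms(1)
proof (induction w)
  case (YVar i)
  then show ?case using arg_cong[OF assms(4), of length] by simp
next
  case (YSum u v)
  have "length gs = length hs" using arg_cong[OF assms(4), of length] by simp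
  then show ?case using YSum assms by (simp add: interchange)
qed simp

text \<open>
  The canonical map at the targets is only claimed to exist, because the induction has to produce it
  from the derivation of \<open>f\<close>. Uniqueness identifies it afterwards, in \<open>y_can_natural\<close>.
\<close>

lemma canonical_natural:
  assumes "canonical C xs u v f" "vars_below u (length hs)" "xs = map (Dom C) hs" "set hs \<subseteq> Arr C"
  shows "\<exists>f'. canonical C (map (Cod C) hs) u v f' \<and> y_eval_arr C v hs \<cdot> f = f' \<cdot> y_eval_arr C u hs"
  using assms(1,2)
proof (induction rule: canonical.induct)
  case (canonical_id w)
  show ?case
    by (rule exI[of _ "\<i> (y_eval C w (map (Cod C) hs))"])
      (use canonical_id assms(3,4) in \<open>simp add: canonical.canonical_id\<close>)
next
  case (canonical_Assoc u v w)
  show ?case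
    by (intro exI conjI, rule canonical.canonical_Assoc)
     (use canonical_Assoc assms(3,4) Assoc_nat[of "y_eval_arr C u hs" "y_eval_arr C v hs" "y_eval_arr C w hs"] in simp)
next
  case (canonical_RUnit w)
  show ?case
    by (intro exI conjI, rule canonical.canonical_RUnit)
     (use canonical_RUnit assms(3,4) RUnit_nat[of "y_eval_arr C w hs"] in simp)
next
  case (canonical_Symm u v)
  show ?case
    by (intro exI conjI, rule canonical.canonical_Symm)
     (use canonical_Symm assms(3,4) Symm_nat[of "y_eval_arr C u hs" "y_eval_arr C v hs"] in simp)
next
  case (canonical_inverse u v f g)
  let ?X = "map (Cod C) hs"
  have vars: "set (yvars u) = set (yvars v)" using canonical_set_yvars[OF canonical_inverse.hyps(1)] .
  then obtain f' where f': "canonical C ?X u v f'" "y_eval_arr C v hs \<cdot> f = f' \<cdot> y_eval_arr C u hs"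
    using canonical_inverse by auto
  have ob: "\<forall>i\<in>set (yvars u). ?X ! i \<in> Obj C" "\<forall>i\<in>set (yvars u). xs ! i \<in> Obj C"
    using canonical_inverse.prems vars assms(3,4) by (auto simp: subset_iff)
  note t' = canonical_typed[OF f'(1) ob(1)] canonical_iso[OF f'(1) ob(1)]
  note t = canonical_typed[OF canonical_inverse.hyps(1) ob(2)]
  note g = inverse_arrowsD[OF canonical_inverse.hyps(2)]
  have us: "vars_below u (length hs)" "vars_below v (length hs)" using canonical_inverse.prems vars by auto
  have "y_eval_arr C u hs \<cdot> g = inverse_arr f' \<cdot> y_eval_arr C v hs"
  proof (rule iso_left_cancel[of f'])
    have "f' \<cdot> (y_eval_arr C u hs \<cdot> g) = (y_eval_arr C v hs \<cdot> f) \<cdot> g"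
      unfolding f'(2) using t t' g us assms(3,4) by (simp add: assoc)
    also have "\<dots> = y_eval_arr C v hs" using t t' g us assms(3,4) by (simp add: assoc)
    also have "\<dots> = f' \<cdot> (inverse_arr f' \<cdot> y_eval_arr C v hs)"
      using t' us assms(3,4) by (simp add: rewrite_head[OF inverse_arr_typed(5)])
    finally show "f' \<cdot> (y_eval_arr C u hs \<cdot> g) = f' \<cdot> (inverse_arr f' \<cdot> y_eval_arr C v hs)" .
  qed (use t t' g us assms(3,4) in simp_all)
  then show ?case using canonical_inverse_arr[OF f'(1) ob(1)] by blast
next
  case (canonical_Comp v w g u f)
  let ?X = "map (Cod C) hs"
  have vars: "set (yvars u) = set (yvars v)" "set (yvars v) = set (yvars w)"
    using canonical_set_yvars[OF canonical_Comp.hyps(2)] canonical_set_yvars[OF canonical_Comp.hyps(1)] .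
  obtain f' g' where f': "canonical C ?X u v f'" "y_eval_arr C v hs \<cdot> f = f' \<cdot> y_eval_arr C u hs"
    and g': "canonical C ?X v w g'" "y_eval_arr C w hs \<cdot> g = g' \<cdot> y_eval_arr C v hs"
    using canonical_Comp vars by auto
  have ob: "\<forall>i\<in>set (yvars u). ?X ! i \<in> Obj C" "\<forall>i\<in>set (yvars v). ?X ! i \<in> Obj C"
     "\<forall>i\<in>set (yvars u). xs ! i \<in> Obj C"  "\<forall>i\<in>set (yvars v). xs ! i \<in> Obj C"
    using canonical_Comp.prems vars assms(3,4) by (auto simp: subset_iff)
  note t = canonical_typed[OF f'(1) ob(1)] canonical_typed[OF g'(1) ob(2)]
    canonical_typed[OF canonical_Comp.hyps(2) ob(3)] canonical_typed[OF canonical_Comp.hyps(1) ob(4)]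
  have us: "vars_below u (length hs)" "vars_below v (length hs)" "vars_below w (length hs)"
    using canonical_Comp.prems vars by auto
  have "y_eval_arr C w hs \<cdot> (g \<cdot> f) = (y_eval_arr C w hs \<cdot> g) \<cdot> f"
    using t us assms(3,4) by (simp add: assoc)
  also have "\<dots> = (g' \<cdot> f') \<cdot> y_eval_arr C u hs"
    unfolding g'(2) using t us assms(3,4) f'(2) by (simp add: assoc)
  finally show ?case using canonical.canonical_Comp[OF g'(1) f'(1)] by blast
next
  case (canonical_Tensor u u' f v v' g)
  let ?X = "map (Cod C) hs"
  have vars: "set (yvars u) = set (yvars u')" "set (yvars v) = set (yvars v')"
    using canonical_set_yvars[OF canonical_Tensor.hyps(1)] canonical_set_yvars[OF canonical_Tensor.hyps(2)] .
  obtain f' g' where f': "canonical C ?X u u' f'" "y_eval_arr C u' hs \<cdot> f = f' \<cdot> y_eval_arr C u hs"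
    and g': "canonical C ?X v v' g'" "y_eval_arr C v' hs \<cdot> g = g' \<cdot> y_eval_arr C v hs"
    using canonical_Tensor by auto
  have ob: "\<forall>i\<in>set (yvars u). ?X ! i \<in> Obj C" "\<forall>i\<in>set (yvars v). ?X ! i \<in> Obj C"
     "\<forall>i\<in>set (yvars u). xs ! i \<in> Obj C"  "\<forall>i\<in>set (yvars v). xs ! i \<in> Obj C"
    using canonical_Tensor.prems vars assms(3,4) by (auto simp: subset_iff)
  note t = canonical_typed[OF f'(1) ob(1)] canonical_typed[OF g'(1) ob(2)]
    canonical_typed[OF canonical_Tensor.hyps(1) ob(3)] canonical_typed[OF canonical_Tensor.hyps(2) ob(4)]
  have us: "vars_below u (length hs)" "vars_below v (length hs)"
    "vars_below u' (length hs)" "vars_below v' (length hs)"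
    using canonical_Tensor.prems vars by auto
  have "y_eval_arr C (YSum u' v') hs \<cdot> (f \<uplus> g) = (f' \<uplus> g') \<cdot> y_eval_arr C (YSum u v) hs"
    using t us assms(3,4) f'(2) g'(2) by (simp add: interchange)
  then show ?case using canonical.canonical_Tensor[OF f'(1) g'(1)] by blast
qed

lemma canonical_unique:
  assumes "canonical C xs u v f" "canonical C xs u v g" "u \<in> Y_obj (length xs)" "set xs \<subseteq> Obj C"
  shows "f = g"
proof -
  have "\<forall>i<length xs. xs ! i \<in> Obj C" using assms(4) by (auto simp: subset_iff)
  from coherence[OF assms(3) canonical_Y_obj[OF assms(1,3)] this] show ?thesis using assms(1,2) by blast
qed

lemma canonical_y_can:
  assumes "u \<in> Y_obj (length xs)" "v \<in> Y_obj (length xs)" "set xs \<subseteq> Obj C"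
  shows "canonical C xs u v (y_can C u v xs)"
proof -
  have "\<forall>i<length xs. xs ! i \<in> Obj C" using assms(3) by (auto simp: subset_iff)
  from theI'[OF coherence[OF assms(1,2) this]] show ?thesis unfolding y_can_def .
qed

lemma y_can_typed [simp]:
  assumes "u \<in> Y_obj (length xs)" "v \<in> Y_obj (length xs)" "set xs \<subseteq> Obj C"
  shows "y_can C u v xs \<in> Arr C" "Dom C (y_can C u v xs) = y_eval C u xs" "Cod C (y_can C u v xs) = y_eval C v xs"
proof -
  have "\<forall>i\<in>set (yvars u). xs ! i \<in> Obj C" using assms(1,3) by (auto simp: Y_obj_vars)
  from canonical_typed[OF canonical_y_can[OF assms] this]
  show "y_can C u v xs \<in> Arr C" "Dom C (y_can C u v xs) = y_eval C u xs" "Cod C (y_can C u v xs) = y_eval C v xs" .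
qed

lemma y_can_refl: "\<lbrakk>u \<in> Y_obj (length xs); set xs \<subseteq> Obj C\<rbrakk> \<Longrightarrow> y_can C u u xs = \<i> (y_eval C u xs)"
  by (rule canonical_unique[OF canonical_y_can canonical_id])

lemma y_can_natural:
  assumes "u \<in> Y_obj (length hs)" "v \<in> Y_obj (length hs)" "set hs \<subseteq> Arr C"
  shows "y_eval_arr C v hs \<cdot> y_can C u v (map (Dom C) hs) = y_can C u v (map (Cod C) hs) \<cdot> y_eval_arr C u hs"
proof -
  have ob: "set (map (Dom C) hs) \<subseteq> Obj C" "set (map (Cod C) hs) \<subseteq> Obj C" using assms(3) by auto
  have "canonical C (map (Dom C) hs) u v (y_can C u v (map (Dom C) hs))"
    by (rule canonical_y_can) (use assms ob in simp_all)
  from canonical_natural[OF this _ refl assms(3)] obtain f'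
    where f': "canonical C (map (Cod C) hs) u v f'"
      "y_eval_arr C v hs \<cdot> y_can C u v (map (Dom C) hs) = f' \<cdot> y_eval_arr C u hs"
    using Y_obj_vars[OF assms(1)] by auto
  have "canonical C (map (Cod C) hs) u v (y_can C u v (map (Cod C) hs))"
    by (rule canonical_y_can) (use assms ob in simp_all)
  from canonical_unique[OF f'(1) this] f'(2) assms ob show ?thesis by simp
qed

end

section \<open>The underlying multicategory\<close>

locale smc_with_word_choice = symmetric_monoidal_category C
  for C :: "('o, 'm) smc" (structure) +
  fixes \<kappa> :: "'o list \<Rightarrow> yword"
  assumes word_choice: "word_choice C \<kappa>"
begin

abbreviation U :: "('o, 'o list \<times> 'm) mcat" where "U \<equiv> underlying C \<kappa>"

lemma kappa_Y_obj [simp]: "set xs \<subseteq> Obj C \<Longrightarrow> \<kappa> xs \<in> Y_obj (length xs)"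
  using word_choice by (simp add: word_choice_def)

lemma kappa_vars [simp]: "set xs \<subseteq> Obj C \<Longrightarrow> set (yvars (\<kappa> xs)) = {..<length xs}"
  by (simp add: Y_obj_vars)

lemma kbar_Obj [simp]: "set xs \<subseteq> Obj C \<Longrightarrow> kbar C \<kappa> xs \<in> Obj C"
  by (simp add: kbar_def)

lemma gamma_kappa_Y_obj:
  assumes "set ys \<subseteq> Obj C" "length xss = length ys" "\<forall>xs\<in>set xss. set xs \<subseteq> Obj C"
  shows "y_gamma (\<kappa> ys) (map \<kappa> xss) \<in> Y_obj (length (concat xss))"
  unfolding length_concat
  by (rule y_gamma_Y_obj) (use assms in \<open>auto simp: list_all2_conv_all_nth\<close>)

lemma fits_kappa: "\<forall>xs\<in>set xss. set xs \<subseteq> Obj C \<Longrightarrow> fits xss (map \<kappa> xss)"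
  by (auto simp: list_all2_conv_all_nth)

lemma map2_eval_kappa: "map2 (\<lambda>xs w. y_eval C w xs) xss (map \<kappa> xss) = map (kbar C \<kappa>) xss"
  by (intro nth_equalityI) (auto simp: kbar_def)

lemma eval_gamma_kappa:
  assumes "set ys \<subseteq> Obj C" "length xss = length ys" "\<forall>xs\<in>set xss. set xs \<subseteq> Obj C"
  shows "y_eval C (y_gamma (\<kappa> ys) (map \<kappa> xss)) (concat xss) = y_eval C (\<kappa> ys) (map (kbar C \<kappa>) xss)"
  using y_eval_gamma[OF fits_kappa[OF assms(3)], of "\<kappa> ys" C] assms by (simp add: map2_eval_kappa)

abbreviation \<phi> :: "'o list \<Rightarrow> 'o list list \<Rightarrow> 'm" where
  "\<phi> ys xss \<equiv> y_can C (\<kappa> (concat xss)) (y_gamma (\<kappa> ys) (map \<kappa> xss)) (concat xss)"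

lemma concat_Obj: "\<forall>xs\<in>set xss. set xs \<subseteq> Obj C \<Longrightarrow> set (concat xss) \<subseteq> Obj C"
  by auto

lemma phi_canonical:
  assumes "set ys \<subseteq> Obj C" "length xss = length ys" "\<forall>xs\<in>set xss. set xs \<subseteq> Obj C"
  shows "canonical C (concat xss) (\<kappa> (concat xss)) (y_gamma (\<kappa> ys) (map \<kappa> xss)) (\<phi> ys xss)"
  by (rule canonical_y_can[OF kappa_Y_obj gamma_kappa_Y_obj]) (use assms in auto)

lemma phi_typed [simp]:
  assumes "set ys \<subseteq> Obj C" "length xss = length ys" "\<forall>xs\<in>set xss. set xs \<subseteq> Obj C"
  shows "\<phi> ys xss \<in> Arr C" "Dom C (\<phi> ys xss) = kbar C \<kappa> (concat xss)"
    "Cod C (\<phi> ys xss) = y_eval C (\<kappa> ys) (map (kbar C \<kappa>) xss)"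
  using y_can_typed[OF kappa_Y_obj[OF concat_Obj[OF assms(3)]] gamma_kappa_Y_obj[OF assms] concat_Obj[OF assms(3)]]
  by (simp_all only: eval_gamma_kappa[OF assms] kbar_def)

abbreviation \<theta> :: "'o list \<Rightarrow> (nat \<Rightarrow> nat) \<Rightarrow> 'm" where
  "\<theta> xs \<sigma> \<equiv> y_can C (\<kappa> (permute_list \<sigma> xs)) (y_act (\<kappa> xs) \<sigma>) (permute_list \<sigma> xs)"

lemma MArr_underlying: "f \<in> MArr U \<longleftrightarrow> set (fst f) \<subseteq> Obj C \<and> snd f \<in> Arr C \<and> Dom C (snd f) = kbar C \<kappa> (fst f)"
  by (auto simp: underlying_def)

lemma MTgt_underlying: "MTgt U f = Cod C (snd f)"
  by (simp add: underlying_def case_prod_beta)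

lemma MSrc_underlying: "MSrc U f = fst f"
  by (simp add: underlying_def)

lemma MObj_underlying: "MObj U = Obj C"
  by (simp add: underlying_def)

lemma mhom_underlying:
  "f \<in> mhom U xs y \<longleftrightarrow> set xs \<subseteq> Obj C \<and> fst f = xs \<and> snd f \<in> Arr C \<and> Dom C (snd f) = kbar C \<kappa> xs \<and> Cod C (snd f) = y"
  by (auto simp: mhom_def MArr_underlying MTgt_underlying MSrc_underlying)

lemma MComp_underlying:
  "MComp U g fs = (concat (map fst fs),
    snd g \<cdot> y_eval_arr C (\<kappa> (fst g)) (map snd fs) \<cdot> \<phi> (fst g) (map fst fs))"
  by (simp add: underlying_def case_prod_beta Let_def)

lemma MAct_underlying:
  "MAct U \<sigma> f = (permute_list \<sigma> (fst f), snd f \<cdot> \<theta> (fst f) \<sigma>)"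
  by (simp add: underlying_def case_prod_beta Let_def)

lemma MId_underlying: "MId U a = ([a], y_can C (\<kappa> [a]) y_one [a])"
  by (simp add: underlying_def)

lemmas underlying_simps = MArr_underlying MTgt_underlying MSrc_underlying MObj_underlying
  MComp_underlying MAct_underlying MId_underlying

lemma mcomposable_underlying:
  "mcomposable U g fs \<longleftrightarrow> set (fst g) \<subseteq> Obj C \<and> snd g \<in> Arr C \<and> Dom C (snd g) = kbar C \<kappa> (fst g)
    \<and> (\<forall>xs\<in>set (map fst fs). set xs \<subseteq> Obj C) \<and> set (map snd fs) \<subseteq> Arr C
    \<and> map (Dom C) (map snd fs) = map (kbar C \<kappa>) (map fst fs) \<and> map (Cod C) (map snd fs) = fst g"
  unfolding mcomposable_def MSrc_underlying MTgt_underlying[abs_def]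
  by (auto simp: MArr_underlying subset_iff comp_def)

lemma composite_typed:
  assumes "mcomposable U g fs"
  shows "length fs = length (fst g)"
    "y_eval_arr C (\<kappa> (fst g)) (map snd fs) \<in> Arr C"
    "Dom C (y_eval_arr C (\<kappa> (fst g)) (map snd fs)) = y_eval C (\<kappa> (fst g)) (map (kbar C \<kappa>) (map fst fs))"
    "Cod C (y_eval_arr C (\<kappa> (fst g)) (map snd fs)) = kbar C \<kappa> (fst g)"
    "\<phi> (fst g) (map fst fs) \<in> Arr C"
    "Dom C (\<phi> (fst g) (map fst fs)) = kbar C \<kappa> (concat (map fst fs))"
    "Cod C (\<phi> (fst g) (map fst fs)) = y_eval C (\<kappa> (fst g)) (map (kbar C \<kappa>) (map fst fs))"
proof -
  note a = assms[unfolded mcomposable_underlying]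
  show l: "length fs = length (fst g)" using a by (metis length_map)
  have s: "vars_below (\<kappa> (fst g)) (length (map snd fs))" "set (map snd fs) \<subseteq> Arr C" using a l by simp_all
  note e = y_eval_arr_typed[OF s]
  show "y_eval_arr C (\<kappa> (fst g)) (map snd fs) \<in> Arr C" by (rule e)
  show "Dom C (y_eval_arr C (\<kappa> (fst g)) (map snd fs)) = y_eval C (\<kappa> (fst g)) (map (kbar C \<kappa>) (map fst fs))"
    using e(2) a by (simp only:)
  show "Cod C (y_eval_arr C (\<kappa> (fst g)) (map snd fs)) = kbar C \<kappa> (fst g)"
    using e(3) a by (simp only: kbar_def)
  have p: "set (fst g) \<subseteq> Obj C" "length (map fst fs) = length (fst g)" "\<forall>xs\<in>set (map fst fs). set xs \<subseteq> Obj C"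
    using a l by simp_all
  show "\<phi> (fst g) (map fst fs) \<in> Arr C"
    "Dom C (\<phi> (fst g) (map fst fs)) = kbar C \<kappa> (concat (map fst fs))"
    "Cod C (\<phi> (fst g) (map fst fs)) = y_eval C (\<kappa> (fst g)) (map (kbar C \<kappa>) (map fst fs))"
    by (rule phi_typed[OF p])+
qed

lemma underlying_MComp_mhom:
  assumes "mcomposable U g fs"
  shows "MComp U g fs \<in> mhom U (concat (map (MSrc U) fs)) (MTgt U g)"
proof -
  note a = assms[unfolded mcomposable_underlying] and t = composite_typed[OF assms]
  have m: "map (MSrc U) fs = map fst fs" by (simp add: MSrc_underlying)
  have "set (concat (map fst fs)) \<subseteq> Obj C" using a by (intro concat_Obj) simp
  moreover have "snd (MComp U g fs) \<in> Arr C" "Dom C (snd (MComp U g fs)) = kbar C \<kappa> (concat (map fst fs))"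
    "Cod C (snd (MComp U g fs)) = Cod C (snd g)"
    unfolding MComp_underlying snd_conv using t a by simp_all
  ultimately show ?thesis
    unfolding mhom_underlying m MTgt_underlying by (simp add: MComp_underlying)
qed

lemma act_canonical:
  assumes "set xs \<subseteq> Obj C" "\<sigma> permutes {..<length xs}"
  shows "canonical C (permute_list \<sigma> xs) (\<kappa> (permute_list \<sigma> xs)) (y_act (\<kappa> xs) \<sigma>)
    (\<theta> xs \<sigma>)"
proof (rule canonical_y_can)
  show "\<kappa> (permute_list \<sigma> xs) \<in> Y_obj (length (permute_list \<sigma> xs))" using assms by (intro kappa_Y_obj) simp
  show "y_act (\<kappa> xs) \<sigma> \<in> Y_obj (length (permute_list \<sigma> xs))" using y_act_Y_obj[OF kappa_Y_obj] assms by simp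
qed (use assms in simp)

lemma act_typed:
  assumes "set xs \<subseteq> Obj C" "\<sigma> permutes {..<length xs}"
  shows "\<theta> xs \<sigma> \<in> Arr C"
    "Dom C (\<theta> xs \<sigma>) = kbar C \<kappa> (permute_list \<sigma> xs)"
    "Cod C (\<theta> xs \<sigma>) = kbar C \<kappa> xs"
proof -
  have k: "\<kappa> (permute_list \<sigma> xs) \<in> Y_obj (length (permute_list \<sigma> xs))" using assms by (intro kappa_Y_obj) simp
  have ob: "\<forall>i\<in>set (yvars (\<kappa> (permute_list \<sigma> xs))). permute_list \<sigma> xs ! i \<in> Obj C"
    using k assms nth_mem[of _ "permute_list \<sigma> xs"] by (auto simp: Y_obj_vars)
  note t = canonical_typed[OF act_canonical[OF assms] ob]
  show "\<theta> xs \<sigma> \<in> Arr C"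
    "Dom C (\<theta> xs \<sigma>) = kbar C \<kappa> (permute_list \<sigma> xs)"
    "Cod C (\<theta> xs \<sigma>) = kbar C \<kappa> xs"
    using t y_eval_act[OF assms(2), of "\<kappa> xs" C] assms(1) by (simp_all add: kbar_def)
qed

lemma underlying_MAct_mhom:
  assumes "f \<in> mhom U xs y" "\<sigma> permutes {..<length xs}"
  shows "MAct U \<sigma> f \<in> mhom U (permute_list \<sigma> xs) y"
  using assms act_typed[of xs \<sigma>] unfolding mhom_underlying by (simp add: MAct_underlying)

lemma one_Y_obj: "y_one \<in> Y_obj (Suc 0)"
  by (auto simp: Y_obj_def)

lemma underlying_MId_mhom: "a \<in> MObj U \<Longrightarrow> MId U a \<in> mhom U [a] a"
  using y_can_typed[of "\<kappa> [a]" "[a]" y_one] kappa_Y_obj[of "[a]"] one_Y_obj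
  by (simp add: mhom_underlying MObj_underlying MId_underlying kbar_def)

text \<open>
  Naturality moves the identity map of the target past \<open>f\<close>, where it meets \<open>\<phi>\<close> and forms a canonical
  endomorphism of \<open>\<kappa> xs\<close>.
\<close>

lemma underlying_MId_left:
  assumes "f \<in> MArr U"
  shows "MComp U (MId U (MTgt U f)) [f] = f"
proof -
  obtain xs h where f: "f = (xs, h)" by (cases f)
  have h: "set xs \<subseteq> Obj C" "h \<in> Arr C" "Dom C h = kbar C \<kappa> xs" using assms by (auto simp: MArr_underlying f)
  let ?y = "Cod C h" and ?b = "kbar C \<kappa> xs"
  have y: "?y \<in> Obj C" "?b \<in> Obj C" using h by auto
  have k: "\<kappa> [?y] \<in> Y_obj (length [?y])" using y by (intro kappa_Y_obj) simp
  then have k': "\<kappa> [?y] \<in> Y_obj (Suc 0)" by simp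
  have nat: "y_can C (\<kappa> [?y]) y_one [?y] \<cdot> y_eval_arr C (\<kappa> [?y]) [h] = h \<cdot> y_can C (\<kappa> [?y]) y_one [?b]"
    using y_can_natural[of "\<kappa> [?y]" "[h]" y_one] h k' one_Y_obj by simp
  have "canonical C [?b] (\<kappa> [?y]) y_one (y_can C (\<kappa> [?y]) y_one [?b])"
    by (rule canonical_y_can) (use k' one_Y_obj y in simp_all)
  then have "canonical C (map2 (\<lambda>xs w. y_eval C w xs) [xs] [\<kappa> xs]) (\<kappa> [?y]) y_one (y_can C (\<kappa> [?y]) y_one [?b])"
    by (simp add: kbar_def)
  from canonical_gamma[OF this] have "canonical C xs (y_gamma (\<kappa> [?y]) [\<kappa> xs]) (\<kappa> xs) (y_can C (\<kappa> [?y]) y_one [?b])"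
    using h k' by (simp add: y_gamma_one_left Y_obj_vars)
  moreover have "canonical C xs (\<kappa> xs) (y_gamma (\<kappa> [?y]) [\<kappa> xs]) (\<phi> [?y] [xs])"
    using phi_canonical[of "[?y]" "[xs]"] y h by simp
  ultimately have "canonical C xs (\<kappa> xs) (\<kappa> xs) (y_can C (\<kappa> [?y]) y_one [?b] \<cdot> \<phi> [?y] [xs])"
    by (rule canonical_Comp)
  from canonical_unique[OF this canonical_id] have c: "y_can C (\<kappa> [?y]) y_one [?b] \<cdot> \<phi> [?y] [xs] = \<i> ?b"
    using h by (simp add: kbar_def)
  have t: "y_can C (\<kappa> [?y]) y_one [?b] \<in> Arr C" "Dom C (y_can C (\<kappa> [?y]) y_one [?b]) = y_eval C (\<kappa> [?y]) [?b]"
    "Cod C (y_can C (\<kappa> [?y]) y_one [?b]) = ?b"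
    using y_can_typed[of "\<kappa> [?y]" "[?b]" y_one] k' one_Y_obj y by simp_all
  have p: "\<phi> [?y] [xs] \<in> Arr C" "Cod C (\<phi> [?y] [xs]) = y_eval C (\<kappa> [?y]) [?b]"
    using phi_typed[of "[?y]" "[xs]"] y h by simp_all
  have "MComp U (MId U (MTgt U f)) [f] = (xs, (h \<cdot> y_can C (\<kappa> [?y]) y_one [?b]) \<cdot> \<phi> [?y] [xs])"
    by (simp add: f MComp_underlying MId_underlying MTgt_underlying nat)
  also have "\<dots> = f" using h t p c by (simp add: assoc f)
  finally show ?thesis .
qed

lemma underlying_MId_right:
  assumes "f \<in> MArr U"
  shows "MComp U f (map (MId U) (MSrc U f)) = f"
proof -
  obtain xs h where f: "f = (xs, h)" by (cases f)
  have h: "set xs \<subseteq> Obj C" "h \<in> Arr C" "Dom C h = kbar C \<kappa> xs" using assms by (auto simp: MArr_underlying f)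
  let ?xss = "map (\<lambda>a. [a]) xs" and ?is = "map (\<lambda>a. y_can C (\<kappa> [a]) y_one [a]) xs"
  have cc: "concat ?xss = xs" by (induction xs) simp_all
  have ob: "\<forall>xs\<in>set ?xss. set xs \<subseteq> Obj C" using h by auto
  have "fits ?xss (map \<kappa> ?xss)" by (rule fits_kappa[OF ob])
  moreover have "fits ?xss (replicate (length xs) y_one)"
    using one_Y_obj by (simp add: list_all2_conv_all_nth)
  moreover have "canonical C (?xss ! i) (map \<kappa> ?xss ! i) (replicate (length xs) y_one ! i) (?is ! i)"
    if "i < length ?xss" for i
  proof -
    have "xs ! i \<in> Obj C" using that h by auto
    then show ?thesis
      using that canonical_y_can[of "\<kappa> [xs ! i]" "[xs ! i]" y_one] kappa_Y_obj[of "[xs ! i]"] one_Y_obj by simp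
  qed
  ultimately have "canonical C (concat ?xss) (y_gamma (\<kappa> xs) (map \<kappa> ?xss)) (y_gamma (\<kappa> xs) (replicate (length xs) y_one))
     (y_eval_arr C (\<kappa> xs) ?is)"
    by (intro canonical_gamma_inner) (use h in simp_all)
  then have 1: "canonical C xs (y_gamma (\<kappa> xs) (map \<kappa> ?xss)) (\<kappa> xs) (y_eval_arr C (\<kappa> xs) ?is)"
    unfolding cc using y_gamma_one_right[OF kappa_Y_obj[OF h(1)]] by simp
  have 2: "canonical C xs (\<kappa> xs) (y_gamma (\<kappa> xs) (map \<kappa> ?xss)) (\<phi> xs ?xss)"
    using phi_canonical[OF h(1) _ ob] unfolding cc by simp
  have c: "y_eval_arr C (\<kappa> xs) ?is \<cdot> \<phi> xs ?xss = \<i> (kbar C \<kappa> xs)"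
    using canonical_unique[OF canonical_Comp[OF 1 2] canonical_id] h by (simp add: kbar_def)
  have obv: "\<forall>i\<in>set (yvars (\<kappa> xs)). xs ! i \<in> Obj C" using h by auto
  then have obv': "\<forall>i\<in>set (yvars (y_gamma (\<kappa> xs) (map \<kappa> ?xss))). xs ! i \<in> Obj C"
    using canonical_set_yvars[OF 2] by simp
  have "MComp U f (map (MId U) (MSrc U f)) = (xs, h \<cdot> y_eval_arr C (\<kappa> xs) ?is \<cdot> \<phi> xs ?xss)"
    by (simp add: f MComp_underlying MId_underlying MSrc_underlying comp_def cc del: map_map)
     (simp add: comp_def cc MId_underlying)
  also have "h \<cdot> y_eval_arr C (\<kappa> xs) ?is \<cdot> \<phi> xs ?xss = h \<cdot> (y_eval_arr C (\<kappa> xs) ?is \<cdot> \<phi> xs ?xss)"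
    using h canonical_typed[OF 1 obv'] canonical_typed[OF 2 obv] by (intro assoc) (simp_all add: kbar_def)
  also have "\<dots> = h" unfolding c using h by simp
  finally show ?thesis by (simp add: f)
qed

lemma underlying_MAct_id: "f \<in> MArr U \<Longrightarrow> MAct U id f = f"
  by (simp add: MAct_underlying y_act_id y_can_refl MArr_underlying kbar_def)

lemma underlying_MAct_MAct:
  assumes "f \<in> mhom U xs y" "\<sigma> permutes {..<length xs}" "\<rho> permutes {..<length xs}"
  shows "MAct U \<rho> (MAct U \<sigma> f) = MAct U (\<sigma> \<circ> \<rho>) f"
proof -
  obtain h where f: "f = (xs, h)" "set xs \<subseteq> Obj C" "h \<in> Arr C" "Dom C h = kbar C \<kappa> xs"
    using assms(1) by (cases f) (auto simp: mhom_underlying)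
  let ?s = "permute_list \<sigma> xs"
  have s: "set ?s \<subseteq> Obj C" "\<rho> permutes {..<length ?s}" using assms f by simp_all
  let ?a = "y_can C (\<kappa> ?s) (y_act (\<kappa> xs) \<sigma>) ?s"
    and ?b = "\<theta> ?s \<rho>"
  have c: "permute_list (\<sigma> \<circ> \<rho>) xs = permute_list \<rho> ?s" by (rule permute_list_compose[OF assms(3)])
  have "canonical C (permute_list \<rho> ?s) (y_act (\<kappa> ?s) \<rho>) (y_act (y_act (\<kappa> xs) \<sigma>) \<rho>) ?a"
    by (rule canonical_act[OF act_canonical[OF f(2) assms(2)] s(2)]) (use s kappa_vars[OF s(1)] in simp)
  from canonical_Comp[OF this act_canonical[OF s]]
  have "canonical C (permute_list \<rho> ?s) (\<kappa> (permute_list \<rho> ?s)) (y_act (\<kappa> xs) (\<sigma> \<circ> \<rho>)) (?a \<cdot> ?b)"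
    by (simp only: y_act_y_act[OF assms(2,3)])
  from canonical_unique[OF this act_canonical[OF f(2) permutes_compose[OF assms(3,2)], unfolded c]]
  have "?a \<cdot> ?b = y_can C (\<kappa> (permute_list \<rho> ?s)) (y_act (\<kappa> xs) (\<sigma> \<circ> \<rho>)) (permute_list \<rho> ?s)"
    using s kappa_Y_obj[of "permute_list \<rho> ?s"] by simp
  then show ?thesis
    using f act_typed[OF f(2) assms(2)] act_typed[OF s] by (simp add: MAct_underlying c assoc)
qed

end

lemma set_subset_if_nth: "(\<And>i. i < length xs \<Longrightarrow> xs ! i \<in> A) \<Longrightarrow> set xs \<subseteq> A"
  by (auto simp: in_set_conv_nth)

context smc_with_word_choice
begin

lemma mcomposable_flatten:
  assumes "mcomposable U h gs" "list_all2 (mcomposable U) gs fss"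
  shows "mcomposable U (MComp U h gs) (concat fss)" "mcomposable U h (map2 (MComp U) gs fss)"
proof -
  have "set (concat fss) \<subseteq> MArr U \<and> map (MTgt U) (concat fss) = concat (map (MSrc U) gs)"
    using assms(2) by (induction rule: list_all2_induct) (simp_all add: mcomposable_def)
  then show "mcomposable U (MComp U h gs) (concat fss)"
    using underlying_MComp_mhom[OF assms(1)] by (simp add: mcomposable_def mhom_def)
  have "set (map2 (MComp U) gs fss) \<subseteq> MArr U \<and> map (MTgt U) (map2 (MComp U) gs fss) = map (MTgt U) gs"
    using assms(2)
  proof (induction rule: list_all2_induct)
    case (Cons g gs fs fss)
    then show ?case using underlying_MComp_mhom[OF Cons(1)] by (simp add: mhom_def)
  qed simp
  then show "mcomposable U h (map2 (MComp U) gs fss)"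
    using assms(1) by (simp add: mcomposable_def)
qed

lemma map_Dom_Obj: "set hs \<subseteq> Arr C \<Longrightarrow> set (map (Dom C) hs) \<subseteq> Obj C"
  by auto

text \<open>
  Both sides are \<open>h\<close>, the outer word evaluated at \<open>gs\<close>, the composite word evaluated at \<open>fss\<close>, and a
  canonical map. On the left one \<open>\<phi>\<close> stands between \<open>gs\<close> and \<open>fss\<close> and is moved to the source by
  naturality; on the right the words evaluated at tuples of composites are split by functoriality.
  The remaining canonical maps have the same target by associativity of operad composition.
\<close>

lemma underlying_MComp_assoc:
  assumes hg: "mcomposable U h gs" and gf: "list_all2 (mcomposable U) gs fss"
  shows "MComp U (MComp U h gs) (concat fss) = MComp U h (map2 (MComp U) gs fss)"
proof -
  let ?zs = "fst h" and ?yss = "map fst gs" and ?xsss = "map (map fst) fss" and ?F = "map snd (concat fss)"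
  let ?Gs = "map2 (\<lambda>g fs. y_eval_arr C (\<kappa> (fst g)) (map snd fs)) gs fss"
  let ?Ps = "map2 (\<lambda>g fs. \<phi> (fst g) (map fst fs)) gs fss"
  note A = hg[unfolded mcomposable_underlying]
  note T1 = composite_typed[OF hg] and T2 = composite_typed[OF mcomposable_flatten(1)[OF hg gf]]
    and T3 = composite_typed[OF mcomposable_flatten(2)[OF hg gf]]
  note B = mcomposable_flatten(1)[OF hg gf, unfolded mcomposable_underlying]
  have len: "length fss = length gs" "length gs = length ?zs" using list_all2_lengthD[OF gf] T1(1) by simp_all
  have gfi: "mcomposable U (gs ! i) (fss ! i)" if "i < length gs" for i
    using gf that by (simp add: list_all2_conv_all_nth)
  note gfa = gfi[unfolded mcomposable_underlying]
  have src: "fst (MComp U h gs) = concat ?yss" by (simp add: MComp_underlying)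
  have mf: "map fst (concat fss) = concat ?xsss" by (simp add: map_concat)
  have m3: "map fst (map2 (MComp U) gs fss) = map concat ?xsss"
    using len by (intro nth_equalityI) (simp_all add: MComp_underlying)
  have yss: "\<forall>ys\<in>set ?yss. set ys \<subseteq> Obj C" using A by blast
  have ccyss: "set (concat ?yss) \<subseteq> Obj C" using concat_Obj[OF yss] .
  have xsss: "\<forall>xs\<in>set (concat ?xsss). set xs \<subseteq> Obj C" using B unfolding mf by blast
  have xsss': "\<forall>xs\<in>set (map concat ?xsss). set xs \<subseteq> Obj C" using xsss by auto
  have F: "set ?F \<subseteq> Arr C" "map (Dom C) ?F = map (kbar C \<kappa>) (concat ?xsss)" "map (Cod C) ?F = concat ?yss"
    using B unfolding mf src by blast+
  have lF: "length ?F = length (concat ?yss)" using F(3) by (metis length_map)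
  let ?\<gamma> = "y_gamma (\<kappa> ?zs) (map \<kappa> ?yss)"
  have \<gamma>: "?\<gamma> \<in> Y_obj (length (concat ?yss))" by (rule gamma_kappa_Y_obj) (use A len yss in simp_all)
  have \<kappa>y: "\<kappa> (concat ?yss) \<in> Y_obj (length (concat ?yss))" by (rule kappa_Y_obj[OF ccyss])
  let ?q = "y_can C (\<kappa> (concat ?yss)) ?\<gamma> (map (Dom C) ?F)"
  have DF: "set (map (Dom C) ?F) \<subseteq> Obj C" by (rule map_Dom_Obj[OF F(1)])
  have lF': "length (map (Dom C) ?F) = length (concat ?yss)" using lF by simp
  have qc: "canonical C (map (Dom C) ?F) (\<kappa> (concat ?yss)) ?\<gamma> ?q"
    by (rule canonical_y_can[OF _ _ DF]; unfold lF'; fact)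
  have q: "?q \<in> Arr C" "Dom C ?q = y_eval C (\<kappa> (concat ?yss)) (map (Dom C) ?F)" "Cod C ?q = y_eval C ?\<gamma> (map (Dom C) ?F)"
    by (rule y_can_typed[OF _ _ DF]; unfold lF'; fact)+
  \<comment> \<open>naturality moves \<open>\<phi> ?zs ?yss\<close> from the targets of the inner arrows to their sources\<close>
  have nat: "y_eval_arr C ?\<gamma> ?F \<cdot> ?q = \<phi> ?zs ?yss \<cdot> y_eval_arr C (\<kappa> (concat ?yss)) ?F"
    using y_can_natural[of "\<kappa> (concat ?yss)" ?F ?\<gamma>, unfolded lF F(3)] \<gamma> \<kappa>y F(1) by blast
  have lens: "length (fss ! i) = length (fst (gs ! i))" if "i < length gs" for i
    by (rule composite_typed(1)[OF gfi[OF that]])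
  have ft: "fits (map (map snd) fss) (map \<kappa> ?yss)"
    using len lens gfa by (simp add: list_all2_conv_all_nth)
  have EG: "y_eval_arr C ?\<gamma> ?F = y_eval_arr C (\<kappa> ?zs) ?Gs"
  proof -
    have "map2 (\<lambda>hs v. y_eval_arr C v hs) (map (map snd) fss) (map \<kappa> ?yss) = ?Gs"
      using len by (intro nth_equalityI) simp_all
    moreover have "concat (map (map snd) fss) = ?F" by (simp add: map_concat)
    moreover have "vars_below (\<kappa> ?zs) (length (map \<kappa> ?yss))" using A len by simp
    ultimately show ?thesis using y_eval_arr_gamma[OF ft, of "\<kappa> ?zs" C] by (simp only:)
  qed
  have ty: "?Gs ! i \<in> Arr C" "Cod C (?Gs ! i) = kbar C \<kappa> (fst (gs ! i))" "?Ps ! i \<in> Arr C"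
     "Dom C (?Gs ! i) = Cod C (?Ps ! i)" "snd (gs ! i) \<in> Arr C" "Dom C (snd (gs ! i)) = kbar C \<kappa> (fst (gs ! i))"
    if "i < length gs" for i
    using composite_typed[OF gfi[OF that]] gfa[OF that] that len by simp_all
  have m3s: "map snd (map2 (MComp U) gs fss) = map2 (Comp C) (map2 (Comp C) (map snd gs) ?Gs) ?Ps"
    using len by (intro nth_equalityI) (simp_all add: MComp_underlying)
  have arrs: "set ?Gs \<subseteq> Arr C" "set ?Ps \<subseteq> Arr C" "set (map snd gs) \<subseteq> Arr C"
    "set (map2 (Comp C) (map snd gs) ?Gs) \<subseteq> Arr C"
    by (rule set_subset_if_nth, use ty len in simp)+
  have lz: "length ?Gs = length ?zs" "length ?Ps = length ?zs" "length (map snd gs) = length ?zs" using len by simp_all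
  have dm: "map (Dom C) (map snd gs) = map (Cod C) ?Gs"
    "map (Dom C) (map2 (Comp C) (map snd gs) ?Gs) = map (Cod C) ?Ps"
    "map (Dom C) ?Gs = map (Cod C) ?Ps"
    by (rule nth_equalityI, use len in simp, use ty len in simp)+
  have vz: "vars_below (\<kappa> ?zs) (length ?zs)" using A by simp
  have E3: "y_eval_arr C (\<kappa> ?zs) (map snd (map2 (MComp U) gs fss))
    = (y_eval_arr C (\<kappa> ?zs) (map snd gs) \<cdot> y_eval_arr C (\<kappa> ?zs) ?Gs) \<cdot> y_eval_arr C (\<kappa> ?zs) ?Ps"
    unfolding m3s
    by (subst y_eval_arr_Comp[OF _ arrs(2,4) dm(2)], (use vz lz in simp),
        subst y_eval_arr_Comp[OF _ arrs(1,3) dm(1)], (use vz lz in simp), rule refl)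
  let ?\<phi>2 = "\<phi> (concat ?yss) (concat ?xsss)" and ?\<phi>3 = "\<phi> ?zs (map concat ?xsss)"
  let ?X = "concat (concat ?xsss)"
  have XX: "concat (map concat ?xsss) = ?X" by (induction fss) simp_all
  have lx: "length (concat ?xsss) = length (concat ?yss)" using arg_cong[OF F(2), of length] lF by (simp del: length_concat)
  have \<phi>2: "canonical C ?X (\<kappa> ?X) (y_gamma (\<kappa> (concat ?yss)) (map \<kappa> (concat ?xsss))) ?\<phi>2"
    by (rule phi_canonical[OF ccyss lx xsss])
  have fx: "fits (concat ?xsss) (map \<kappa> (concat ?xsss))" by (rule fits_kappa[OF xsss])
  have lhs: "canonical C ?X (\<kappa> ?X) (y_gamma ?\<gamma> (map \<kappa> (concat ?xsss))) (?q \<cdot> ?\<phi>2)"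
  proof (rule canonical_Comp[OF canonical_gamma[OF _ fx] \<phi>2])
    show "canonical C (map2 (\<lambda>xs w. y_eval C w xs) (concat ?xsss) (map \<kappa> (concat ?xsss))) (\<kappa> (concat ?yss)) ?\<gamma> ?q"
      using qc unfolding map2_eval_kappa F(2) .
    show "vars_below (\<kappa> (concat ?yss)) (length (map \<kappa> (concat ?xsss)))"
      unfolding kappa_vars[OF ccyss] length_map[of \<kappa>] lx by simp
  qed
  have \<phi>3: "canonical C ?X (\<kappa> ?X) (y_gamma (\<kappa> ?zs) (map \<kappa> (map concat ?xsss))) ?\<phi>3"
  proof -
    have "length (map concat ?xsss) = length ?zs" using len by simp
    with A have "canonical C (concat (map concat ?xsss)) (\<kappa> (concat (map concat ?xsss)))
      (y_gamma (\<kappa> ?zs) (map \<kappa> (map concat ?xsss))) ?\<phi>3"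
      by (intro phi_canonical[OF _ _ xsss']) simp_all
    then show ?thesis by (simp only: XX)
  qed
  let ?vs = "map2 y_gamma (map \<kappa> ?yss) (map (map \<kappa>) ?xsss)"
  have Pc: "canonical C (map concat ?xsss ! i) (map \<kappa> (map concat ?xsss) ! i) (?vs ! i) (?Ps ! i)" if "i < length gs" for i
  proof -
    have "canonical C (concat (map fst (fss ! i))) (\<kappa> (concat (map fst (fss ! i))))
      (y_gamma (\<kappa> (fst (gs ! i))) (map \<kappa> (map fst (fss ! i)))) (\<phi> (fst (gs ! i)) (map fst (fss ! i)))"
      by (rule phi_canonical) (use gfa[OF that] lens[OF that] in simp_all)
    then show ?thesis using that len by simp
  qed
  have Pf: "fits (map concat ?xsss) (map \<kappa> (map concat ?xsss))" by (rule fits_kappa[OF xsss'])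
  have Pf': "fits (map concat ?xsss) ?vs"
    unfolding list_all2_conv_all_nth
  proof (intro conjI allI impI)
    show "length (map concat ?xsss) = length ?vs" using len by simp
    fix i assume "i < length (map concat ?xsss)"
    then have i: "i < length gs" using len by simp
    show "?vs ! i \<in> Y_obj (length (map concat ?xsss ! i))"
      using gamma_kappa_Y_obj[of "fst (gs ! i)" "map fst (fss ! i)"] gfa[OF i] lens[OF i] i len by simp
  qed
  have EP: "canonical C ?X (y_gamma (\<kappa> ?zs) (map \<kappa> (map concat ?xsss))) (y_gamma (\<kappa> ?zs) ?vs) (y_eval_arr C (\<kappa> ?zs) ?Ps)"
    using canonical_gamma_inner[OF Pf Pf', of "\<kappa> ?zs" C ?Ps, unfolded XX] Pc vz len by (simp only: length_map)
  \<comment> \<open>the targets of the two canonical maps are the same word\<close>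
  have as: "y_gamma ?\<gamma> (map \<kappa> (concat ?xsss)) = y_gamma (\<kappa> ?zs) ?vs"
  proof -
    have "y_gamma ?\<gamma> (concat (map (map \<kappa>) ?xsss)) = y_gamma (\<kappa> ?zs) ?vs"
    proof (rule y_gamma_assoc)
      show "\<kappa> ?zs \<in> Y_obj (length (map \<kappa> ?yss))" using A len by simp
      show "list_all2 (\<lambda>v us. v \<in> Y_obj (length us)) (map \<kappa> ?yss) (map (map \<kappa>) ?xsss)"
        using len lens gfa by (simp add: list_all2_conv_all_nth)
      show "list_all2 (list_all2 (\<lambda>j u. u \<in> Y_obj j)) (map (map length) ?xsss) (map (map \<kappa>) ?xsss)"
        using gfa len by (simp add: list_all2_conv_all_nth)
    qed
    then show ?thesis by (simp only: map_concat)
  qed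
  have cX: "set ?X \<subseteq> Obj C" by (rule concat_Obj[OF xsss])
  have key: "?q \<cdot> ?\<phi>2 = y_eval_arr C (\<kappa> ?zs) ?Ps \<cdot> ?\<phi>3"
    by (rule canonical_unique[OF lhs[unfolded as] canonical_Comp[OF EP \<phi>3] kappa_Y_obj[OF cX] cX])
  let ?h = "snd h" and ?E1 = "y_eval_arr C (\<kappa> ?zs) (map snd gs)" and ?EG = "y_eval_arr C (\<kappa> ?zs) ?Gs"
    and ?EP = "y_eval_arr C (\<kappa> ?zs) ?Ps" and ?E2 = "y_eval_arr C (\<kappa> (concat ?yss)) ?F"
  note t1 = T1 and t2 = T2[unfolded src mf] and t3 = T3[unfolded m3]
  have v: "vars_below (\<kappa> ?zs) (length ?Gs)" "vars_below (\<kappa> ?zs) (length ?Ps)"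
    "vars_below (\<kappa> ?zs) (length (map snd gs))"
    using vz unfolding lz by simp_all
  note EGt = y_eval_arr_typed[OF v(1) arrs(1), unfolded dm(3) dm(1)[symmetric]]
    and EPt = y_eval_arr_typed[OF v(2) arrs(2)] and E1t' = y_eval_arr_typed[OF v(3) arrs(3)]
  have E1t: "Dom C ?E1 = Cod C ?EG" "?E1 \<in> Arr C"
    by (simp_all only: EGt E1t')
  have Dq: "Cod C ?q = Dom C ?EG" "Dom C ?q = Cod C ?\<phi>2"
    using q(2,3) y_eval_arr_typed(2)[of ?\<gamma> ?F] EG F \<gamma> lF t2(7) by (simp_all only: Y_obj_vars order_refl)
  have DP: "Dom C ?EP = Cod C ?\<phi>3"
    using y_eval_arr_typed(2)[OF _ _, of "\<kappa> ?zs"] t3(3,7) E3 EPt E1t EGt by simp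
  have "?h \<cdot> ?E1 \<cdot> \<phi> ?zs ?yss \<cdot> ?E2 \<cdot> ?\<phi>2 = ?h \<cdot> (?E1 \<cdot> ((\<phi> ?zs ?yss \<cdot> ?E2) \<cdot> ?\<phi>2))"
    using t1 t2 A by (simp add: assoc kbar_def)
  also have "\<dots> = ?h \<cdot> (?E1 \<cdot> (?EG \<cdot> (?q \<cdot> ?\<phi>2)))"
    unfolding nat[symmetric] EG using t2 EGt q Dq by (simp add: assoc)
  also have "\<dots> = ?h \<cdot> ((?E1 \<cdot> ?EG) \<cdot> ?EP) \<cdot> ?\<phi>3"
    unfolding key using A t1 t3 EGt EPt E1t DP by (simp add: assoc kbar_def)
  finally show ?thesis
    using XX by (simp only: MComp_underlying[of "MComp U h gs"] MComp_underlying[of h "map2 (MComp U) gs fss"] src mf m3 E3)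
      (simp only: MComp_underlying fst_conv snd_conv)
qed

text \<open>
  Here \<open>\<theta>\<close> stands in front of the permuted inner arrows. After it has been moved past them, evaluating
  \<open>\<kappa> ys \<cdot> \<sigma>\<close> at the permuted arrows is the same as evaluating \<open>\<kappa> ys\<close> at the arrows, and both
  canonical maps end in the word \<open>\<gamma>(\<kappa> ys; \<kappa> xss) \<cdot> block_perm \<sigma> js\<close>.
\<close>

lemma underlying_MAct_outer:
  assumes gf: "mcomposable U g fs" and \<sigma>: "\<sigma> permutes {..<length fs}"
  shows "MComp U (MAct U \<sigma> g) (permute_list \<sigma> fs)
    = MAct U (block_perm \<sigma> (map (\<lambda>f. length (MSrc U f)) fs)) (MComp U g fs)"
proof -
  let ?ys = "fst g" and ?xss = "map fst fs" and ?hs = "map snd fs"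
  let ?sys = "permute_list \<sigma> (fst g)" and ?sxss = "permute_list \<sigma> (map fst fs)" and ?shs = "permute_list \<sigma> (map snd fs)"
  note A = gf[unfolded mcomposable_underlying] and T = composite_typed[OF gf]
  have \<sigma>': "\<sigma> permutes {..<length ?ys}" "\<sigma> permutes {..<length ?xss}" "\<sigma> permutes {..<length ?hs}"
    using \<sigma> T(1) by simp_all
  have ys: "set ?ys \<subseteq> Obj C" "set ?sys \<subseteq> Obj C" using A \<sigma>' by simp_all
  have xss: "\<forall>xs\<in>set ?xss. set xs \<subseteq> Obj C" "\<forall>xs\<in>set ?sxss. set xs \<subseteq> Obj C" using A \<sigma>' by simp_all
  have hs: "set ?hs \<subseteq> Arr C" "set ?shs \<subseteq> Arr C" using A \<sigma>' by simp_all
  have len: "length ?xss = length ?ys" "length ?sxss = length ?sys" "length ?shs = length ?sys" "length ?sys = length ?ys"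
    using T(1) by simp_all
  have Dh: "map (Dom C) ?shs = map (kbar C \<kappa>) ?sxss" "map (Cod C) ?shs = ?sys"
    using A \<sigma>' by (metis permute_list_map length_map)+
  have fst_eq: "map fst (permute_list \<sigma> fs) = ?sxss" "map snd (permute_list \<sigma> fs) = ?shs"
    using \<sigma> by (simp_all add: permute_list_map)
  let ?js = "map (\<lambda>f. length (MSrc U f)) fs"
  let ?\<beta> = "block_perm \<sigma> ?js"
  have js: "?js = map length ?xss" by (simp add: MSrc_underlying)
  have \<beta>: "?\<beta> permutes {..<length (concat ?xss)}" "permute_list ?\<beta> (concat ?xss) = concat ?sxss"
    using block_perm_permutes[of \<sigma> ?js] permute_list_block_perm[OF \<sigma>'(2)] \<sigma> unfolding js by (simp_all add: length_concat)
  have cx: "set (concat ?xss) \<subseteq> Obj C" "set (concat ?sxss) \<subseteq> Obj C" using concat_Obj xss by blast+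
  let ?a = "y_can C (\<kappa> ?sys) (y_act (\<kappa> ?ys) \<sigma>) ?sys"
  let ?q = "y_can C (\<kappa> ?sys) (y_act (\<kappa> ?ys) \<sigma>) (map (Dom C) ?shs)"
  let ?b = "y_can C (\<kappa> (concat ?sxss)) (y_act (\<kappa> (concat ?xss)) ?\<beta>) (concat ?sxss)"
  have k: "\<kappa> ?sys \<in> Y_obj (length ?shs)" "y_act (\<kappa> ?ys) \<sigma> \<in> Y_obj (length ?shs)"
    using kappa_Y_obj[OF ys(2)] y_act_Y_obj[OF kappa_Y_obj[OF ys(1)] \<sigma>'(1)] unfolding len by simp_all
  have nat: "y_eval_arr C (\<kappa> ?ys) ?hs \<cdot> ?q = ?a \<cdot> y_eval_arr C (\<kappa> ?sys) ?shs"
  proof -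
    have "y_eval_arr C (y_act (\<kappa> ?ys) \<sigma>) ?shs = y_eval_arr C (\<kappa> ?ys) ?hs"
      by (rule y_eval_arr_act[OF \<sigma>'(3)]) (use kappa_vars[OF ys(1)] T(1) in simp)
    then show ?thesis using y_can_natural[OF k hs(2)] by (simp only: Dh(2))
  qed
  have lD: "length (map (Dom C) ?shs) = length ?shs" by simp
  have DO: "set (map (Dom C) ?shs) \<subseteq> Obj C" by (rule map_Dom_Obj[OF hs(2)])
  have qc: "canonical C (map (Dom C) ?shs) (\<kappa> ?sys) (y_act (\<kappa> ?ys) \<sigma>) ?q"
    by (rule canonical_y_can[OF _ _ DO]; unfold lD; rule k)
  have qt: "?q \<in> Arr C" "Dom C ?q = y_eval C (\<kappa> ?sys) (map (Dom C) ?shs)"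
     "Cod C ?q = y_eval C (y_act (\<kappa> ?ys) \<sigma>) (map (Dom C) ?shs)"
    by (rule y_can_typed[OF _ _ DO]; unfold lD; rule k)+
  have fit: "fits ?sxss (map \<kappa> ?sxss)" by (rule fits_kappa[OF xss(2)])
  have 1: "canonical C (concat ?sxss) (y_gamma (\<kappa> ?sys) (map \<kappa> ?sxss)) (y_gamma (y_act (\<kappa> ?ys) \<sigma>) (map \<kappa> ?sxss)) ?q"
  proof (rule canonical_gamma[OF _ fit])
    show "canonical C (map2 (\<lambda>xs w. y_eval C w xs) ?sxss (map \<kappa> ?sxss)) (\<kappa> ?sys) (y_act (\<kappa> ?ys) \<sigma>) ?q"
      using qc unfolding map2_eval_kappa Dh(1) .
    show "vars_below (\<kappa> ?sys) (length (map \<kappa> ?sxss))"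
      using kappa_vars[OF ys(2)] len by simp
  qed
  have 2: "canonical C (concat ?sxss) (\<kappa> (concat ?sxss)) (y_gamma (\<kappa> ?sys) (map \<kappa> ?sxss)) (\<phi> ?sys ?sxss)"
    by (rule phi_canonical[OF ys(2) len(2) xss(2)])
  have 3: "canonical C (concat ?sxss) (y_act (\<kappa> (concat ?xss)) ?\<beta>) (y_act (y_gamma (\<kappa> ?ys) (map \<kappa> ?xss)) ?\<beta>) (\<phi> ?ys ?xss)"
    using canonical_act[OF phi_canonical[OF ys(1) len(1) xss(1)] \<beta>(1)] kappa_vars[OF cx(1)] unfolding \<beta>(2) by blast
  have 4: "canonical C (concat ?sxss) (\<kappa> (concat ?sxss)) (y_act (\<kappa> (concat ?xss)) ?\<beta>) ?b"
    using act_canonical[OF cx(1) \<beta>(1)] unfolding \<beta>(2) .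
  have w: "y_gamma (y_act (\<kappa> ?ys) \<sigma>) (map \<kappa> ?sxss) = y_act (y_gamma (\<kappa> ?ys) (map \<kappa> ?xss)) ?\<beta>"
  proof -
    have "y_gamma (y_act (\<kappa> ?ys) \<sigma>) (permute_list \<sigma> (map \<kappa> ?xss)) = y_act (y_gamma (\<kappa> ?ys) (map \<kappa> ?xss)) (block_perm \<sigma> ?js)"
    proof (rule y_gamma_act_outer)
      show "\<kappa> ?ys \<in> Y_obj (length (map \<kappa> ?xss))" using kappa_Y_obj[OF ys(1)] len by simp
      show "list_all2 (\<lambda>j v. v \<in> Y_obj j) ?js (map \<kappa> ?xss)"
        unfolding js using fits_kappa[OF xss(1)] by (simp add: list_all2_map1)
    qed (use \<sigma> in simp)
    then show ?thesis using \<sigma>'(2) by (simp add: permute_list_map del: map_map)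
  qed
  have key: "?q \<cdot> \<phi> ?sys ?sxss = \<phi> ?ys ?xss \<cdot> ?b"
    by (rule canonical_unique[OF canonical_Comp[OF 1 2, unfolded w] canonical_Comp[OF 3 4] kappa_Y_obj[OF cx(2)] cx(2)])
  note ta = act_typed[OF ys(1) \<sigma>'(1)] and tb = act_typed[OF cx(1) \<beta>(1), unfolded \<beta>(2)]
  have vs: "vars_below (\<kappa> ?sys) (length ?shs)" using kappa_vars[OF ys(2)] len by simp
  note te = y_eval_arr_typed[OF vs hs(2)]
  note tp = phi_typed[OF ys(2) len(2) xss(2)]
  have DqE: "Cod C ?q = Dom C (y_eval_arr C (\<kappa> ?ys) ?hs)"
  proof -
    have "map (Dom C) ?shs = permute_list \<sigma> (map (Dom C) ?hs)" using \<sigma>' by (metis permute_list_map)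
    then have "y_eval C (y_act (\<kappa> ?ys) \<sigma>) (map (Dom C) ?shs) = y_eval C (\<kappa> ?ys) (map (Dom C) ?hs)"
      using y_eval_act[of \<sigma> "map (Dom C) ?hs" "\<kappa> ?ys" C] \<sigma>' kappa_vars[OF ys(1)] T(1) by simp
    then show ?thesis using qt(3) T(3) A by metis
  qed
  have "snd g \<cdot> ?a \<cdot> y_eval_arr C (\<kappa> ?sys) ?shs \<cdot> \<phi> ?sys ?sxss
    = snd g \<cdot> ((?a \<cdot> y_eval_arr C (\<kappa> ?sys) ?shs) \<cdot> \<phi> ?sys ?sxss)"
    using A ta te tp Dh by (simp add: assoc kbar_def del: map_map)
  also have "\<dots> = snd g \<cdot> (y_eval_arr C (\<kappa> ?ys) ?hs \<cdot> (?q \<cdot> \<phi> ?sys ?sxss))"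
    unfolding nat[symmetric] using A T qt tp Dh DqE by (simp add: assoc kbar_def del: map_map)
  also have "\<dots> = snd g \<cdot> y_eval_arr C (\<kappa> ?ys) ?hs \<cdot> \<phi> ?ys ?xss \<cdot> ?b"
    unfolding key using A T tb by (simp add: assoc kbar_def del: map_map)
  finally show ?thesis
    by (simp only: MComp_underlying MAct_underlying fst_conv snd_conv fst_eq \<beta>(2))
qed

text \<open>
  The maps \<open>\<theta>\<close> of the inner arrows already stand at the source; functoriality of the outer word
  separates them from the arrows.
\<close>

lemma underlying_MAct_inner:
  assumes gf: "mcomposable U g fs" and \<rho>s: "list_all2 (\<lambda>\<rho> f. \<rho> permutes {..<length (MSrc U f)}) \<rho>s fs"
  shows "MComp U g (map2 (MAct U) \<rho>s fs)
    = MAct U (sum_perm \<rho>s (map (\<lambda>f. length (MSrc U f)) fs)) (MComp U g fs)"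
proof -
  let ?ys = "fst g" and ?xss = "map fst fs" and ?hs = "map snd fs"
  let ?sxss = "map2 permute_list \<rho>s (map fst fs)"
  let ?as = "map2 (\<lambda>\<rho> xs. \<theta> xs \<rho>) \<rho>s (map fst fs)"
  note A = gf[unfolded mcomposable_underlying] and T = composite_typed[OF gf]
  have lr: "length \<rho>s = length fs" using list_all2_lengthD[OF \<rho>s] .
  have \<rho>: "\<rho>s ! i permutes {..<length (?xss ! i)}" if "i < length fs" for i
    using \<rho>s that by (simp add: list_all2_conv_all_nth MSrc_underlying)
  have ys: "set ?ys \<subseteq> Obj C" using A by blast
  have xss: "\<forall>xs\<in>set ?xss. set xs \<subseteq> Obj C" using A by blast
  have xi: "set (?xss ! i) \<subseteq> Obj C" if "i < length fs" for i using xss that by simp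
  have sxss: "\<forall>xs\<in>set ?sxss. set xs \<subseteq> Obj C"
  proof
    fix xs assume "xs \<in> set ?sxss"
    then obtain i where i: "i < length fs" "xs = permute_list (\<rho>s ! i) (?xss ! i)"
      using lr by (auto simp: in_set_conv_nth)
    then show "set xs \<subseteq> Obj C" using xi[OF i(1)] \<rho>[OF i(1)] by simp
  qed
  have len: "length ?xss = length ?ys" "length ?sxss = length ?ys" "length ?as = length fs" using T(1) lr by simp_all
  have fst_eq: "map fst (map2 (MAct U) \<rho>s fs) = ?sxss"
    using lr by (intro nth_equalityI) (simp_all add: MAct_underlying)
  have snd_eq: "map snd (map2 (MAct U) \<rho>s fs) = map2 (Comp C) ?hs ?as"
    using lr by (intro nth_equalityI) (simp_all add: MAct_underlying)
  let ?js = "map (\<lambda>f. length (MSrc U f)) fs"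
  let ?\<beta> = "sum_perm \<rho>s ?js"
  have js: "?js = map length ?xss" by (simp add: MSrc_underlying)
  have r1: "list_all2 (\<lambda>\<rho> xs. \<rho> permutes {..<length xs}) \<rho>s ?xss" and r2: "list_all2 (\<lambda>\<rho> j. \<rho> permutes {..<j}) \<rho>s ?js"
    using \<rho>s by (simp_all add: list_all2_map2 MSrc_underlying)
  have \<beta>: "?\<beta> permutes {..<length (concat ?xss)}" "permute_list ?\<beta> (concat ?xss) = concat ?sxss"
    using sum_perm_permutes[OF r2] permute_list_sum_perm[OF r1] unfolding js by (simp_all add: length_concat)
  have cx: "set (concat ?xss) \<subseteq> Obj C" "set (concat ?sxss) \<subseteq> Obj C" using concat_Obj xss sxss by blast+
  let ?b = "y_can C (\<kappa> (concat ?sxss)) (y_act (\<kappa> (concat ?xss)) ?\<beta>) (concat ?sxss)"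
  have ty: "?as ! i \<in> Arr C" "Cod C (?as ! i) = kbar C \<kappa> (?xss ! i)" "Dom C (?as ! i) = kbar C \<kappa> (?sxss ! i)"
    if "i < length fs" for i
    using act_typed[OF xi[OF that] \<rho>[OF that]] that lr by simp_all
  have arrs: "set ?hs \<subseteq> Arr C" "set ?as \<subseteq> Arr C"
    using A by (blast, intro set_subset_if_nth, use ty len in simp)
  have dm: "map (Dom C) ?hs = map (Cod C) ?as" "map (Dom C) ?as = map (kbar C \<kappa>) ?sxss"
  proof -
    have "map (Dom C) ?hs = map (kbar C \<kappa>) ?xss" using A by blast
    also have "\<dots> = map (Cod C) ?as" by (rule nth_equalityI) (use ty lr in simp_all)
    finally show "map (Dom C) ?hs = map (Cod C) ?as" .
    show "map (Dom C) ?as = map (kbar C \<kappa>) ?sxss" by (rule nth_equalityI) (use ty lr in simp_all)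
  qed
  have v: "vars_below (\<kappa> ?ys) (length ?hs)" "vars_below (\<kappa> ?ys) (length ?as)"
    "vars_below (\<kappa> ?ys) (length ?xss)" "vars_below (\<kappa> ?ys) (length ?sxss)"
    using kappa_vars[OF ys] len T(1) by simp_all
  have E: "y_eval_arr C (\<kappa> ?ys) (map snd (map2 (MAct U) \<rho>s fs)) = y_eval_arr C (\<kappa> ?ys) ?hs \<cdot> y_eval_arr C (\<kappa> ?ys) ?as"
    unfolding snd_eq by (rule y_eval_arr_Comp[OF v(2) arrs(2,1) dm(1)])
  have fit: "fits ?sxss (map \<kappa> ?sxss)" by (rule fits_kappa[OF sxss])
  have fit': "fits ?sxss (map2 y_act (map \<kappa> ?xss) \<rho>s)"
    unfolding list_all2_conv_all_nth
  proof (intro conjI allI impI)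
    fix i assume "i < length ?sxss"
    then have i: "i < length fs" using len T(1) by simp
    show "map2 y_act (map \<kappa> ?xss) \<rho>s ! i \<in> Y_obj (length (?sxss ! i))"
      using y_act_Y_obj[OF kappa_Y_obj[OF xi[OF i]] \<rho>[OF i]] i lr by simp
  qed (use lr in simp)
  have 1: "canonical C (concat ?sxss) (y_gamma (\<kappa> ?ys) (map \<kappa> ?sxss)) (y_gamma (\<kappa> ?ys) (map2 y_act (map \<kappa> ?xss) \<rho>s))
    (y_eval_arr C (\<kappa> ?ys) ?as)"
  proof (rule canonical_gamma_inner[OF fit fit' v(4)])
    fix i assume "i < length ?sxss"
    then have i: "i < length fs" using len T(1) by simp
    show "canonical C (?sxss ! i) (map \<kappa> ?sxss ! i) (map2 y_act (map \<kappa> ?xss) \<rho>s ! i) (?as ! i)"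
      using act_canonical[OF xi[OF i] \<rho>[OF i]] i lr by simp
  qed
  have 2: "canonical C (concat ?sxss) (\<kappa> (concat ?sxss)) (y_gamma (\<kappa> ?ys) (map \<kappa> ?sxss)) (\<phi> ?ys ?sxss)"
    by (rule phi_canonical[OF ys len(2) sxss])
  have 3: "canonical C (concat ?sxss) (y_act (\<kappa> (concat ?xss)) ?\<beta>) (y_act (y_gamma (\<kappa> ?ys) (map \<kappa> ?xss)) ?\<beta>) (\<phi> ?ys ?xss)"
    using canonical_act[OF phi_canonical[OF ys len(1) xss] \<beta>(1)] kappa_vars[OF cx(1)] unfolding \<beta>(2) by blast
  have 4: "canonical C (concat ?sxss) (\<kappa> (concat ?sxss)) (y_act (\<kappa> (concat ?xss)) ?\<beta>) ?b"
    using act_canonical[OF cx(1) \<beta>(1)] unfolding \<beta>(2) .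
  have w: "y_gamma (\<kappa> ?ys) (map2 y_act (map \<kappa> ?xss) \<rho>s) = y_act (y_gamma (\<kappa> ?ys) (map \<kappa> ?xss)) ?\<beta>"
  proof (rule y_gamma_act_inner[OF _ _ r2])
    show "\<kappa> ?ys \<in> Y_obj (length (map \<kappa> ?xss))" using kappa_Y_obj[OF ys] len by simp
    show "list_all2 (\<lambda>j v. v \<in> Y_obj j) ?js (map \<kappa> ?xss)"
      unfolding js using fits_kappa[OF xss] by (simp add: list_all2_map1)
  qed
  have key: "y_eval_arr C (\<kappa> ?ys) ?as \<cdot> \<phi> ?ys ?sxss = \<phi> ?ys ?xss \<cdot> ?b"
    by (rule canonical_unique[OF canonical_Comp[OF 1 2, unfolded w] canonical_Comp[OF 3 4] kappa_Y_obj[OF cx(2)] cx(2)])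
  note tb = act_typed[OF cx(1) \<beta>(1), unfolded \<beta>(2)]
  note te = y_eval_arr_typed[OF v(2) arrs(2), unfolded dm(2) dm(1)[symmetric]] and te' = y_eval_arr_typed[OF v(1) arrs(1)]
  note tp = phi_typed[OF ys len(2) sxss]
  have "snd g \<cdot> (y_eval_arr C (\<kappa> ?ys) ?hs \<cdot> y_eval_arr C (\<kappa> ?ys) ?as) \<cdot> \<phi> ?ys ?sxss
    = snd g \<cdot> (y_eval_arr C (\<kappa> ?ys) ?hs \<cdot> (y_eval_arr C (\<kappa> ?ys) ?as \<cdot> \<phi> ?ys ?sxss))"
    using A T(4) te te'(1,2) tp by (simp add: assoc kbar_def del: map_map)
  also have "\<dots> = snd g \<cdot> y_eval_arr C (\<kappa> ?ys) ?hs \<cdot> \<phi> ?ys ?xss \<cdot> ?b"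
    unfolding key using A T tb by (simp add: assoc kbar_def del: map_map)
  finally show ?thesis
    by (simp only: MComp_underlying MAct_underlying[of ?\<beta>] fst_conv snd_conv fst_eq E \<beta>(2))
qed

theorem underlying_multicategory: "multicategory U"
proof
  show "set (MSrc U f) \<subseteq> MObj U" "MTgt U f \<in> MObj U" if "f \<in> MArr U" for f
    using that by (simp_all add: underlying_simps)
qed (fact underlying_MId_mhom underlying_MComp_mhom underlying_MAct_mhom underlying_MId_left underlying_MId_right
    underlying_MComp_assoc underlying_MAct_id underlying_MAct_MAct underlying_MAct_outer underlying_MAct_inner)+

end

section \<open>Lax functors and canonical maps\<close>

lemma y_eval_rename:
  "\<forall>j\<in>set (yvars w). zs ! r j = xs ! j \<Longrightarrow> y_eval C (ysubst (\<lambda>j. YVar (r j)) w) zs = y_eval C w xs"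
  by (rule y_eval_ysubst) simp

context lax_symmetric_monoidal_functor
begin

lemma lax_arr_typed [simp]:
  assumes "f \<in> Arr C"
  shows "lax_arr F f \<in> Arr D" "Dom D (lax_arr F f) = lax_ob F (Dom C f)" "Cod D (lax_arr F f) = lax_ob F (Cod C f)"
  using functor_hom[of f "Dom C f" "Cod C f"] assms by (auto simp: hom_def)

declare functor_Obj [simp] functor_Ident [simp]

lemma lax_arr_Comp:
  assumes "f \<in> Arr C" "g \<in> Arr C" "Dom C g = Cod C f"
  shows "lax_arr F (g \<cdot>\<^bsub>C\<^esub> f) = lax_arr F g \<cdot>\<^bsub>D\<^esub> lax_arr F f"
  by (rule functor_Comp[of g "Cod C f" "Cod C g" f "Dom C f"]) (use assms in \<open>auto simp: hom_def\<close>)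

lemma xi_typed [simp]:
  assumes "a \<in> Obj C" "b \<in> Obj C"
  shows "lax_xi F (a, b) \<in> Arr D" "Dom D (lax_xi F (a, b)) = lax_ob F a \<oplus>\<^bsub>D\<^esub> lax_ob F b"
    "Cod D (lax_xi F (a, b)) = lax_ob F (a \<oplus>\<^bsub>C\<^esub> b)"
  using xi_hom[OF assms] by (auto simp: hom_def)

lemma eta_typed [simp]:
  "lax_eta F \<in> Arr D" "Dom D (lax_eta F) = \<e>\<^bsub>D\<^esub>" "Cod D (lax_eta F) = lax_ob F \<e>\<^bsub>C\<^esub>"
  using eta_hom by (auto simp: hom_def)

lemma xi_nat:
  assumes "f \<in> Arr C" "g \<in> Arr C"
  shows "lax_xi F (Cod C f, Cod C g) \<cdot>\<^bsub>D\<^esub> (lax_arr F f \<uplus>\<^bsub>D\<^esub> lax_arr F g)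
    = lax_arr F (f \<uplus>\<^bsub>C\<^esub> g) \<cdot>\<^bsub>D\<^esub> lax_xi F (Dom C f, Dom C g)"
  by (rule xi_natural) (use assms in \<open>auto simp: hom_def\<close>)

text \<open>
  The structure map \<open>w(F xs) \<rightarrow> F(w xs)\<close> for an arbitrary word \<open>w\<close>; for left-nested words it is \<open>\<xi>\<^sub>n\<close>
  (\<open>xi_n_eq_xi_word\<close>).
\<close>

primrec xi_word :: "yword \<Rightarrow> 'o list \<Rightarrow> 'm" where
  "xi_word YE xs = lax_eta F"
| "xi_word (YVar i) xs = \<i>\<^bsub>D\<^esub> (lax_ob F (xs ! i))"
| "xi_word (YSum u v) xs = lax_xi F (y_eval C u xs, y_eval C v xs) \<cdot>\<^bsub>D\<^esub> (xi_word u xs \<uplus>\<^bsub>D\<^esub> xi_word v xs)"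

lemma xi_word_typed [simp]:
  assumes "vars_below w (length xs)" "set xs \<subseteq> Obj C"
  shows "xi_word w xs \<in> Arr D" "Dom D (xi_word w xs) = y_eval D w (map (lax_ob F) xs)"
    "Cod D (xi_word w xs) = lax_ob F (y_eval C w xs)"
proof -
  have "xi_word w xs \<in> Arr D \<and> Dom D (xi_word w xs) = y_eval D w (map (lax_ob F) xs)
      \<and> Cod D (xi_word w xs) = lax_ob F (y_eval C w xs)"
    using assms(1) by (induction w) (use assms(2) in \<open>simp_all add: subset_iff\<close>)
  then show "xi_word w xs \<in> Arr D" "Dom D (xi_word w xs) = y_eval D w (map (lax_ob F) xs)"
    "Cod D (xi_word w xs) = lax_ob F (y_eval C w xs)" by simp_all
qed

lemma xi_word_natural:
  assumes "vars_below w (length hs)" "set hs \<subseteq> Arr C"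
  shows "lax_arr F (y_eval_arr C w hs) \<cdot>\<^bsub>D\<^esub> xi_word w (map (Dom C) hs)
    = xi_word w (map (Cod C) hs) \<cdot>\<^bsub>D\<^esub> y_eval_arr D w (map (lax_arr F) hs)"
  using assms(1)
proof (induction w)
  case (YVar i)
  then show ?case using assms(2) by (simp add: subset_iff)
next
  case (YSum u v)
  have o: "set (map (Dom C) hs) \<subseteq> Obj C" "set (map (Cod C) hs) \<subseteq> Obj C" "set (map (lax_arr F) hs) \<subseteq> Arr D"
    using assms(2) by auto
  have uv: "vars_below u (length hs)" "vars_below v (length hs)" using YSum.prems by auto
  let ?u = "y_eval_arr C u hs" and ?v = "y_eval_arr C v hs"
  have m: "map (Dom D) (map (lax_arr F) hs) = map (lax_ob F) (map (Dom C) hs)"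
     "map (Cod D) (map (lax_arr F) hs) = map (lax_ob F) (map (Cod C) hs)"
    using assms(2) by auto
  have te: "y_eval_arr D w (map (lax_arr F) hs) \<in> Arr D" "Dom D (y_eval_arr D w (map (lax_arr F) hs)) = y_eval D w (map (lax_ob F) (map (Dom C) hs))"
    "Cod D (y_eval_arr D w (map (lax_arr F) hs)) = y_eval D w (map (lax_ob F) (map (Cod C) hs))"
    if "vars_below w (length hs)" for w
    using D.y_eval_arr_typed[OF _ o(3), of w, unfolded m] that by (simp_all del: map_map)
  have tx: "xi_word w (map (Dom C) hs) \<in> Arr D" "Dom D (xi_word w (map (Dom C) hs)) = y_eval D w (map (lax_ob F) (map (Dom C) hs))"
     "Cod D (xi_word w (map (Dom C) hs)) = lax_ob F (y_eval C w (map (Dom C) hs))"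
     "xi_word w (map (Cod C) hs) \<in> Arr D" "Dom D (xi_word w (map (Cod C) hs)) = y_eval D w (map (lax_ob F) (map (Cod C) hs))"
     "Cod D (xi_word w (map (Cod C) hs)) = lax_ob F (y_eval C w (map (Cod C) hs))"
    if "vars_below w (length hs)" for w
    using xi_word_typed[OF _ o(1), of w] xi_word_typed[OF _ o(2), of w] that by simp_all
  have ev: "y_eval C w (map (Dom C) hs) \<in> Obj C" "y_eval C w (map (Cod C) hs) \<in> Obj C"
    if "vars_below w (length hs)" for w
    using C.y_eval_Obj_list[OF _ o(1), of w] C.y_eval_Obj_list[OF _ o(2), of w] that by simp_all
  note t = te[OF uv(1)] te[OF uv(2)] tx[OF uv(1)] tx[OF uv(2)] ev[OF uv(1)] ev[OF uv(2)]
    C.y_eval_arr_typed[OF uv(1) assms(2)] C.y_eval_arr_typed[OF uv(2) assms(2)]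
  have "lax_arr F (y_eval_arr C (YSum u v) hs) \<cdot>\<^bsub>D\<^esub> xi_word (YSum u v) (map (Dom C) hs)
    = (lax_arr F (?u \<uplus>\<^bsub>C\<^esub> ?v) \<cdot>\<^bsub>D\<^esub> lax_xi F (Dom C ?u, Dom C ?v)) \<cdot>\<^bsub>D\<^esub> (xi_word u (map (Dom C) hs) \<uplus>\<^bsub>D\<^esub> xi_word v (map (Dom C) hs))"
    using t by (simp add: D.assoc del: map_map)
  also have "\<dots> = lax_xi F (Cod C ?u, Cod C ?v) \<cdot>\<^bsub>D\<^esub> ((lax_arr F ?u \<cdot>\<^bsub>D\<^esub> xi_word u (map (Dom C) hs)) \<uplus>\<^bsub>D\<^esub> (lax_arr F ?v \<cdot>\<^bsub>D\<^esub> xi_word v (map (Dom C) hs)))"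
    unfolding xi_nat[OF C.y_eval_arr_typed(1)[OF uv(1) assms(2)] C.y_eval_arr_typed(1)[OF uv(2) assms(2)], symmetric] using t by (simp add: D.assoc D.interchange del: map_map)
  also have "\<dots> = xi_word (YSum u v) (map (Cod C) hs) \<cdot>\<^bsub>D\<^esub> y_eval_arr D (YSum u v) (map (lax_arr F) hs)"
    unfolding YSum.IH(1)[OF uv(1)] YSum.IH(2)[OF uv(2)] using t by (simp add: D.assoc D.interchange del: map_map)
  finally show ?case .
qed simp

lemma xi_word_rename:
  "\<forall>j\<in>set (yvars w). zs ! r j = xs ! j \<Longrightarrow> xi_word (ysubst (\<lambda>j. YVar (r j)) w) zs = xi_word w xs"
  by (induction w) (simp_all add: y_eval_rename[of _ zs r xs C] ball_Un)

lemma xi_word_act: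
  assumes "\<sigma> permutes {..<length xs}" "vars_below w (length xs)"
  shows "xi_word (y_act w \<sigma>) (permute_list \<sigma> xs) = xi_word w xs"
  unfolding y_act_def
proof (rule xi_word_rename, intro ballI)
  fix i assume "i \<in> set (yvars w)"
  then have i: "i < length xs" using assms(2) by auto
  have "inv \<sigma> i < length xs"
    using permutes_in_image[OF permutes_inv[OF assms(1)], of i] i by simp
  then show "permute_list \<sigma> xs ! inv \<sigma> i = xs ! i"
    by (simp add: permute_list_nth[OF assms(1)] permutes_inverses[OF assms(1)])
qed

lemma xi_word_gamma:
  assumes fit: "fits xss ws" and w: "vars_below w (length ws)" and xss: "\<forall>xs\<in>set xss. set xs \<subseteq> Obj C"
  shows "xi_word (y_gamma w ws) (concat xss)
    = xi_word w (map2 (\<lambda>xs v. y_eval C v xs) xss ws) \<cdot>\<^bsub>D\<^esub> y_eval_arr D w (map2 (\<lambda>xs v. xi_word v xs) xss ws)"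
  using w
proof (induction w)
  case YE
  then show ?case by (simp add: y_gamma_def)
next
  case (YVar i)
  have len: "length xss = length ws" using list_all2_lengthD[OF fit] .
  have i: "i < length ws" "i < length xss" using YVar len by auto
  have v: "ws ! i \<in> Y_obj (length (xss ! i))" using fit i by (simp add: list_all2_conv_all_nth)
  have xi: "set (xss ! i) \<subseteq> Obj C" using xss i by simp
  have "map y_arity ws = map length xss"
    using fit by (auto simp: list_all2_conv_all_nth Y_obj_arity intro!: nth_equalityI)
  then have o: "map y_arity (take i ws) = map length (take i xss)" by (metis take_map)
  have "xi_word (y_gamma (YVar i) ws) (concat xss) = xi_word (ws ! i) (xss ! i)"
    unfolding y_gamma_YVar o
    by (rule xi_word_rename) (simp add: Y_obj_vars[OF v] nth_concat_offset i)
  then show ?case using i v xi by (simp add: Y_obj_vars)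
next
  case (YSum u v)
  let ?as = "map2 (\<lambda>xs v. y_eval C v xs) xss ws" and ?xs = "map2 (\<lambda>xs v. xi_word v xs) xss ws"
  have len: "length xss = length ws" using list_all2_lengthD[OF fit] .
  have v: "vars_below (ws ! i) (length (xss ! i))" "set (xss ! i) \<subseteq> Obj C" if "i < length ws" for i
    using fit xss that len Y_obj_vars[of "ws ! i" "length (xss ! i)"] by (simp_all add: list_all2_conv_all_nth)
  have as: "set ?as \<subseteq> Obj C" "set ?xs \<subseteq> Arr D"
    by (rule set_subset_if_nth, use v len in simp)+
  have m: "map (Cod D) ?xs = map (lax_ob F) ?as"
    by (rule nth_equalityI) (use v len in simp_all)
  have uv: "vars_below u (length ?as)" "vars_below v (length ?as)"
     "vars_below u (length ?xs)" "vars_below v (length ?xs)"  using YSum.prems len by auto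
  have uv': "vars_below u (length ws)" "vars_below v (length ws)" using YSum.prems by auto
  note t = xi_word_typed[OF uv(1) as(1)] xi_word_typed[OF uv(2) as(1)]
    D.y_eval_arr_typed[OF uv(3) as(2), unfolded m] D.y_eval_arr_typed[OF uv(4) as(2), unfolded m]
    C.y_eval_Obj_list[OF uv(1) as(1)] C.y_eval_Obj_list[OF uv(2) as(1)]
  have g: "y_gamma (YSum u v) ws = YSum (y_gamma u ws) (y_gamma v ws)" by (simp add: y_gamma_def)
  show ?case
    unfolding g xi_word.simps y_eval_gamma[OF fit uv'(1)] y_eval_gamma[OF fit uv'(2)]
      YSum.IH(1)[OF uv'(1)] YSum.IH(2)[OF uv'(2)] y_eval_arr.simps
    using t by (simp add: D.assoc D.interchange)
qed

lemma lax_inverse_arrows: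
  assumes "inverse_arrows C f g"
  shows "inverse_arrows D (lax_arr F f) (lax_arr F g)"
proof -
  note i = C.inverse_arrowsD[OF assms]
  have "lax_arr F g \<cdot>\<^bsub>D\<^esub> lax_arr F f = \<i>\<^bsub>D\<^esub> (lax_ob F (Dom C f))"
    "lax_arr F f \<cdot>\<^bsub>D\<^esub> lax_arr F g = \<i>\<^bsub>D\<^esub> (lax_ob F (Cod C f))"
    using i lax_arr_Comp[of f g] lax_arr_Comp[of g f] by simp_all
  then show ?thesis using i by (simp add: inverse_arrows_def hom_def)
qed

text \<open>
  The associator, the unit and the symmetry are handled by the three axioms of a lax symmetric
  monoidal functor, in this order \<open>xi_assoc\<close>, \<open>xi_unit\<close> and \<open>xi_symm\<close>, and tensor products by the
  naturality of \<open>\<xi>\<close>. For inverses it matters that canonical maps in the target category are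
  invertible, as \<open>\<xi>\<close> itself need not be.
\<close>

lemma canonical_lax:
  assumes "canonical C xs u v f" "vars_below u (length xs)" "set xs \<subseteq> Obj C"
  shows "\<exists>f'. canonical D (map (lax_ob F) xs) u v f' \<and> lax_arr F f \<cdot>\<^bsub>D\<^esub> xi_word u xs = xi_word v xs \<cdot>\<^bsub>D\<^esub> f'"
  using assms(1,2)
proof (induction rule: canonical.induct)
  case (canonical_id w)
  show ?case
    by (intro exI conjI, rule canonical.canonical_id) (use canonical_id assms(3) in simp)
next
  case (canonical_Assoc u v w)
  let ?a = "y_eval C u xs" and ?b = "y_eval C v xs" and ?c = "y_eval C w xs"
  let ?x = "xi_word u xs" and ?y = "xi_word v xs" and ?z = "xi_word w xs"
  let ?FX = "map (lax_ob F) xs"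
  have vars: "vars_below u (length xs)" "vars_below v (length xs)" "vars_below w (length xs)"
    using canonical_Assoc by auto
  note t = vars[THEN xi_word_typed(1), OF assms(3)] vars[THEN xi_word_typed(2), OF assms(3)] vars[THEN xi_word_typed(3), OF assms(3)] vars[THEN C.y_eval_Obj_list, OF assms(3)]
  have obD: "y_eval D u ?FX \<in> Obj D" "y_eval D v ?FX \<in> Obj D" "y_eval D w ?FX \<in> Obj D"
    using t by (metis D.Dom_Obj)+
  have "lax_arr F (\<alpha>\<^bsub>C\<^esub> ?a ?b ?c) \<cdot>\<^bsub>D\<^esub> xi_word (YSum (YSum u v) w) xs
    = (lax_arr F (\<alpha>\<^bsub>C\<^esub> ?a ?b ?c) \<cdot>\<^bsub>D\<^esub> lax_xi F (?a \<oplus>\<^bsub>C\<^esub> ?b, ?c) \<cdot>\<^bsub>D\<^esub> (lax_xi F (?a, ?b) \<uplus>\<^bsub>D\<^esub> \<i>\<^bsub>D\<^esub> (lax_ob F ?c)))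
      \<cdot>\<^bsub>D\<^esub> ((?x \<uplus>\<^bsub>D\<^esub> ?y) \<uplus>\<^bsub>D\<^esub> ?z)"
    using t by (simp add: D.assoc D.interchange)
  also have "\<dots> = lax_xi F (?a, ?b \<oplus>\<^bsub>C\<^esub> ?c) \<cdot>\<^bsub>D\<^esub> ((\<i>\<^bsub>D\<^esub> (lax_ob F ?a) \<uplus>\<^bsub>D\<^esub> lax_xi F (?b, ?c))
      \<cdot>\<^bsub>D\<^esub> (\<alpha>\<^bsub>D\<^esub> (lax_ob F ?a) (lax_ob F ?b) (lax_ob F ?c) \<cdot>\<^bsub>D\<^esub> ((?x \<uplus>\<^bsub>D\<^esub> ?y) \<uplus>\<^bsub>D\<^esub> ?z)))"
    unfolding xi_assoc[OF t(10-12)] using t by (simp add: D.assoc)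
  also have "\<dots> = xi_word (YSum u (YSum v w)) xs \<cdot>\<^bsub>D\<^esub> \<alpha>\<^bsub>D\<^esub> (y_eval D u ?FX) (y_eval D v ?FX) (y_eval D w ?FX)"
    using t obD D.Assoc_nat[of ?x ?y ?z] by (simp add: D.assoc D.interchange_head)
  finally show ?case using canonical.canonical_Assoc by blast
next
  case (canonical_RUnit w)
  let ?a = "y_eval C w xs" and ?x = "xi_word w xs" and ?FX = "map (lax_ob F) xs"
  have vars: "vars_below w (length xs)" using canonical_RUnit by auto
  note t = vars[THEN xi_word_typed(1), OF assms(3)] vars[THEN xi_word_typed(2), OF assms(3)] vars[THEN xi_word_typed(3), OF assms(3)] vars[THEN C.y_eval_Obj_list, OF assms(3)]
  have obD: "y_eval D w ?FX \<in> Obj D" using t by (metis D.Dom_Obj)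
  have "lax_arr F (\<c>\<^bsub>C\<^esub> ?a) \<cdot>\<^bsub>D\<^esub> xi_word (YSum w YE) xs
    = (lax_arr F (\<c>\<^bsub>C\<^esub> ?a) \<cdot>\<^bsub>D\<^esub> lax_xi F (?a, \<e>\<^bsub>C\<^esub>) \<cdot>\<^bsub>D\<^esub> (\<i>\<^bsub>D\<^esub> (lax_ob F ?a) \<uplus>\<^bsub>D\<^esub> lax_eta F)) \<cdot>\<^bsub>D\<^esub> (?x \<uplus>\<^bsub>D\<^esub> \<i>\<^bsub>D\<^esub> \<e>\<^bsub>D\<^esub>)"
    using t by (simp add: D.assoc D.interchange)
  also have "\<dots> = ?x \<cdot>\<^bsub>D\<^esub> \<c>\<^bsub>D\<^esub> (y_eval D w ?FX)"
    using t obD D.RUnit_nat[of ?x] by (simp add: xi_unit)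
  finally show ?case using canonical.canonical_RUnit by blast
next
  case (canonical_Symm u v)
  let ?a = "y_eval C u xs" and ?b = "y_eval C v xs"
  let ?x = "xi_word u xs" and ?y = "xi_word v xs" and ?FX = "map (lax_ob F) xs"
  have vars: "vars_below u (length xs)" "vars_below v (length xs)"
    using canonical_Symm by auto
  note t = vars[THEN xi_word_typed(1), OF assms(3)] vars[THEN xi_word_typed(2), OF assms(3)] vars[THEN xi_word_typed(3), OF assms(3)] vars[THEN C.y_eval_Obj_list, OF assms(3)]
  have obD: "y_eval D u ?FX \<in> Obj D" "y_eval D v ?FX \<in> Obj D"
    using t by (metis D.Dom_Obj)+
  have "lax_arr F (\<tau>\<^bsub>C\<^esub> ?a ?b) \<cdot>\<^bsub>D\<^esub> xi_word (YSum u v) xs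
    = (lax_arr F (\<tau>\<^bsub>C\<^esub> ?a ?b) \<cdot>\<^bsub>D\<^esub> lax_xi F (?a, ?b)) \<cdot>\<^bsub>D\<^esub> (?x \<uplus>\<^bsub>D\<^esub> ?y)"
    using t by (simp add: D.assoc)
  also have "\<dots> = lax_xi F (?b, ?a) \<cdot>\<^bsub>D\<^esub> (\<tau>\<^bsub>D\<^esub> (lax_ob F ?a) (lax_ob F ?b) \<cdot>\<^bsub>D\<^esub> (?x \<uplus>\<^bsub>D\<^esub> ?y))"
    using t by (simp add: xi_symm D.assoc)
  also have "\<dots> = xi_word (YSum v u) xs \<cdot>\<^bsub>D\<^esub> \<tau>\<^bsub>D\<^esub> (y_eval D u ?FX) (y_eval D v ?FX)"
    using t obD D.Symm_nat[of ?x ?y] by (simp add: D.assoc)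
  finally show ?case using canonical.canonical_Symm by blast
next
  case (canonical_inverse u v f g)
  let ?FX = "map (lax_ob F) xs"
  have vars: "vars_below u (length xs)" "vars_below v (length xs)"
    using canonical_inverse.prems canonical_set_yvars[OF canonical_inverse.hyps(1)] by auto
  then obtain f' where f': "canonical D ?FX u v f'" "lax_arr F f \<cdot>\<^bsub>D\<^esub> xi_word u xs = xi_word v xs \<cdot>\<^bsub>D\<^esub> f'"
    using canonical_inverse by auto
  have ob: "\<forall>i\<in>set (yvars u). ?FX ! i \<in> Obj D" "\<forall>i\<in>set (yvars u). xs ! i \<in> Obj C"
    using vars assms(3) by (auto simp: subset_iff)
  note g = C.inverse_arrowsD[OF canonical_inverse.hyps(2)]
  note Fg = D.inverse_arrowsD[OF lax_inverse_arrows[OF canonical_inverse.hyps(2)]]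
  note t = vars[THEN xi_word_typed(1), OF assms(3)] vars[THEN xi_word_typed(2), OF assms(3)] vars[THEN xi_word_typed(3), OF assms(3)] D.canonical_typed[OF f'(1) ob(1)] D.canonical_iso[OF f'(1) ob(1)]
    C.canonical_typed[OF canonical_inverse.hyps(1) ob(2)]
  have "lax_arr F g \<cdot>\<^bsub>D\<^esub> xi_word v xs = lax_arr F g \<cdot>\<^bsub>D\<^esub> ((xi_word v xs \<cdot>\<^bsub>D\<^esub> f') \<cdot>\<^bsub>D\<^esub> D.inverse_arr f')"
    using t g by (simp add: D.assoc)
  also have "\<dots> = (lax_arr F g \<cdot>\<^bsub>D\<^esub> lax_arr F f) \<cdot>\<^bsub>D\<^esub> (xi_word u xs \<cdot>\<^bsub>D\<^esub> D.inverse_arr f')"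
    unfolding f'(2)[symmetric] using t g(1-4) by (simp add: D.assoc)
  also have "\<dots> = xi_word u xs \<cdot>\<^bsub>D\<^esub> D.inverse_arr f'"
    unfolding Fg(5) using t g(1-4) by simp
  finally show ?case using D.canonical_inverse_arr[OF f'(1) ob(1)] by blast
next
  case (canonical_Comp v w g u f)
  let ?FX = "map (lax_ob F) xs"
  have vars: "vars_below u (length xs)" "vars_below v (length xs)" "vars_below w (length xs)"
    using canonical_Comp.prems canonical_set_yvars[OF canonical_Comp.hyps(2)] canonical_set_yvars[OF canonical_Comp.hyps(1)] by auto
  obtain f' g' where f': "canonical D ?FX u v f'" "lax_arr F f \<cdot>\<^bsub>D\<^esub> xi_word u xs = xi_word v xs \<cdot>\<^bsub>D\<^esub> f'"
    and g': "canonical D ?FX v w g'" "lax_arr F g \<cdot>\<^bsub>D\<^esub> xi_word v xs = xi_word w xs \<cdot>\<^bsub>D\<^esub> g'"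
    using canonical_Comp vars by auto
  have ob: "\<forall>i\<in>set (yvars u). ?FX ! i \<in> Obj D" "\<forall>i\<in>set (yvars v). ?FX ! i \<in> Obj D"
     "\<forall>i\<in>set (yvars u). xs ! i \<in> Obj C" "\<forall>i\<in>set (yvars v). xs ! i \<in> Obj C"
    using vars assms(3) by (auto simp: subset_iff)
  note t = vars[THEN xi_word_typed(1), OF assms(3)] vars[THEN xi_word_typed(2), OF assms(3)] vars[THEN xi_word_typed(3), OF assms(3)] D.canonical_typed[OF f'(1) ob(1)] D.canonical_typed[OF g'(1) ob(2)]
    C.canonical_typed[OF canonical_Comp.hyps(2) ob(3)] C.canonical_typed[OF canonical_Comp.hyps(1) ob(4)]
  have "lax_arr F (g \<cdot>\<^bsub>C\<^esub> f) \<cdot>\<^bsub>D\<^esub> xi_word u xs = lax_arr F g \<cdot>\<^bsub>D\<^esub> (lax_arr F f \<cdot>\<^bsub>D\<^esub> xi_word u xs)"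
    using t by (simp add: D.assoc lax_arr_Comp)
  also have "\<dots> = (lax_arr F g \<cdot>\<^bsub>D\<^esub> xi_word v xs) \<cdot>\<^bsub>D\<^esub> f'"
    unfolding f'(2) using t by (simp add: D.assoc)
  also have "\<dots> = xi_word w xs \<cdot>\<^bsub>D\<^esub> (g' \<cdot>\<^bsub>D\<^esub> f')"
    unfolding g'(2) using t by (simp add: D.assoc)
  finally show ?case using canonical.canonical_Comp[OF g'(1) f'(1)] by blast
next
  case (canonical_Tensor u u' f v v' g)
  let ?FX = "map (lax_ob F) xs"
  have vars: "vars_below u (length xs)" "vars_below v (length xs)"
    "vars_below u' (length xs)" "vars_below v' (length xs)"
    using canonical_Tensor.prems canonical_set_yvars[OF canonical_Tensor.hyps(1)] canonical_set_yvars[OF canonical_Tensor.hyps(2)] by auto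
  obtain f' g' where f': "canonical D ?FX u u' f'" "lax_arr F f \<cdot>\<^bsub>D\<^esub> xi_word u xs = xi_word u' xs \<cdot>\<^bsub>D\<^esub> f'"
    and g': "canonical D ?FX v v' g'" "lax_arr F g \<cdot>\<^bsub>D\<^esub> xi_word v xs = xi_word v' xs \<cdot>\<^bsub>D\<^esub> g'"
    using canonical_Tensor vars by auto
  have ob: "\<forall>i\<in>set (yvars u). ?FX ! i \<in> Obj D" "\<forall>i\<in>set (yvars v). ?FX ! i \<in> Obj D"
     "\<forall>i\<in>set (yvars u). xs ! i \<in> Obj C" "\<forall>i\<in>set (yvars v). xs ! i \<in> Obj C"
    using vars assms(3) by (auto simp: subset_iff)
  note t = vars[THEN xi_word_typed(1), OF assms(3)] vars[THEN xi_word_typed(2), OF assms(3)] vars[THEN xi_word_typed(3), OF assms(3)] D.canonical_typed[OF f'(1) ob(1)] D.canonical_typed[OF g'(1) ob(2)]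
    C.canonical_typed[OF canonical_Tensor.hyps(1) ob(3)] C.canonical_typed[OF canonical_Tensor.hyps(2) ob(4)]
    vars[THEN C.y_eval_Obj_list, OF assms(3)]
  have "lax_arr F (f \<uplus>\<^bsub>C\<^esub> g) \<cdot>\<^bsub>D\<^esub> xi_word (YSum u v) xs
    = (lax_arr F (f \<uplus>\<^bsub>C\<^esub> g) \<cdot>\<^bsub>D\<^esub> lax_xi F (Dom C f, Dom C g)) \<cdot>\<^bsub>D\<^esub> (xi_word u xs \<uplus>\<^bsub>D\<^esub> xi_word v xs)"
    using t by (simp add: D.assoc)
  also have "\<dots> = lax_xi F (Cod C f, Cod C g) \<cdot>\<^bsub>D\<^esub> ((lax_arr F f \<cdot>\<^bsub>D\<^esub> xi_word u xs) \<uplus>\<^bsub>D\<^esub> (lax_arr F g \<cdot>\<^bsub>D\<^esub> xi_word v xs))"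
    unfolding xi_nat[OF C.canonical_typed(1)[OF canonical_Tensor.hyps(1) ob(3)] C.canonical_typed(1)[OF canonical_Tensor.hyps(2) ob(4)], symmetric] using t by (simp add: D.assoc D.interchange)
  also have "\<dots> = xi_word (YSum u' v') xs \<cdot>\<^bsub>D\<^esub> (f' \<uplus>\<^bsub>D\<^esub> g')"
    unfolding f'(2) g'(2) using t by (simp add: D.assoc D.interchange)
  finally show ?case using canonical.canonical_Tensor[OF f'(1) g'(1)] by blast
qed

lemma y_can_lax:
  assumes "u \<in> Y_obj (length xs)" "v \<in> Y_obj (length xs)" "set xs \<subseteq> Obj C"
  shows "lax_arr F (y_can C u v xs) \<cdot>\<^bsub>D\<^esub> xi_word u xs = xi_word v xs \<cdot>\<^bsub>D\<^esub> y_can D u v (map (lax_ob F) xs)"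
proof -
  let ?FX = "map (lax_ob F) xs"
  have FX: "set ?FX \<subseteq> Obj D" "length ?FX = length xs" using assms(3) by auto
  obtain f' where f': "canonical D ?FX u v f'" "lax_arr F (y_can C u v xs) \<cdot>\<^bsub>D\<^esub> xi_word u xs = xi_word v xs \<cdot>\<^bsub>D\<^esub> f'"
    using canonical_lax[OF C.canonical_y_can[OF assms]] Y_obj_vars[OF assms(1)] assms(3) by auto
  have "canonical D ?FX u v (y_can D u v ?FX)"
    by (rule D.canonical_y_can) (use assms FX in simp_all)
  from D.canonical_unique[OF f'(1) this] f'(2) assms FX show ?thesis by simp
qed

end

lemma y_gamma_m_one: "y_gamma y_m [w, y_one] = YSum w (YVar (y_arity w))"
  by (simp add: y_gamma_def)

text \<open>
  The two statements are proved together, because the variable appended by the operad composition is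
  numbered by the arity of the preceding word.
\<close>

lemma k_word_Suc: "k_word (Suc (Suc n)) = YSum (k_word (Suc n)) (YVar (Suc n))"
  and k_word_Y_obj: "k_word n \<in> Y_obj n"
proof -
  have "k_word (Suc n) \<in> Y_obj (Suc n) \<and> k_word (Suc (Suc n)) = YSum (k_word (Suc n)) (YVar (Suc n))" for n
  proof (induction n)
    case 0
    show ?case by (auto simp: Y_obj_def y_gamma_def)
  next
    case (Suc n)
    then have "k_word (Suc (Suc n)) \<in> Y_obj (Suc (Suc n))" by (auto simp: Y_obj_def lessThan_Suc)
    moreover from Y_obj_arity[OF this]
    have "k_word (Suc (Suc (Suc n))) = YSum (k_word (Suc (Suc n))) (YVar (Suc (Suc n)))"
      by (simp only: k_word.simps(3)[of "Suc n"] y_gamma_m_one)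
    ultimately show ?case by blast
  qed
  then show "k_word (Suc (Suc n)) = YSum (k_word (Suc n)) (YVar (Suc n))" "k_word n \<in> Y_obj n"
    by (blast, cases n) (auto simp: Y_obj_def)
qed

context lax_symmetric_monoidal_functor
begin

lemma xi_n_eq_xi_word: "length xs = n \<Longrightarrow> xi_n n F xs = xi_word (k_word n) xs"
proof (induction n arbitrary: xs rule: k_word.induct)
  case 2
  then show ?case by (cases xs) (simp_all add: lax_cod)
next
  case (3 n)
  let ?k = "k_word (Suc n)"
  have len: "length (butlast xs) = Suc n" using 3(2) by simp
  \<comment> \<open>the word \<open>?k\<close> does not contain the last variable, so it has the same value at \<open>xs\<close> and \<open>butlast xs\<close>\<close>
  have nth: "\<forall>j\<in>set (yvars ?k). xs ! id j = butlast xs ! j"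
    using Y_obj_vars[OF k_word_Y_obj[of "Suc n"]] 3(2) by (simp add: nth_butlast)
  have id: "ysubst (\<lambda>j. YVar (id j)) w = w" for w by simp
  have "xi_word ?k (butlast xs) = xi_word ?k xs" "y_eval C ?k (butlast xs) = y_eval C ?k xs"
    using xi_word_rename[OF nth] y_eval_rename[OF nth, of C] by (simp_all only: id)
  moreover have "last xs = xs ! Suc n" using 3(2) by (simp add: last_conv_nth[of xs] flip: length_greater_0_conv)
  ultimately show ?case
    using 3(1)[OF len] len
    by (simp add: k_word_Suc lax_cod lax_dom kbar_def k_choice_def del: k_word.simps(3))
qed simp

end

section \<open>The induced multifunctor\<close>

lemma k_choice_word_choice: "word_choice C k_choice"
  by (simp add: word_choice_def k_choice_def k_word_Y_obj)

locale lax_functor_with_word_choices =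
  lax_symmetric_monoidal_functor C D F + A: smc_with_word_choice C \<kappa> + B: smc_with_word_choice D \<mu>
  for C D :: "('o, 'm) smc" and F :: "('o, 'm) lax" and \<kappa> \<mu> :: "'o list \<Rightarrow> yword"
begin

abbreviation Fs :: "'o list \<Rightarrow> 'o list" where "Fs \<equiv> map (lax_ob F)"

definition induced_arr :: "'o list \<Rightarrow> 'm \<Rightarrow> 'm" where
  "induced_arr xs f = lax_arr F f \<cdot>\<^bsub>D\<^esub> (xi_word (\<kappa> xs) xs \<cdot>\<^bsub>D\<^esub> y_can D (\<mu> (Fs xs)) (\<kappa> xs) (Fs xs))"

lemma Fs_Obj: "set xs \<subseteq> Obj C \<Longrightarrow> set (Fs xs) \<subseteq> Obj D"
  by auto

lemma words_Y_obj:
  assumes "set xs \<subseteq> Obj C"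
  shows "\<kappa> xs \<in> Y_obj (length (Fs xs))" "\<mu> (Fs xs) \<in> Y_obj (length (Fs xs))"
  using A.kappa_Y_obj[OF assms] B.kappa_Y_obj[OF Fs_Obj[OF assms]] by simp_all

lemma change_typed:
  assumes "set xs \<subseteq> Obj C"
  shows "y_can D (\<mu> (Fs xs)) (\<kappa> xs) (Fs xs) \<in> Arr D"
    "Dom D (y_can D (\<mu> (Fs xs)) (\<kappa> xs) (Fs xs)) = kbar D \<mu> (Fs xs)"
    "Cod D (y_can D (\<mu> (Fs xs)) (\<kappa> xs) (Fs xs)) = y_eval D (\<kappa> xs) (Fs xs)"
  using D.y_can_typed[OF words_Y_obj(2,1)[OF assms] Fs_Obj[OF assms]] by (simp_all only: kbar_def)

lemma xi_kappa_typed: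
  assumes "set xs \<subseteq> Obj C"
  shows "xi_word (\<kappa> xs) xs \<in> Arr D" "Dom D (xi_word (\<kappa> xs) xs) = y_eval D (\<kappa> xs) (Fs xs)"
    "Cod D (xi_word (\<kappa> xs) xs) = lax_ob F (kbar C \<kappa> xs)"
  using xi_word_typed[of "\<kappa> xs" xs] A.kappa_vars[OF assms] assms by (simp_all add: kbar_def)

lemma induced_arr_typed:
  assumes "set xs \<subseteq> Obj C" "f \<in> Arr C" "Dom C f = kbar C \<kappa> xs"
  shows "induced_arr xs f \<in> Arr D" "Dom D (induced_arr xs f) = kbar D \<mu> (Fs xs)"
    "Cod D (induced_arr xs f) = lax_ob F (Cod C f)"
  using change_typed[OF assms(1)] xi_kappa_typed[OF assms(1)] assms by (simp_all add: induced_arr_def)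

text \<open>
  The definition changes from \<open>\<kappa>\<close> to left-nested words, applies \<open>F\<close> with \<open>\<xi>\<^sub>n\<close>, and changes to \<open>\<mu>\<close>. By
  \<open>y_can_lax\<close> the image under \<open>F\<close> of the first change of words can be exchanged with \<open>\<xi>\<close>, after which
  the two changes compose to a single canonical map.
\<close>

lemma induced_eq:
  "induced \<kappa> \<mu> F = \<lparr>mf_dom = underlying C \<kappa>, mf_cod = underlying D \<mu>,
     mf_ob = restrict (lax_ob F) (Obj C),
     mf_arr = (\<lambda>f\<in>MArr (underlying C \<kappa>). (Fs (fst f), induced_arr (fst f) (snd f)))\<rparr>"
proof -
  have ob: "compose (Obj C) (\<lambda>a\<in>Obj D. a) (compose (Obj C) (\<lambda>a\<in>Obj C. lax_ob F a) (\<lambda>a\<in>Obj C. a)) = restrict (lax_ob F) (Obj C)"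
    by (auto simp: compose_def fun_eq_iff)
  interpret K: smc_with_word_choice C k_choice by unfold_locales (rule k_choice_word_choice)
  interpret L: smc_with_word_choice D k_choice by unfold_locales (rule k_choice_word_choice)
  have arr: "mf_arr (change_choice D k_choice \<mu>) (mf_arr (induced_k F) (mf_arr (change_choice C \<kappa> k_choice) (xs, f)))
      = (Fs xs, induced_arr xs f)" if xf: "(xs, f) \<in> MArr (underlying C \<kappa>)" for xs f
  proof -
    have f: "set xs \<subseteq> Obj C" "f \<in> Arr C" "Dom C f = kbar C \<kappa> xs"
      using xf by (simp_all add: A.MArr_underlying)
    let ?k = "k_choice xs"
    have k: "?k \<in> Y_obj (length xs)" "k_choice (Fs xs) = ?k" "?k \<in> Y_obj (length (Fs xs))"
      by (simp_all add: k_choice_def k_word_Y_obj)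
    note w = words_Y_obj[OF f(1)] and Fo = Fs_Obj[OF f(1)]
    have \<kappa>: "\<kappa> xs \<in> Y_obj (length xs)" by (rule A.kappa_Y_obj[OF f(1)])
    let ?c = "y_can C ?k (\<kappa> xs) xs" and ?d = "y_can D ?k (\<kappa> xs) (Fs xs)" and ?e = "y_can D (\<mu> (Fs xs)) ?k (Fs xs)"
    note c = C.y_can_typed[OF k(1) \<kappa> f(1)] and d = D.y_can_typed[OF k(3) w(1) Fo] and e = D.y_can_typed[OF w(2) k(3) Fo]
    have 1: "mf_arr (change_choice C \<kappa> k_choice) (xs, f) = (xs, f \<cdot>\<^bsub>C\<^esub> ?c)"
      using xf by (simp add: change_choice_def)
    have 2: "(xs, f \<cdot>\<^bsub>C\<^esub> ?c) \<in> MArr (underlying C k_choice)"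
      using c f by (simp add: K.MArr_underlying kbar_def)
    have xi: "xi_n (length xs) F xs = xi_word ?k xs" by (simp add: xi_n_eq_xi_word k_choice_def)
    have xk: "xi_word ?k xs \<in> Arr D" "Dom D (xi_word ?k xs) = y_eval D ?k (Fs xs)" "Cod D (xi_word ?k xs) = lax_ob F (y_eval C ?k xs)"
      using xi_word_typed[OF _ f(1), of ?k] Y_obj_vars[OF k(1)] by simp_all
    have 3: "mf_arr (induced_k F) (xs, f \<cdot>\<^bsub>C\<^esub> ?c) = (Fs xs, lax_arr F (f \<cdot>\<^bsub>C\<^esub> ?c) \<cdot>\<^bsub>D\<^esub> xi_word ?k xs)"
      using 2 by (simp add: induced_k_def lax_dom lax_cod xi)
    have 4: "(Fs xs, lax_arr F (f \<cdot>\<^bsub>C\<^esub> ?c) \<cdot>\<^bsub>D\<^esub> xi_word ?k xs) \<in> MArr (underlying D k_choice)"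
      using c f xk Fo by (simp add: L.MArr_underlying kbar_def k)
    have 5: "mf_arr (change_choice D k_choice \<mu>) (Fs xs, lax_arr F (f \<cdot>\<^bsub>C\<^esub> ?c) \<cdot>\<^bsub>D\<^esub> xi_word ?k xs)
      = (Fs xs, (lax_arr F (f \<cdot>\<^bsub>C\<^esub> ?c) \<cdot>\<^bsub>D\<^esub> xi_word ?k xs) \<cdot>\<^bsub>D\<^esub> ?e)"
      using 4 by (simp add: change_choice_def k)
    have de: "?d \<cdot>\<^bsub>D\<^esub> ?e = y_can D (\<mu> (Fs xs)) (\<kappa> xs) (Fs xs)"
      using D.canonical_unique[OF canonical_Comp[OF D.canonical_y_can[OF k(3) w(1) Fo] D.canonical_y_can[OF w(2) k(3) Fo]]
         D.canonical_y_can[OF w(2) w(1) Fo] w(2) Fo] .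
    have "(lax_arr F (f \<cdot>\<^bsub>C\<^esub> ?c) \<cdot>\<^bsub>D\<^esub> xi_word ?k xs) \<cdot>\<^bsub>D\<^esub> ?e
      = lax_arr F f \<cdot>\<^bsub>D\<^esub> ((lax_arr F ?c \<cdot>\<^bsub>D\<^esub> xi_word ?k xs) \<cdot>\<^bsub>D\<^esub> ?e)"
      using c f xk e by (simp add: lax_arr_Comp kbar_def D.assoc)
    also have "\<dots> = lax_arr F f \<cdot>\<^bsub>D\<^esub> (xi_word (\<kappa> xs) xs \<cdot>\<^bsub>D\<^esub> (?d \<cdot>\<^bsub>D\<^esub> ?e))"
      unfolding y_can_lax[OF k(1) \<kappa> f(1)] using xi_kappa_typed[OF f(1)] d e by (simp add: D.assoc)
    finally show ?thesis by (simp add: 1 3 5 de induced_arr_def)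
  qed
  have "mf_arr (induced \<kappa> \<mu> F) = (\<lambda>f\<in>MArr (underlying C \<kappa>). (Fs (fst f), induced_arr (fst f) (snd f)))"
    using arr by (auto simp: induced_def mf_comp_def compose_def fun_eq_iff lax_dom lax_cod change_choice_def[of C])
  moreover have "mf_ob (induced \<kappa> \<mu> F) = restrict (lax_ob F) (Obj C)"
    using ob by (simp add: induced_def mf_comp_def change_choice_def induced_k_def lax_dom lax_cod A.MObj_underlying K.MObj_underlying)
  moreover have "mf_dom (induced \<kappa> \<mu> F) = underlying C \<kappa>" "mf_cod (induced \<kappa> \<mu> F) = underlying D \<mu>"
    by (simp_all add: induced_def mf_comp_def change_choice_def lax_dom lax_cod)
  ultimately show ?thesis by simp
qed

lemma induced_Id:
  assumes a: "a \<in> Obj C"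
  shows "induced_arr [a] (y_can C (\<kappa> [a]) y_one [a]) = y_can D (\<mu> [lax_ob F a]) y_one [lax_ob F a]"
proof -
  have xs: "set [a] \<subseteq> Obj C" using a by simp
  have o: "y_one \<in> Y_obj (length [a])" "y_one \<in> Y_obj (length (Fs [a]))" using A.one_Y_obj by simp_all
  note w = words_Y_obj[OF xs] and Fo = Fs_Obj[OF xs] and k = A.kappa_Y_obj[OF xs]
  let ?c = "y_can C (\<kappa> [a]) y_one [a]" and ?d = "y_can D (\<kappa> [a]) y_one (Fs [a])" and ?e = "y_can D (\<mu> (Fs [a])) (\<kappa> [a]) (Fs [a])"
  note c = C.y_can_typed[OF k o(1) xs] and d = D.y_can_typed[OF w(1) o(2) Fo]
  have de: "?d \<cdot>\<^bsub>D\<^esub> ?e = y_can D (\<mu> (Fs [a])) y_one (Fs [a])"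
    by (rule D.canonical_unique[OF canonical_Comp[OF D.canonical_y_can[OF w(1) o(2) Fo] D.canonical_y_can[OF w(2) w(1) Fo]]
         D.canonical_y_can[OF w(2) o(2) Fo] w(2) Fo])
  have "induced_arr [a] ?c = (lax_arr F ?c \<cdot>\<^bsub>D\<^esub> xi_word (\<kappa> [a]) [a]) \<cdot>\<^bsub>D\<^esub> ?e"
    using c change_typed[OF xs] xi_kappa_typed[OF xs] by (simp add: induced_arr_def D.assoc kbar_def)
  also have "\<dots> = xi_word y_one [a] \<cdot>\<^bsub>D\<^esub> (?d \<cdot>\<^bsub>D\<^esub> ?e)"
    unfolding y_can_lax[OF k o(1) xs] using d change_typed[OF xs] a by (simp add: D.assoc)
  also have "\<dots> = y_can D (\<mu> (Fs [a])) y_one (Fs [a])"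
    unfolding de using D.y_can_typed[OF w(2) o(2) Fo] a by simp
  finally show ?thesis by simp
qed

lemma induced_Act:
  assumes f: "set xs \<subseteq> Obj C" "f \<in> Arr C" "Dom C f = kbar C \<kappa> xs" and \<sigma>: "\<sigma> permutes {..<length xs}"
  shows "induced_arr (permute_list \<sigma> xs) (f \<cdot>\<^bsub>C\<^esub> A.\<theta> xs \<sigma>)
    = induced_arr xs f \<cdot>\<^bsub>D\<^esub> B.\<theta> (Fs xs) \<sigma>"
proof -
  let ?s = "permute_list \<sigma> xs"
  have s: "set ?s \<subseteq> Obj C" "Fs ?s = permute_list \<sigma> (Fs xs)" using f(1) \<sigma> by (simp_all add: permute_list_map)
  have \<sigma>F: "\<sigma> permutes {..<length (Fs xs)}" using \<sigma> by simp
  have ys: "y_act (\<kappa> xs) \<sigma> \<in> Y_obj (length ?s)" using y_act_Y_obj[OF A.kappa_Y_obj[OF f(1)] \<sigma>] by simp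
  have ys': "y_act (\<kappa> xs) \<sigma> \<in> Y_obj (length (Fs ?s))" using ys by simp
  note k = A.kappa_Y_obj[OF s(1)] and w = words_Y_obj[OF s(1)] and Fo = Fs_Obj[OF s(1)] and F0 = Fs_Obj[OF f(1)]
  let ?c = "y_can C (\<kappa> ?s) (y_act (\<kappa> xs) \<sigma>) ?s" and ?d = "y_can D (\<kappa> ?s) (y_act (\<kappa> xs) \<sigma>) (Fs ?s)"
  let ?e = "y_can D (\<mu> (Fs ?s)) (\<kappa> ?s) (Fs ?s)" and ?u = "y_can D (\<mu> (Fs xs)) (\<kappa> xs) (Fs xs)"
  let ?b = "B.\<theta> (Fs xs) \<sigma>"
  have vk: "vars_below (\<kappa> xs) (length xs)" using A.kappa_vars[OF f(1)] by simp
  have vm: "vars_below (\<mu> (Fs xs)) (length (Fs xs))" using B.kappa_vars[OF F0] by simp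
  note c = A.act_typed[OF f(1) \<sigma>] and b = B.act_typed[OF F0 \<sigma>F] and d = D.y_can_typed[OF w(1) ys' Fo]
  have 1: "canonical D (Fs ?s) (\<mu> (Fs ?s)) (y_act (\<kappa> xs) \<sigma>) (?d \<cdot>\<^bsub>D\<^esub> ?e)"
    by (rule canonical_Comp[OF D.canonical_y_can[OF w(1) ys' Fo] D.canonical_y_can[OF w(2) w(1) Fo]])
  have "canonical D (permute_list \<sigma> (Fs xs)) (y_act (\<mu> (Fs xs)) \<sigma>) (y_act (\<kappa> xs) \<sigma>) ?u"
    by (rule canonical_act[OF D.canonical_y_can[OF words_Y_obj(2,1)[OF f(1)] F0] \<sigma>F vm])
  from canonical_Comp[OF this B.act_canonical[OF F0 \<sigma>F]]
  have 2: "canonical D (Fs ?s) (\<mu> (Fs ?s)) (y_act (\<kappa> xs) \<sigma>) (?u \<cdot>\<^bsub>D\<^esub> ?b)" unfolding s(2) .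
  have key: "?d \<cdot>\<^bsub>D\<^esub> ?e = ?u \<cdot>\<^bsub>D\<^esub> ?b" by (rule D.canonical_unique[OF 1 2 w(2) Fo])
  have "induced_arr ?s (f \<cdot>\<^bsub>C\<^esub> ?c) = lax_arr F f \<cdot>\<^bsub>D\<^esub> ((lax_arr F ?c \<cdot>\<^bsub>D\<^esub> xi_word (\<kappa> ?s) ?s) \<cdot>\<^bsub>D\<^esub> ?e)"
    using c f change_typed[OF s(1)] xi_kappa_typed[OF s(1)] by (simp add: induced_arr_def D.assoc lax_arr_Comp)
  also have "\<dots> = lax_arr F f \<cdot>\<^bsub>D\<^esub> (xi_word (\<kappa> xs) xs \<cdot>\<^bsub>D\<^esub> (?d \<cdot>\<^bsub>D\<^esub> ?e))"
    unfolding y_can_lax[OF k ys s(1)] xi_word_act[OF \<sigma> vk]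
    using d change_typed[OF s(1)] xi_kappa_typed[OF f(1)] y_eval_act[OF \<sigma>F, of "\<kappa> xs" D] vk s(2) by (simp add: D.assoc)
  also have "\<dots> = induced_arr xs f \<cdot>\<^bsub>D\<^esub> ?b"
    unfolding key using b f change_typed[OF f(1)] xi_kappa_typed[OF f(1)] by (simp add: induced_arr_def D.assoc)
  finally show ?thesis .
qed

text \<open>
  On the left, \<open>y_can_lax\<close> moves \<open>F \<phi>\<close> past \<open>\<xi>\<close>, then \<open>xi_word_gamma\<close> splits \<open>\<xi>\<close> of the composite word
  into an outer and an inner part, and naturality of \<open>\<xi>\<close> interchanges the outer part with the inner
  arrows. On the right, naturality moves the change of words for the outer arrow past the inner
  images. Both sides then consist of the same arrows followed by a canonical map.
\<close>

lemma induced_Comp: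
  assumes gf: "mcomposable (underlying C \<kappa>) g fs"
  shows "induced_arr (concat (map fst fs)) (snd (MComp (underlying C \<kappa>) g fs))
    = snd (MComp (underlying D \<mu>) (Fs (fst g), induced_arr (fst g) (snd g)) (map (\<lambda>f. (Fs (fst f), induced_arr (fst f) (snd f))) fs))"
proof -
  let ?ys = "fst g" and ?xss = "map fst fs" and ?hs = "map snd fs" and ?g = "snd g"
  let ?X = "concat ?xss" and ?Fxss = "map Fs (map fst fs)"
  let ?FX = "Fs (concat (map fst fs))"
  note G = gf[unfolded A.mcomposable_underlying] and T = A.composite_typed[OF gf]
  have ys: "set ?ys \<subseteq> Obj C" and xss: "\<forall>xs\<in>set ?xss. set xs \<subseteq> Obj C" using G by blast+
  have Fys: "set (Fs ?ys) \<subseteq> Obj D" by (rule Fs_Obj[OF ys])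
  have Fxss: "\<forall>xs\<in>set ?Fxss. set xs \<subseteq> Obj D" using xss by fastforce
  have X: "set ?X \<subseteq> Obj C" by (rule A.concat_Obj[OF xss])
  have FX: "set ?FX \<subseteq> Obj D" "concat ?Fxss = ?FX" using Fs_Obj[OF X] by (simp_all add: map_concat)
  have len: "length ?xss = length ?ys" "length ?Fxss = length (Fs ?ys)" "length fs = length ?ys" using T(1) by simp_all
  have fi: "set (fst (fs ! i)) \<subseteq> Obj C" "snd (fs ! i) \<in> Arr C" "Dom C (snd (fs ! i)) = kbar C \<kappa> (fst (fs ! i))"
    if "i < length fs" for i
  proof -
    have "fs ! i \<in> MArr (underlying C \<kappa>)" using gf that by (auto simp: mcomposable_def)
    then show "set (fst (fs ! i)) \<subseteq> Obj C" "snd (fs ! i) \<in> Arr C" "Dom C (snd (fs ! i)) = kbar C \<kappa> (fst (fs ! i))"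
      by (simp_all add: A.MArr_underlying)
  qed
  let ?xis = "map (\<lambda>f. xi_word (\<kappa> (fst f)) (fst f)) fs"
  let ?ds = "map (\<lambda>f. y_can D (\<mu> (Fs (fst f))) (\<kappa> (fst f)) (Fs (fst f))) fs"
  let ?Fh = "map (lax_arr F) ?hs"
  let ?is = "map (\<lambda>f. induced_arr (fst f) (snd f)) fs"
  let ?\<gamma> = "y_gamma (\<kappa> ?ys) (map \<kappa> ?xss)"
  have \<gamma>: "?\<gamma> \<in> Y_obj (length ?X)" "?\<gamma> \<in> Y_obj (length ?FX)"
    using A.gamma_kappa_Y_obj[OF ys len(1) xss] by simp_all
  note w = words_Y_obj[OF X]
  let ?c1 = "y_can D (\<mu> ?FX) (\<kappa> ?X) ?FX" and ?c2 = "y_can D (\<kappa> ?X) ?\<gamma> ?FX"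
  note c1 = change_typed[OF X] and c2 = D.y_can_typed[OF w(1) \<gamma>(2) FX(1)]
  let ?E = "y_eval_arr C (\<kappa> ?ys) ?hs" and ?\<phi> = "A.\<phi> ?ys ?xss"
  let ?EF = "y_eval_arr D (\<kappa> ?ys) ?Fh" and ?Ex = "y_eval_arr D (\<kappa> ?ys) ?xis" and ?Ed = "y_eval_arr D (\<kappa> ?ys) ?ds"
  have v: "vars_below (\<kappa> ?ys) (length ?hs)" "vars_below (\<kappa> ?ys) (length ?Fh)" "vars_below (\<kappa> ?ys) (length ?xis)"
     "vars_below (\<kappa> ?ys) (length ?ds)" "vars_below (\<kappa> ?ys) (length ?is)" "vars_below (\<kappa> ?ys) (length (map \<kappa> ?xss))"
     "vars_below (\<kappa> ?ys) (length ?ys)" "vars_below (\<kappa> ?ys) (length (map2 (Comp D) ?xis ?ds))"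
     "vars_below (\<kappa> ?ys) (length ?Fxss)"
    using A.kappa_vars[OF ys] len by simp_all
  have arrs: "set ?hs \<subseteq> Arr C" "set ?Fh \<subseteq> Arr D" "set ?xis \<subseteq> Arr D" "set ?ds \<subseteq> Arr D" "set ?is \<subseteq> Arr D" "set (map2 (Comp D) ?xis ?ds) \<subseteq> Arr D"
    by (rule set_subset_if_nth, use fi induced_arr_typed xi_kappa_typed change_typed in simp)+
  have dm: "map (Dom C) ?hs = map (kbar C \<kappa>) ?xss" "map (Cod C) ?hs = ?ys"
    "map (Dom D) ?Fh = map (Cod D) ?xis" "map (Dom D) ?Fh = map (Cod D) (map2 (Comp D) ?xis ?ds)" "map (Dom D) ?xis = map (Cod D) ?ds"
    "map (Dom D) ?ds = map (kbar D \<mu>) ?Fxss" "map (Dom D) ?is = map (kbar D \<mu>) ?Fxss" "map (Cod D) ?is = Fs ?ys"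
    "map (Cod D) ?Fh = Fs ?ys"
    "map (Dom D) ?xis = map2 (\<lambda>xs v. y_eval D v xs) ?Fxss (map \<kappa> ?xss)"
    "map2 (\<lambda>xs v. xi_word v xs) ?xss (map \<kappa> ?xss) = ?xis"
  proof -
    show "map (Dom C) ?hs = map (kbar C \<kappa>) ?xss" using G by blast
    show 2: "map (Cod C) ?hs = ?ys" using G by blast
    show "map (Cod D) ?is = Fs ?ys" unfolding 2[symmetric]
      by (rule nth_equalityI) (use fi induced_arr_typed in simp_all)
    show "map (Cod D) ?Fh = Fs ?ys" unfolding 2[symmetric]
      by (rule nth_equalityI) (use fi in simp_all)
  qed (rule nth_equalityI, simp, use fi induced_arr_typed xi_kappa_typed change_typed in simp)+
  note tE = C.y_eval_arr_typed[OF v(1) arrs(1)]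
  note tF = D.y_eval_arr_typed[OF v(2) arrs(2), unfolded dm(3) dm(9)] and tx = D.y_eval_arr_typed[OF v(3) arrs(3)]
    and td = D.y_eval_arr_typed[OF v(4) arrs(4)]
  have key1: "lax_arr F ?\<phi> \<cdot>\<^bsub>D\<^esub> xi_word (\<kappa> ?X) ?X = xi_word ?\<gamma> ?X \<cdot>\<^bsub>D\<^esub> ?c2"
    by (rule y_can_lax[OF A.kappa_Y_obj[OF X] \<gamma>(1) X])
  have key2: "xi_word ?\<gamma> ?X = xi_word (\<kappa> ?ys) (map (Dom C) ?hs) \<cdot>\<^bsub>D\<^esub> ?Ex"
    using xi_word_gamma[OF A.fits_kappa[OF xss] v(6) xss] unfolding A.map2_eval_kappa dm(1,11) .
  have key3: "lax_arr F ?E \<cdot>\<^bsub>D\<^esub> xi_word (\<kappa> ?ys) (map (Dom C) ?hs) = xi_word (\<kappa> ?ys) ?ys \<cdot>\<^bsub>D\<^esub> ?EF"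
    using xi_word_natural[OF v(1) arrs(1)] unfolding dm(2) .
  let ?d = "y_can D (\<mu> (Fs ?ys)) (\<kappa> ?ys) (Fs ?ys)" and ?q = "y_can D (\<mu> (Fs ?ys)) (\<kappa> ?ys) (map (Dom D) ?is)"
  let ?I = "y_eval_arr D (\<mu> (Fs ?ys)) ?is" and ?\<psi> = "B.\<phi> (Fs ?ys) ?Fxss"
  have yw: "\<mu> (Fs ?ys) \<in> Y_obj (length ?is)" "\<kappa> ?ys \<in> Y_obj (length ?is)"
    using words_Y_obj[OF ys] len by simp_all
  have yw': "\<mu> (Fs ?ys) \<in> Y_obj (length (map (Dom D) ?is))" "\<kappa> ?ys \<in> Y_obj (length (map (Dom D) ?is))"
    using yw by simp_all
  have DO: "set (map (Dom D) ?is) \<subseteq> Obj D" using arrs(5) by (intro B.map_Dom_Obj)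
  \<comment> \<open>the change of words for the outer arrow moves past the images of the inner arrows\<close>
  have key4: "y_eval_arr D (\<kappa> ?ys) ?is \<cdot>\<^bsub>D\<^esub> ?q = ?d \<cdot>\<^bsub>D\<^esub> ?I"
    using D.y_can_natural[OF yw arrs(5)] unfolding dm(8) .
  have is_eq: "?is = map2 (Comp D) ?Fh (map2 (Comp D) ?xis ?ds)"
    by (rule nth_equalityI) (simp_all add: induced_arr_def)
  \<comment> \<open>the images of the inner arrows split into \<open>F\<close>, \<open>\<xi>\<close> and a change of words\<close>
  have key5: "y_eval_arr D (\<kappa> ?ys) ?is = ?EF \<cdot>\<^bsub>D\<^esub> (?Ex \<cdot>\<^bsub>D\<^esub> ?Ed)"
    unfolding is_eq D.y_eval_arr_Comp[OF v(8) arrs(6,2) dm(4)] D.y_eval_arr_Comp[OF v(4) arrs(4,3) dm(5)] ..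
  note q = D.y_can_typed[OF yw' DO]
  have fit: "fits ?Fxss (map \<mu> ?Fxss)" "fits ?Fxss (map \<kappa> ?xss)"
    using B.fits_kappa[OF Fxss] A.fits_kappa[OF xss] by (simp_all add: list_all2_conv_all_nth)
  have q1: "canonical D ?FX (y_gamma (\<mu> (Fs ?ys)) (map \<mu> ?Fxss)) (y_gamma (\<kappa> ?ys) (map \<mu> ?Fxss)) ?q"
    unfolding FX(2)[symmetric]
  proof (rule canonical_gamma[OF _ fit(1)])
    show "canonical D (map2 (\<lambda>xs w. y_eval D w xs) ?Fxss (map \<mu> ?Fxss)) (\<mu> (Fs ?ys)) (\<kappa> ?ys) ?q"
      using D.canonical_y_can[OF yw' DO] unfolding B.map2_eval_kappa dm(7) .
    show "vars_below (\<mu> (Fs ?ys)) (length (map \<mu> ?Fxss))" using B.kappa_vars[OF Fys] len by simp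
  qed
  have q2: "canonical D ?FX (y_gamma (\<kappa> ?ys) (map \<mu> ?Fxss)) ?\<gamma> ?Ed"
    unfolding FX(2)[symmetric]
  proof (rule canonical_gamma_inner[OF fit v(9)])
    fix i assume "i < length ?Fxss"
    then have i: "i < length fs" by simp
    show "canonical D (?Fxss ! i) (map \<mu> ?Fxss ! i) (map \<kappa> ?xss ! i) (?ds ! i)"
      using D.canonical_y_can[OF words_Y_obj(2,1)[OF fi(1)[OF i]] Fs_Obj[OF fi(1)[OF i]]] i by simp
  qed
  have q0: "canonical D ?FX (\<mu> ?FX) (y_gamma (\<mu> (Fs ?ys)) (map \<mu> ?Fxss)) ?\<psi>"
    using B.phi_canonical[OF Fys len(2) Fxss] unfolding FX(2) .
  have key: "?Ed \<cdot>\<^bsub>D\<^esub> (?q \<cdot>\<^bsub>D\<^esub> ?\<psi>) = ?c2 \<cdot>\<^bsub>D\<^esub> ?c1"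
    by (rule D.canonical_unique[OF canonical_Comp[OF q2 canonical_Comp[OF q1 q0]]
        canonical_Comp[OF D.canonical_y_can[OF w(1) \<gamma>(2) FX(1)] D.canonical_y_can[OF w(2) w(1) FX(1)]] w(2) FX(1)])
  note tp = B.phi_typed[OF Fys len(2) Fxss]
  note x0 = xi_kappa_typed[OF ys] and xX = xi_kappa_typed[OF X] and d0 = change_typed[OF ys]
  have vI: "vars_below (\<mu> (Fs ?ys)) (length ?is)" using B.kappa_vars[OF Fys] len by simp
  note tI = D.y_eval_arr_typed[OF vI arrs(5), unfolded dm(7,8)]
  have DomC: "set (map (Dom C) ?hs) \<subseteq> Obj C" by (rule A.map_Dom_Obj[OF arrs(1)])
  have vD: "vars_below (\<kappa> ?ys) (length (map (Dom C) ?hs))" using v(1) by simp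
  note xD = xi_word_typed[OF vD DomC]
  have tx2: "Cod D ?Ex = y_eval D (\<kappa> ?ys) (Fs (map (Dom C) ?hs))"
  proof -
    have "map (Cod D) ?xis = Fs (map (Dom C) ?hs)" unfolding dm(1)
      by (rule nth_equalityI) (use fi xi_kappa_typed in simp_all)
    then show ?thesis using tx(3) by (simp only:)
  qed
  have c2x: "Cod D ?c2 = Dom D ?Ex"
    using c2(3) tx(2) y_eval_gamma[OF fit(2) v(6), of D] unfolding FX(2) dm(10) by simp
  have Fg: "lax_arr F ?g \<in> Arr D" "Dom D (lax_arr F ?g) = lax_ob F (kbar C \<kappa> ?ys)" using G by simp_all
  have FE: "lax_arr F ?E \<in> Arr D" "Dom D (lax_arr F ?E) = lax_ob F (y_eval C (\<kappa> ?ys) (map (Dom C) ?hs))"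
    "Cod D (lax_arr F ?E) = lax_ob F (kbar C \<kappa> ?ys)"
    using tE T(4) by simp_all
  have Fp: "lax_arr F ?\<phi> \<in> Arr D" "Dom D (lax_arr F ?\<phi>) = lax_ob F (kbar C \<kappa> ?X)"
    "Cod D (lax_arr F ?\<phi>) = lax_ob F (y_eval C (\<kappa> ?ys) (map (Dom C) ?hs))"
    using T(5-7) dm(1) by (simp_all only: lax_arr_typed)
  have FFF: "lax_arr F (?g \<cdot>\<^bsub>C\<^esub> ?E \<cdot>\<^bsub>C\<^esub> ?\<phi>) = lax_arr F ?g \<cdot>\<^bsub>D\<^esub> (lax_arr F ?E \<cdot>\<^bsub>D\<^esub> lax_arr F ?\<phi>)"
    using G T by (simp add: lax_arr_Comp C.assoc del: map_map)
  have tFx: "Dom D ?EF = Cod D ?Ex" using tF(2) tx(3) by (simp only:)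
  have tEd: "Cod D ?Ed = Dom D ?Ex" using td(3) tx(2) dm(5) by (simp only:)
  have qd: "Cod D ?q = Dom D ?Ed" "Cod D ?\<psi> = Dom D ?q" using q(2,3) td(2) tp(3) dm(6,7) by (simp_all only:)
  have EFc: "Cod D ?EF = y_eval D (\<kappa> ?ys) (Fs ?ys)" using tF(3) .
  have "induced_arr ?X (?g \<cdot>\<^bsub>C\<^esub> ?E \<cdot>\<^bsub>C\<^esub> ?\<phi>)
    = lax_arr F ?g \<cdot>\<^bsub>D\<^esub> (lax_arr F ?E \<cdot>\<^bsub>D\<^esub> ((lax_arr F ?\<phi> \<cdot>\<^bsub>D\<^esub> xi_word (\<kappa> ?X) ?X) \<cdot>\<^bsub>D\<^esub> ?c1))"
    unfolding induced_arr_def FFF using Fg FE Fp xX c1 by (simp add: D.assoc)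
  also have "\<dots> = lax_arr F ?g \<cdot>\<^bsub>D\<^esub> ((lax_arr F ?E \<cdot>\<^bsub>D\<^esub> xi_word (\<kappa> ?ys) (map (Dom C) ?hs)) \<cdot>\<^bsub>D\<^esub> (?Ex \<cdot>\<^bsub>D\<^esub> (?c2 \<cdot>\<^bsub>D\<^esub> ?c1)))"
    unfolding key1 key2 using Fg FE xD tx(1) tx2 c2(1,2) c2x c1 by (simp add: D.assoc del: map_map)
  also have "\<dots> = lax_arr F ?g \<cdot>\<^bsub>D\<^esub> (xi_word (\<kappa> ?ys) ?ys \<cdot>\<^bsub>D\<^esub> ((?EF \<cdot>\<^bsub>D\<^esub> (?Ex \<cdot>\<^bsub>D\<^esub> ?Ed)) \<cdot>\<^bsub>D\<^esub> (?q \<cdot>\<^bsub>D\<^esub> ?\<psi>)))"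
    unfolding key3 key[symmetric] using Fg x0 tF(1) EFc tFx tx(1) td(1) tEd q(1) qd tp(1)
    by (simp add: D.assoc del: map_map)
  also have "\<dots> = lax_arr F ?g \<cdot>\<^bsub>D\<^esub> (xi_word (\<kappa> ?ys) ?ys \<cdot>\<^bsub>D\<^esub> ((y_eval_arr D (\<kappa> ?ys) ?is \<cdot>\<^bsub>D\<^esub> ?q) \<cdot>\<^bsub>D\<^esub> ?\<psi>))"
    unfolding key5 using tF(1) tFx tx(1) td(1) tEd q(1) qd tp(1) by (simp add: D.assoc del: map_map)
  also have "\<dots> = induced_arr ?ys ?g \<cdot>\<^bsub>D\<^esub> ?I \<cdot>\<^bsub>D\<^esub> ?\<psi>"
    unfolding key4 induced_arr_def[of ?ys ?g] using Fg x0 d0 tI tp by (simp add: D.assoc kbar_def del: map_map)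
  finally have "induced_arr ?X (?g \<cdot>\<^bsub>C\<^esub> ?E \<cdot>\<^bsub>C\<^esub> ?\<phi>) = induced_arr ?ys ?g \<cdot>\<^bsub>D\<^esub> ?I \<cdot>\<^bsub>D\<^esub> ?\<psi>" .
  moreover have "map fst (map (\<lambda>f. (Fs (fst f), induced_arr (fst f) (snd f))) fs) = ?Fxss"
    "map snd (map (\<lambda>f. (Fs (fst f), induced_arr (fst f) (snd f))) fs) = ?is" by simp_all
  ultimately show ?thesis
    by (simp only: A.MComp_underlying B.MComp_underlying fst_conv snd_conv)
qed

theorem induced_multifunctor: "multifunctor (underlying C \<kappa>) (underlying D \<mu>) (induced \<kappa> \<mu> F)"
proof -
  let ?I = "induced \<kappa> \<mu> F"
  have I: "mf_arr ?I f = (Fs (fst f), induced_arr (fst f) (snd f))" if "f \<in> MArr (underlying C \<kappa>)" for f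
    using that by (simp add: induced_eq)
  have ob: "mf_ob ?I a = lax_ob F a" if "a \<in> Obj C" for a using that by (simp add: induced_eq)
  have obs: "map (mf_ob ?I) xs = Fs xs" if "set xs \<subseteq> Obj C" for xs using that ob by (auto simp: subset_iff)
  interpret M: multicategory "underlying C \<kappa>" by (rule A.underlying_multicategory)
  interpret N: multicategory "underlying D \<mu>" by (rule B.underlying_multicategory)
  show ?thesis
  proof
    show "mf_dom ?I = underlying C \<kappa>" "mf_cod ?I = underlying D \<mu>"
      "mf_ob ?I \<in> extensional (MObj (underlying C \<kappa>))" "mf_arr ?I \<in> extensional (MArr (underlying C \<kappa>))"
      by (simp_all add: induced_eq A.MObj_underlying)
    show "mf_ob ?I a \<in> MObj (underlying D \<mu>)" if "a \<in> MObj (underlying C \<kappa>)" for a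
      using that by (simp add: A.MObj_underlying B.MObj_underlying ob)
    show "mf_arr ?I f \<in> mhom (underlying D \<mu>) (map (mf_ob ?I) xs) (mf_ob ?I y)" if "f \<in> mhom (underlying C \<kappa>) xs y" for f xs y
    proof -
      have f: "f \<in> MArr (underlying C \<kappa>)" "set xs \<subseteq> Obj C" "fst f = xs" "snd f \<in> Arr C" "Dom C (snd f) = kbar C \<kappa> xs" "Cod C (snd f) = y"
        using that by (auto simp: A.mhom_underlying A.MArr_underlying)
      have "y \<in> Obj C" using f by auto
      then show ?thesis
        using induced_arr_typed[OF f(2,4,5)] f Fs_Obj[OF f(2)] by (simp add: I B.mhom_underlying obs ob)
    qed
    show "mf_arr ?I (MId (underlying C \<kappa>) a) = MId (underlying D \<mu>) (mf_ob ?I a)" if "a \<in> MObj (underlying C \<kappa>)" for a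
    proof -
      have a: "a \<in> Obj C" using that by (simp add: A.MObj_underlying)
      have "MId (underlying C \<kappa>) a \<in> MArr (underlying C \<kappa>)" using M.MId_mhom[OF that] by (simp add: mhom_def)
      from I[OF this] show ?thesis
        using induced_Id[OF a] a by (simp add: A.MId_underlying B.MId_underlying ob)
    qed
    show "mf_arr ?I (MComp (underlying C \<kappa>) g fs) = MComp (underlying D \<mu>) (mf_arr ?I g) (map (mf_arr ?I) fs)"
      if gf: "mcomposable (underlying C \<kappa>) g fs" for g fs
    proof -
      have m: "MComp (underlying C \<kappa>) g fs \<in> MArr (underlying C \<kappa>)" using M.MComp_mhom[OF gf] by (simp add: mhom_def)
      have g: "g \<in> MArr (underlying C \<kappa>)" "set fs \<subseteq> MArr (underlying C \<kappa>)" using gf by (simp_all add: mcomposable_def)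
      have mi: "map (mf_arr ?I) fs = map (\<lambda>f. (Fs (fst f), induced_arr (fst f) (snd f))) fs" using g(2) I by auto
      have s: "fst (MComp (underlying C \<kappa>) g fs) = concat (map fst fs)" by (simp add: A.MComp_underlying)
      show ?thesis
        unfolding I[OF m] I[OF g(1)] mi s induced_Comp[OF gf]
        by (rule prod_eqI) (simp_all add: B.MComp_underlying map_concat comp_def)
    qed
    show "mf_arr ?I (MAct (underlying C \<kappa>) \<sigma> f) = MAct (underlying D \<mu>) \<sigma> (mf_arr ?I f)"
      if f: "f \<in> mhom (underlying C \<kappa>) xs y" and \<sigma>: "\<sigma> permutes {..<length xs}" for f xs y \<sigma>
    proof -
      have m: "f \<in> MArr (underlying C \<kappa>)" "MAct (underlying C \<kappa>) \<sigma> f \<in> MArr (underlying C \<kappa>)"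
        using f M.MAct_mhom[OF f \<sigma>] by (simp_all add: mhom_def)
      have f': "set (fst f) \<subseteq> Obj C" "snd f \<in> Arr C" "Dom C (snd f) = kbar C \<kappa> (fst f)" "\<sigma> permutes {..<length (fst f)}"
        using f \<sigma> by (auto simp: A.mhom_underlying)
      show ?thesis
        unfolding I[OF m(1)] I[OF m(2)]
        using induced_Act[OF f'] f'(4) by (simp add: A.MAct_underlying B.MAct_underlying permute_list_map)
    qed
  qed
qed

end

section \<open>Functoriality\<close>

lemma lax_functor_with_word_choicesI:
  "\<lbrakk>lax_symmetric_monoidal_functor C D F; word_choice C \<kappa>; word_choice D \<mu>\<rbrakk>
    \<Longrightarrow> lax_functor_with_word_choices C D F \<kappa> \<mu>"
  by (simp add: lax_functor_with_word_choices_def smc_with_word_choice_def smc_with_word_choice_axioms_def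
    lax_symmetric_monoidal_functor_def)

lemma induced_lax_id:
  assumes "lax_symmetric_monoidal_functor C C (lax_id C)" "word_choice C \<kappa>"
  shows "induced \<kappa> \<kappa> (lax_id C) = mf_id (underlying C \<kappa>)"
proof -
  interpret I: lax_functor_with_word_choices C C "lax_id C" \<kappa> \<kappa>
    by (intro lax_functor_with_word_choicesI assms)
  have ob: "lax_ob (lax_id C) a = a" if "a \<in> Obj C" for a using that by (simp add: lax_id_def)
  have arr: "lax_arr (lax_id C) f = f" if "f \<in> Arr C" for f using that by (simp add: lax_id_def)
  have eta: "lax_eta (lax_id C) = \<i>\<^bsub>C\<^esub> \<e>\<^bsub>C\<^esub>" by (simp add: lax_id_def)
  have xi: "lax_xi (lax_id C) (a, b) = \<i>\<^bsub>C\<^esub> (a \<oplus>\<^bsub>C\<^esub> b)" if "a \<in> Obj C" "b \<in> Obj C" for a b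
    using that by (simp add: lax_id_def)
  have xi_word: "I.xi_word w xs = \<i>\<^bsub>C\<^esub> (y_eval C w xs)" if "vars_below w (length xs)" "set xs \<subseteq> Obj C" for w xs
    using that(1) by (induction w) (use that(2) ob in \<open>simp_all add: subset_iff eta xi\<close>)
  have obs: "I.Fs xs = xs" if "set xs \<subseteq> Obj C" for xs
    using that ob by (auto simp: subset_iff intro!: map_idI)
  have "(I.Fs (fst f), I.induced_arr (fst f) (snd f)) = f" if "f \<in> MArr (underlying C \<kappa>)" for f
  proof -
    have f: "set (fst f) \<subseteq> Obj C" "snd f \<in> Arr C" "Dom C (snd f) = kbar C \<kappa> (fst f)"
      using that by (simp_all add: I.A.MArr_underlying)
    have "y_can C (\<kappa> (fst f)) (\<kappa> (fst f)) (fst f) = \<i>\<^bsub>C\<^esub> (kbar C \<kappa> (fst f))"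
      using I.C.y_can_refl[OF I.A.kappa_Y_obj[OF f(1)] f(1)] by (simp add: kbar_def)
    moreover have "I.xi_word (\<kappa> (fst f)) (fst f) = \<i>\<^bsub>C\<^esub> (kbar C \<kappa> (fst f))"
      using xi_word[OF _ f(1), of "\<kappa> (fst f)"] I.A.kappa_vars[OF f(1)] by (simp add: kbar_def)
    ultimately show ?thesis
      using f obs[OF f(1)] by (simp add: I.induced_arr_def arr)
  qed
  then show ?thesis
    unfolding I.induced_eq mf_id_def by (auto simp: I.A.MObj_underlying fun_eq_iff restrict_def ob)
qed

text \<open>
  The structure map of a composite functor at a word is the composite of the structure maps. The map
  \<open>G\<close> applied to the change of words in the middle is exchanged with \<open>\<xi>\<close> of \<open>G\<close> by \<open>y_can_lax\<close> and
  composes with the change of words of \<open>G\<close>.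
\<close>

lemma induced_lax_comp:
  assumes F: "lax_symmetric_monoidal_functor C D F" and G: "lax_symmetric_monoidal_functor D E G"
    and GF: "lax_symmetric_monoidal_functor C E (lax_comp G F)"
    and ch: "word_choice C \<kappa>" "word_choice D \<mu>" "word_choice E \<nu>"
  shows "induced \<kappa> \<nu> (lax_comp G F) = mf_comp (induced \<mu> \<nu> G) (induced \<kappa> \<mu> F)"
proof -
  interpret F: lax_functor_with_word_choices C D F \<kappa> \<mu>
    by (intro lax_functor_with_word_choicesI F ch)
  interpret G: lax_functor_with_word_choices D E G \<mu> \<nu>
    by (intro lax_functor_with_word_choicesI G ch)
  interpret H: lax_functor_with_word_choices C E "lax_comp G F" \<kappa> \<nu>
    by (intro lax_functor_with_word_choicesI GF ch)
  have ob: "lax_ob (lax_comp G F) a = lax_ob G (lax_ob F a)" if "a \<in> Obj C" for a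
    using that by (simp add: lax_comp_def F.lax_dom compose_def)
  have arr: "lax_arr (lax_comp G F) f = lax_arr G (lax_arr F f)" if "f \<in> Arr C" for f
    using that by (simp add: lax_comp_def F.lax_dom compose_def)
  have obs: "H.Fs xs = G.Fs (F.Fs xs)" if "set xs \<subseteq> Obj C" for xs
    using that ob by (auto simp: subset_iff)
  have xi: "H.xi_word w xs = lax_arr G (F.xi_word w xs) \<cdot>\<^bsub>E\<^esub> G.xi_word w (F.Fs xs)"
    if "vars_below w (length xs)" and xs: "set xs \<subseteq> Obj C" for w xs
    using that(1)
  proof (induction w)
    case YE
    have "lax_eta (lax_comp G F) = lax_arr G (lax_eta F) \<cdot>\<^bsub>E\<^esub> lax_eta G"
      by (simp add: lax_comp_def G.lax_cod)
    then show ?case by simp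
  next
    case (YVar i)
    then have "xs ! i \<in> Obj C" using xs by auto
    then show ?case using YVar by (simp add: ob)
  next
    case (YSum u v)
    have uv: "vars_below u (length xs)" "vars_below v (length xs)"
      "vars_below u (length (F.Fs xs))" "vars_below v (length (F.Fs xs))" using YSum.prems by auto
    note Fo = F.Fs_Obj[OF xs]
    let ?a = "y_eval C u xs" and ?b = "y_eval C v xs"
    let ?x = "F.xi_word u xs" and ?y = "F.xi_word v xs" and ?x' = "G.xi_word u (F.Fs xs)" and ?y' = "G.xi_word v (F.Fs xs)"
    note ev = F.C.y_eval_Obj_list[OF uv(1) xs] F.C.y_eval_Obj_list[OF uv(2) xs]
      F.D.y_eval_Obj_list[OF uv(3) Fo] F.D.y_eval_Obj_list[OF uv(4) Fo]
    note t = F.xi_word_typed[OF uv(1) xs] F.xi_word_typed[OF uv(2) xs] G.xi_word_typed[OF uv(3) Fo] G.xi_word_typed[OF uv(4) Fo]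
    have "lax_xi (lax_comp G F) (?a, ?b) = lax_arr G (lax_xi F (?a, ?b)) \<cdot>\<^bsub>E\<^esub> lax_xi G (lax_ob F ?a, lax_ob F ?b)"
      using ev by (simp add: lax_comp_def F.lax_dom G.lax_cod)
    then have "H.xi_word (YSum u v) xs = (lax_arr G (lax_xi F (?a, ?b)) \<cdot>\<^bsub>E\<^esub> lax_xi G (lax_ob F ?a, lax_ob F ?b))
        \<cdot>\<^bsub>E\<^esub> ((lax_arr G ?x \<cdot>\<^bsub>E\<^esub> ?x') \<uplus>\<^bsub>E\<^esub> (lax_arr G ?y \<cdot>\<^bsub>E\<^esub> ?y'))"
      using YSum.IH uv by simp
    also have "\<dots> = lax_arr G (lax_xi F (?a, ?b)) \<cdot>\<^bsub>E\<^esub> ((lax_xi G (Cod D ?x, Cod D ?y)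
        \<cdot>\<^bsub>E\<^esub> (lax_arr G ?x \<uplus>\<^bsub>E\<^esub> lax_arr G ?y)) \<cdot>\<^bsub>E\<^esub> (?x' \<uplus>\<^bsub>E\<^esub> ?y'))"
      using t ev by (simp add: G.D.assoc G.D.interchange del: map_map)
    also have "\<dots> = lax_arr G (lax_xi F (?a, ?b)) \<cdot>\<^bsub>E\<^esub> ((lax_arr G (?x \<uplus>\<^bsub>D\<^esub> ?y) \<cdot>\<^bsub>E\<^esub> lax_xi G (Dom D ?x, Dom D ?y)) \<cdot>\<^bsub>E\<^esub> (?x' \<uplus>\<^bsub>E\<^esub> ?y'))"
      unfolding G.xi_nat[OF t(1) t(4)] ..
    also have "\<dots> = lax_arr G (F.xi_word (YSum u v) xs) \<cdot>\<^bsub>E\<^esub> G.xi_word (YSum u v) (F.Fs xs)"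
      using t ev by (simp add: G.D.assoc G.lax_arr_Comp del: map_map)
    finally show ?case .
  qed
  have induced_arr: "H.induced_arr xs f = G.induced_arr (F.Fs xs) (F.induced_arr xs f)"
    if f: "set xs \<subseteq> Obj C" "f \<in> Arr C" "Dom C f = kbar C \<kappa> xs" for xs f
  proof -
    let ?k = "\<kappa> xs" and ?m = "\<mu> (F.Fs xs)" and ?n = "\<nu> (G.Fs (F.Fs xs))" and ?Y = "F.Fs xs" and ?Z = "G.Fs (F.Fs xs)"
    note Fo = F.Fs_Obj[OF f(1)] and Go = G.Fs_Obj[OF F.Fs_Obj[OF f(1)]]
    have w: "?k \<in> Y_obj (length ?Y)" "?m \<in> Y_obj (length ?Y)" "?k \<in> Y_obj (length ?Z)" "?m \<in> Y_obj (length ?Z)" "?n \<in> Y_obj (length ?Z)"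
      using F.words_Y_obj[OF f(1)] G.words_Y_obj[OF Fo] by simp_all
    let ?d = "y_can D ?m ?k ?Y" and ?p = "y_can E ?m ?k ?Z" and ?q = "y_can E ?n ?m ?Z"
    have key: "?p \<cdot>\<^bsub>E\<^esub> ?q = y_can E ?n ?k ?Z"
      by (rule G.D.canonical_unique[OF canonical_Comp[OF G.D.canonical_y_can[OF w(4,3) Go] G.D.canonical_y_can[OF w(5,4) Go]]
         G.D.canonical_y_can[OF w(5,3) Go] w(5) Go])
    note d = F.change_typed[OF f(1)] and q = G.change_typed[OF Fo] and p = G.D.y_can_typed[OF w(4,3) Go]
      and x = F.xi_kappa_typed[OF f(1)] and x' = G.xi_kappa_typed[OF Fo]
    have vk: "vars_below ?k (length xs)" "vars_below ?k (length ?Y)" using F.A.kappa_vars[OF f(1)] by simp_all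
    note xk = G.xi_word_typed[OF vk(2) Fo]
    have "G.induced_arr ?Y (F.induced_arr xs f)
      = lax_arr G (lax_arr F f) \<cdot>\<^bsub>E\<^esub> (lax_arr G (F.xi_word ?k xs) \<cdot>\<^bsub>E\<^esub> ((lax_arr G ?d \<cdot>\<^bsub>E\<^esub> G.xi_word ?m ?Y) \<cdot>\<^bsub>E\<^esub> ?q))"
      unfolding G.induced_arr_def F.induced_arr_def
      using f d x x' q by (simp add: G.lax_arr_Comp G.D.assoc kbar_def del: map_map)
    also have "\<dots> = lax_arr G (lax_arr F f) \<cdot>\<^bsub>E\<^esub> ((lax_arr G (F.xi_word ?k xs) \<cdot>\<^bsub>E\<^esub> G.xi_word ?k ?Y) \<cdot>\<^bsub>E\<^esub> (?p \<cdot>\<^bsub>E\<^esub> ?q))"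
      unfolding G.y_can_lax[OF w(2,1) Fo] using x xk p q by (simp add: G.D.assoc del: map_map)
    also have "\<dots> = H.induced_arr xs f"
      unfolding H.induced_arr_def key xi[OF vk(1) f(1)] obs[OF f(1)] arr[OF f(2)] ..
    finally show ?thesis ..
  qed
  have "mf_arr (induced \<mu> \<nu> G) (mf_arr (induced \<kappa> \<mu> F) g) = (H.Fs (fst g), H.induced_arr (fst g) (snd g))"
    if g: "g \<in> MArr (underlying C \<kappa>)" for g
  proof -
    have g': "set (fst g) \<subseteq> Obj C" "snd g \<in> Arr C" "Dom C (snd g) = kbar C \<kappa> (fst g)"
      using g by (simp_all add: F.A.MArr_underlying)
    have "(F.Fs (fst g), F.induced_arr (fst g) (snd g)) \<in> MArr (underlying D \<mu>)"
      using F.induced_arr_typed[OF g'] F.Fs_Obj[OF g'(1)] by (simp add: F.B.MArr_underlying)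
    then show ?thesis
      using g induced_arr[OF g'] obs[OF g'(1)] by (simp add: F.induced_eq G.induced_eq)
  qed
  note arrows = this
  show ?thesis
  proof (rule mfun.equality)
    show "mf_ob (induced \<kappa> \<nu> (lax_comp G F)) = mf_ob (mf_comp (induced \<mu> \<nu> G) (induced \<kappa> \<mu> F))"
      by (auto simp: H.induced_eq F.induced_eq G.induced_eq mf_comp_def F.A.MObj_underlying compose_def fun_eq_iff ob)
    have "mf_arr (induced \<kappa> \<nu> (lax_comp G F))
        = (\<lambda>g\<in>MArr (underlying C \<kappa>). mf_arr (induced \<mu> \<nu> G) (mf_arr (induced \<kappa> \<mu> F) g))"
      unfolding H.induced_eq mfun.select_convs by (rule restrict_ext) (rule arrows[symmetric])
    then show "mf_arr (induced \<kappa> \<nu> (lax_comp G F)) = mf_arr (mf_comp (induced \<mu> \<nu> G) (induced \<kappa> \<mu> F))"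
      by (simp add: mf_comp_def compose_def F.induced_eq)
  qed (simp_all add: H.induced_eq F.induced_eq G.induced_eq mf_comp_def)
qed

lemma mhom_MArr: "f \<in> mhom M xs y \<Longrightarrow> f \<in> MArr M"
  by (simp add: mhom_def)

context multifunctor
begin

lemma mf_arr_MArr: "f \<in> MArr M \<Longrightarrow> mf_arr F f \<in> MArr N"
  using mf_arr_mhom[of f "MSrc M f" "MTgt M f"] by (simp add: mhom_def)

lemma mf_arr_MSrc: "f \<in> MArr M \<Longrightarrow> MSrc N (mf_arr F f) = map (mf_ob F) (MSrc M f)"
  using mf_arr_mhom[of f "MSrc M f" "MTgt M f"] by (simp add: mhom_def)

lemma mf_arr_MTgt: "f \<in> MArr M \<Longrightarrow> MTgt N (mf_arr F f) = mf_ob F (MTgt M f)"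
  using mf_arr_mhom[of f "MSrc M f" "MTgt M f"] by (simp add: mhom_def)

lemma mf_arr_mcomposable:
  assumes "mcomposable M g fs"
  shows "mcomposable N (mf_arr F g) (map (mf_arr F) fs)"
proof -
  have "map (MTgt N) (map (mf_arr F) fs) = map (mf_ob F) (map (MTgt M) fs)"
  proof -
    have "set fs \<subseteq> MArr M" using assms by (simp add: mcomposable_def)
    then show ?thesis by (simp add: mf_arr_MTgt subset_iff)
  qed
  with assms show ?thesis
    by (auto simp: mcomposable_def mf_arr_MArr mf_arr_MSrc subset_iff simp del: map_map)
qed

end

lemma mf_comp_multifunctor:
  assumes "multifunctor M N F" "multifunctor N P G"
  shows "multifunctor M P (mf_comp G F)"
proof -
  interpret F: multifunctor M N F by fact
  interpret G: multifunctor N P G by fact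
  let ?H = "mf_comp G F"
  have ob: "mf_ob ?H a = mf_ob G (mf_ob F a)" if "a \<in> MObj M" for a
    using that by (simp add: mf_comp_def F.mf_dom compose_def)
  have arr: "mf_arr ?H f = mf_arr G (mf_arr F f)" if "f \<in> MArr M" for f
    using that by (simp add: mf_comp_def F.mf_dom compose_def)
  show ?thesis
  proof
    show "mf_dom ?H = M" "mf_cod ?H = P" by (simp_all add: mf_comp_def F.mf_dom G.mf_cod)
    show "mf_ob ?H \<in> extensional (MObj M)" "mf_arr ?H \<in> extensional (MArr M)"
      by (simp_all add: mf_comp_def F.mf_dom)
    show "mf_ob ?H a \<in> MObj P" if "a \<in> MObj M" for a
      using that by (simp add: ob F.mf_ob_MObj G.mf_ob_MObj)
    show "mf_arr ?H f \<in> mhom P (map (mf_ob ?H) xs) (mf_ob ?H y)" if f: "f \<in> mhom M xs y" for f xs y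
    proof -
      have "set xs \<subseteq> MObj M" "y \<in> MObj M" using f F.M.MSrc_MObj F.M.MTgt_MObj by (auto simp: mhom_def)
      then have "map (mf_ob ?H) xs = map (mf_ob G) (map (mf_ob F) xs)" "mf_ob ?H y = mf_ob G (mf_ob F y)"
        using ob by (auto simp: subset_iff)
      then show ?thesis using G.mf_arr_mhom[OF F.mf_arr_mhom[OF f]] arr[OF mhom_MArr[OF f]] by (simp only:)
    qed
    show "mf_arr ?H (MId M a) = MId P (mf_ob ?H a)" if "a \<in> MObj M" for a
      using that arr[OF mhom_MArr[OF F.M.MId_mhom[OF that]]] by (simp add: ob F.mf_arr_MId G.mf_arr_MId F.mf_ob_MObj)
    show "mf_arr ?H (MComp M g fs) = MComp P (mf_arr ?H g) (map (mf_arr ?H) fs)" if gf: "mcomposable M g fs" for g fs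
    proof -
      have "g \<in> MArr M" "map (mf_arr ?H) fs = map (mf_arr G) (map (mf_arr F) fs)"
        using gf arr by (auto simp: mcomposable_def subset_iff)
      then show ?thesis
        using arr[OF mhom_MArr[OF F.M.MComp_mhom[OF gf]]] F.mf_arr_MComp[OF gf] G.mf_arr_MComp[OF F.mf_arr_mcomposable[OF gf]]
        by (simp add: arr del: map_map)
    qed
    show "mf_arr ?H (MAct M \<sigma> f) = MAct P \<sigma> (mf_arr ?H f)" if f: "f \<in> mhom M xs y" and \<sigma>: "\<sigma> permutes {..<length xs}" for f xs y \<sigma>
      using arr[OF mhom_MArr[OF F.M.MAct_mhom[OF f \<sigma>]]] arr[OF mhom_MArr[OF f]] F.mf_arr_MAct[OF f \<sigma>]
        G.mf_arr_MAct[OF F.mf_arr_mhom[OF f], of \<sigma>] \<sigma> by simp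
  qed
qed

lemma mf_id_multifunctor:
  assumes "multicategory M"
  shows "multifunctor M M (mf_id M)"
proof -
  interpret multicategory M by fact
  have ob: "mf_ob (mf_id M) a = a" if "a \<in> MObj M" for a using that by (simp add: mf_id_def)
  have arr: "mf_arr (mf_id M) f = f" if "f \<in> MArr M" for f using that by (simp add: mf_id_def)
  show ?thesis
  proof
    show "mf_dom (mf_id M) = M" "mf_cod (mf_id M) = M" "mf_ob (mf_id M) \<in> extensional (MObj M)"
      "mf_arr (mf_id M) \<in> extensional (MArr M)" by (simp_all add: mf_id_def)
    show "mf_arr (mf_id M) f \<in> mhom M (map (mf_ob (mf_id M)) xs) (mf_ob (mf_id M) y)" if f: "f \<in> mhom M xs y" for f xs y
    proof -
      have "set xs \<subseteq> MObj M" "y \<in> MObj M" using f MSrc_MObj MTgt_MObj by (auto simp: mhom_def)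
      then have "map (mf_ob (mf_id M)) xs = xs" "mf_ob (mf_id M) y = y" using ob by (auto simp: subset_iff intro!: map_idI)
      then show ?thesis using f arr[OF mhom_MArr[OF f]] by simp
    qed
    show "mf_arr (mf_id M) (MComp M g fs) = MComp M (mf_arr (mf_id M) g) (map (mf_arr (mf_id M)) fs)" if gf: "mcomposable M g fs" for g fs
    proof -
      have "g \<in> MArr M" "map (mf_arr (mf_id M)) fs = fs"
        using gf arr by (auto simp: mcomposable_def subset_iff intro!: map_idI)
      then show ?thesis using arr[OF mhom_MArr[OF MComp_mhom[OF gf]]] arr by simp
    qed
    show "mf_arr (mf_id M) (MAct M \<sigma> f) = MAct M \<sigma> (mf_arr (mf_id M) f)" if "f \<in> mhom M xs y" "\<sigma> permutes {..<length xs}" for f xs y \<sigma>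
      using arr[OF mhom_MArr[OF MAct_mhom[OF that]]] arr[OF mhom_MArr[OF that(1)]] by simp
  qed (simp_all add: ob arr[OF mhom_MArr[OF MId_mhom]])
qed

lemma hom_Multicat: "F \<in> hom Multicat M N \<longleftrightarrow> multifunctor M N F"
proof
  show "multifunctor M N F" if "F \<in> hom Multicat M N" using that by (auto simp: hom_def Multicat_def)
  show "F \<in> hom Multicat M N" if "multifunctor M N F"
    using multifunctor.mf_dom[OF that] multifunctor.mf_cod[OF that] that by (simp add: hom_def Multicat_def)
qed

theorem Multicat_category: "category Multicat"
proof
  show "Dom Multicat F \<in> Obj Multicat" "Cod Multicat F \<in> Obj Multicat" if "F \<in> Arr Multicat" for F
    using that by (simp_all add: Multicat_def multifunctor_def)
  show "Ident Multicat M \<in> hom Multicat M M" if "M \<in> Obj Multicat" for M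
    using that mf_id_multifunctor unfolding hom_Multicat by (simp add: Multicat_def)
  show "Comp Multicat G F \<in> hom Multicat M P" if "G \<in> hom Multicat N P" "F \<in> hom Multicat M N" for G F M N P
    using that mf_comp_multifunctor unfolding hom_Multicat by (simp add: Multicat_def)
  show "Comp Multicat (Ident Multicat N) F = F" if "F \<in> hom Multicat M N" for F M N
  proof -
    interpret multifunctor M N F using that by (simp add: hom_Multicat)
    show ?thesis
    proof (rule mfun.equality)
      show "mf_ob (Comp Multicat (Ident Multicat N) F) = mf_ob F"
        using mf_ob_MObj mf_ob_ext by (auto simp: Multicat_def mf_comp_def mf_id_def mf_dom compose_def fun_eq_iff extensional_def)
      show "mf_arr (Comp Multicat (Ident Multicat N) F) = mf_arr F"
        using mf_arr_MArr mf_arr_ext by (auto simp: Multicat_def mf_comp_def mf_id_def mf_dom compose_def fun_eq_iff extensional_def)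
    qed (simp_all add: Multicat_def mf_comp_def mf_id_def mf_cod)
  qed
  show "Comp Multicat F (Ident Multicat M) = F" if "F \<in> hom Multicat M N" for F M N
  proof -
    interpret multifunctor M N F using that by (simp add: hom_Multicat)
    show ?thesis
    proof (rule mfun.equality)
      show "mf_ob (Comp Multicat F (Ident Multicat M)) = mf_ob F"
        using mf_ob_ext by (auto simp: Multicat_def mf_comp_def mf_id_def compose_def fun_eq_iff extensional_def)
      show "mf_arr (Comp Multicat F (Ident Multicat M)) = mf_arr F"
        using mf_arr_ext by (auto simp: Multicat_def mf_comp_def mf_id_def compose_def fun_eq_iff extensional_def)
    qed (simp_all add: Multicat_def mf_comp_def mf_id_def mf_dom)
  qed
  show "Comp Multicat (Comp Multicat H G) F = Comp Multicat H (Comp Multicat G F)"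
    if "H \<in> hom Multicat N P" "G \<in> hom Multicat K N" "F \<in> hom Multicat M K" for H G F M N P K
  proof -
    interpret F: multifunctor M K F using that by (simp add: hom_Multicat)
    interpret G: multifunctor K N G using that by (simp add: hom_Multicat)
    show ?thesis
      using F.mf_ob_MObj F.mf_arr_MArr
      by (auto simp: Multicat_def mf_comp_def F.mf_dom G.mf_dom compose_def fun_eq_iff restrict_def)
  qed
qed

theorem corollary2p5:
  fixes S :: "(('o, 'm) smc, ('o, 'm) lax) cat"
    and \<kappa> :: "('o, 'm) smc \<Rightarrow> 'o list \<Rightarrow> yword"
  assumes "subcategory S SMCat_lax"
    and "\<And>C. C \<in> Obj S \<Longrightarrow> word_choice C (\<kappa> C)"
  shows "\<exists>Uo Ua. cat_functor S Multicat Uo Ua \<and>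
    (\<forall>C\<in>Obj S. Uo C = underlying C (\<kappa> C)) \<and>
    (\<forall>F\<in>Arr S. Ua F = induced (\<kappa> (lax_dom F)) (\<kappa> (lax_cod F)) F)"
proof -
  let ?Uo = "\<lambda>C. underlying C (\<kappa> C)" and ?Ua = "\<lambda>F. induced (\<kappa> (lax_dom F)) (\<kappa> (lax_cod F)) F"
  interpret S: category S using assms(1) by (simp add: subcategory_def)
  have smc: "symmetric_monoidal_category C" if "C \<in> Obj S" for C
    using assms(1) that by (auto simp: subcategory_def SMCat_lax_def)
  have homS: "lax_symmetric_monoidal_functor C D F \<and> lax_dom F = C \<and> lax_cod F = D \<and> F \<in> Arr S \<and> C \<in> Obj S \<and> D \<in> Obj S"
    if "F \<in> hom S C D" for C D F
  proof -
    have F: "F \<in> Arr S" "Dom S F = C" "Cod S F = D" using that by (auto simp: hom_def)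
    then have "lax_dom F = C" "lax_cod F = D" "lax_symmetric_monoidal_functor (lax_dom F) (lax_cod F) F"
      using assms(1) by (auto simp: subcategory_def SMCat_lax_def)
    then show ?thesis using F S.Dom_Obj[OF F(1)] S.Cod_Obj[OF F(1)] by simp
  qed
  have "cat_functor S Multicat ?Uo ?Ua"
  proof (intro cat_functor.intro cat_functor_axioms.intro)
    show "category S" by unfold_locales
    show "category Multicat" by (rule Multicat_category)
    show "?Uo C \<in> Obj Multicat" if "C \<in> Obj S" for C
    proof -
      interpret smc_with_word_choice C "\<kappa> C"
        using smc[OF that] assms(2)[OF that] by (simp add: smc_with_word_choice_def smc_with_word_choice_axioms_def)
      show ?thesis using underlying_multicategory by (simp add: Multicat_def)
    qed
    show "?Ua F \<in> hom Multicat (?Uo C) (?Uo D)" if "F \<in> hom S C D" for F C D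
    proof -
      note F = homS[OF that]
      interpret lax_functor_with_word_choices C D F "\<kappa> C" "\<kappa> D"
        using F assms(2) by (intro lax_functor_with_word_choicesI) simp_all
      show ?thesis using induced_multifunctor F by (simp add: hom_Multicat)
    qed
    show "?Ua (Ident S C) = Ident Multicat (?Uo C)" if C: "C \<in> Obj S" for C
    proof -
      have I: "Ident S C = lax_id C" using assms(1) C by (simp add: subcategory_def SMCat_lax_def)
      note h = homS[OF S.Ident_hom[OF C], unfolded I]
      show ?thesis using induced_lax_id[of C "\<kappa> C"] h assms(2)[OF C] by (simp add: I Multicat_def)
    qed
    show "?Ua (Comp S G F) = Comp Multicat (?Ua G) (?Ua F)" if G: "G \<in> hom S D E" and F: "F \<in> hom S C D" for G F C D E
    proof -
      have "G \<in> Arr S" "F \<in> Arr S" "Cod S F = Dom S G" using F G by (auto simp: hom_def)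
      then have c: "Comp S G F = lax_comp G F" using assms(1) by (simp add: subcategory_def SMCat_lax_def)
      note h = homS[OF S.Comp_hom[OF G F], unfolded c] and hG = homS[OF G] and hF = homS[OF F]
      show ?thesis
        using induced_lax_comp[of C D F E G "\<kappa> C" "\<kappa> D" "\<kappa> E"] h hG hF assms(2) by (simp add: c Multicat_def)
    qed
  qed
  then show ?thesis by (intro exI[of _ ?Uo] exI[of _ ?Ua]) simp
qed

end
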